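(* Let $1<p<n$ be integers, let $\Omega$ be a bounded domain in $\mathbb R^n$, and let $u\in C^4(\Omega)\cap C^{1,1}(\overline\Omega)$ be a $p$-plurisubharmonic function solving the equation $$\mathcal M_p(u)(x)=f(x,u(x))\quad\text{in }\Omega,$$ where $f\in C^{1,1}(\overline\Omega\times\mathbb R)$ is given. Suppose that $f\ge f_0>0$ for a constant $f_0$, and that there is a $p$-plurisubharmonic function $w$ in $\Omega$ (continuous up to $\partial\Omega$) satisfying $w>u$ in $\Omega$ and $w=u$ on $\partial\Omega$. Then for any fixed $\delta>0$ there is a bound $$(w(x)-u(x))^{1+\delta}\,|D^2u(x)|\le C\qquad\text{for all }x\in\Omega,$$ where (for the fixed $\delta$) the constant $C$ depends only on $n$, $p$, $f_0$, $\sup_\Omega(|Du|+|Dw|)$ and $\|f\|_{C^{1,1}}$.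
   Context: A $C^2$ function $u$ on a domain $\Omega\subset\mathbb R^n$ is called $p$-plurisubharmonic if at every $x\in\Omega$ the eigenvalues $\lambda_1,\dots,\lambda_n$ of the Hessian $D^2u(x)$ satisfy $\lambda_{i_1}+\cdots+\lambda_{i_p}\ge 0$ for all $1\le i_1<\cdots<i_p\le n$. The operator $\mathcal M_p$ is defined by $$\mathcal M_p(u)(x)=\prod_{1\le i_1<i_2<\cdots<i_p\le n}(\lambda_{i_1}+\cdots+\lambda_{i_p}),$$ where $\lambda_1,\dots,\lambda_n$ are the eigenvalues of $D^2u(x)$. *)

theory Defs
  imports "HOL-Analysis.Analysis" "HOL-Computational_Algebra.Polynomial"
begin

definition partial_deriv :: "'a::euclidean_space \<Rightarrow> ('a \<Rightarrow> real) \<Rightarrow> 'a \<Rightarrow> real" where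
  "partial_deriv b g x = frechet_derivative g (at x) b"

definition grad :: "('a::euclidean_space \<Rightarrow> real) \<Rightarrow> 'a \<Rightarrow> 'a" where
  "grad g x = (\<Sum>b\<in>Basis. partial_deriv b g x *\<^sub>R b)"

(* The class C^k(S) for an open set S. *)
primrec Ck_on :: "nat \<Rightarrow> 'a::euclidean_space set \<Rightarrow> ('a \<Rightarrow> real) \<Rightarrow> bool" where
  "Ck_on 0 S g \<longleftrightarrow> continuous_on S g"
| "Ck_on (Suc k) S g \<longleftrightarrow>
     (\<forall>x\<in>S. g differentiable at x) \<and> (\<forall>b\<in>Basis. Ck_on k S (partial_deriv b g))"

(* The class C^{1,1}(closure S) for an open set S: derivatives are taken in S only, but g is
   continuous up to the boundary, and g, Dg are bounded and Dg is Lipschitz uniformly on S.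
   In particular Dg extends continuously to the closure. *)
definition C11_closure :: "'a::euclidean_space set \<Rightarrow> ('a \<Rightarrow> real) \<Rightarrow> bool" where
  "C11_closure S g \<longleftrightarrow>
     continuous_on (closure S) g \<and> Ck_on 1 S g \<and>
     bounded (g ` S) \<and> bounded (grad g ` S) \<and> (\<exists>L. L-lipschitz_on S (grad g))"

(* sup |g| + sup |Dg| + [Dg]_{0,1}.  The suprema are real-valued and hence meaningful only for
   functions in C11_closure S; pairs with x = y contribute 0 / 0 = 0. *)
definition C11_norm :: "'a::euclidean_space set \<Rightarrow> ('a \<Rightarrow> real) \<Rightarrow> real" where
  "C11_norm S g =
     (SUP x\<in>S. \<bar>g x\<bar>) + (SUP x\<in>S. norm (grad g x)) +
     (SUP (x, y)\<in>S \<times> S. dist (grad g x) (grad g y) / dist x y)"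

definition hessian :: "(real^'n \<Rightarrow> real) \<Rightarrow> real^'n \<Rightarrow> real^'n^'n" where
  "hessian g x = (\<chi> i j. partial_deriv (axis i 1) (partial_deriv (axis j 1) g) x)"

definition char_polynomial :: "real^'n^'n \<Rightarrow> real poly" where
  "char_polynomial A = det (mat [:0, 1:] - (\<chi> i j. [:A $ i $ j:]))"

(* The real eigenvalues in increasing order, repeated according to algebraic multiplicity.  For
   a symmetric matrix, such as the Hessian of a C^2 function, the list has length CARD('n). *)
definition eigenvalues :: "real^'n^'n \<Rightarrow> real list" where
  "eigenvalues A = sorted_list_of_multiset (proots (char_polynomial A))"

(* The sets I of p indices stand for 1 \<le> i_1 < ... < i_p \<le> n, shifted to start from 0. *)
definition p_plurisubharmonic :: "nat \<Rightarrow> (real^'n) set \<Rightarrow> (real^'n \<Rightarrow> real) \<Rightarrow> bool" where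
  "p_plurisubharmonic p \<Omega> g \<longleftrightarrow>
     Ck_on 2 \<Omega> g \<and>
     (\<forall>x\<in>\<Omega>. \<forall>I. I \<subseteq> {..<CARD('n)} \<and> card I = p \<longrightarrow>
        (\<Sum>i\<in>I. eigenvalues (hessian g x) ! i) \<ge> 0)"

definition M_op :: "nat \<Rightarrow> (real^'n \<Rightarrow> real) \<Rightarrow> real^'n \<Rightarrow> real" where
  "M_op p g x =
     (\<Prod>I\<in>{I. I \<subseteq> {..<CARD('n)} \<and> card I = p}. \<Sum>i\<in>I. eigenvalues (hessian g x) ! i)"

end

theory Submission
  imports Defs
begin

text \<open>
  Write l_0 \<le> ... \<le> l_m for the eigenvalues of D^2 u and a_i for the derivatives of the
  sum over I of ln l_I. For every orthonormal frame v, Ky Fan's inequality gives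
  ln f(x, u x) \<le> ln f(x0, u x0) + sum_i a_i (D^2 u(x)(v_i, v_i) - l_i(x0)), with equality at x0 for
  an eigenframe. This tangent inequality replaces the differentiation of eigenvalues: letting v rotate
  in a suitable plane along a line through x0 produces the good third-order terms
  2 (a_i - a_m) / (l_m - l_i) u_{mmi}^2.

  At a maximum of (w - u)^(1 + \<delta>) D^2 u(\<xi>, \<xi>) exp(\<alpha> |Du|^2), with \<xi> frozen to the top eigenvector, these
  terms absorb the bad ones in all directions with l_i \<ge> -\<epsilon> l_m, because
  1 + (1 + \<delta>/2) / (1 + \<delta>) < 2. In the remaining directions the first-order condition and the term
  \<alpha> a_i l_i^2 suffice. As a_m l_m \<ge> 1/p, there remains (w - u) l_m \<le> C. Finally w - u itself is bounded:
  Du and Dw are bounded, and a large ball in the domain would contradict f \<ge> f0.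
\<close>

section \<open>Orthonormal frames and eigenvalues\<close>

text \<open>Three obstacles shape the argument. The largest eigenvalue of D^2 u need not be
  differentiable where it is multiple, so the test function is maximised over all unit \<xi> and the
  direction is then frozen; a frozen second derivative of a C^4 function is of class C^2. As f is
  only C^{1,1}, the equation cannot be differentiated twice; a one-sided comparison at x0 needs only
  a quadratic lower bound for ln f(x, u x). Finally the third-order terms must balance. With \<beta>
  = 1 + \<delta>, the first-order condition makes \<beta> (D_i ln (w - u))^2 about 1 / \<beta> times
  (D_i ln u_mm)^2, so the bad terms carry the factor 1 + 1 / \<beta> against a good factor of nearly
  2 or more; \<beta> > 1 leaves room for cross terms and slightly negative l_i. The factor
  exp(\<alpha> |Du|^2) supplies 2 \<alpha> a_i l_i^2 at the price of multiples of (\<alpha> u_i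
  l_i)^2, which forces \<alpha> |Du|^2 to be small.

  C may not depend on the Lipschitz constant of Du; that constant only ensures that the maximum is
  attained inside the domain.\<close>

definition orthonormal_frame :: "(nat \<Rightarrow> 'a::euclidean_space) \<Rightarrow> bool" where
  "orthonormal_frame e \<longleftrightarrow> (\<forall>i<DIM('a). \<forall>j<DIM('a). e i \<bullet> e j = (if i = j then 1 else 0))"

lemma orthonormal_frameD:
  fixes e :: "nat \<Rightarrow> 'a::euclidean_space"
  assumes "orthonormal_frame e" "i < DIM('a)"
  shows "e i \<bullet> e i = 1" "norm (e i) = 1"
  using assms by (auto simp: orthonormal_frame_def norm_eq_1)

lemma orthonormal_frame_expansion:
  fixes e :: "nat \<Rightarrow> 'a::euclidean_space"
  assumes e: "orthonormal_frame e"
  shows "(\<Sum>i<DIM('a). (x \<bullet> e i) *\<^sub>R e i) = x"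
proof -
  let ?n = "DIM('a)"
  define B where "B = e ` {..<?n}"
  have inj: "inj_on e {..<?n}"
    using e by (auto simp: inj_on_def orthonormal_frame_def) (metis zero_neq_one)
  have "card B = ?n"
    by (simp add: B_def card_image inj)
  have orth: "pairwise orthogonal B"
    using e by (auto simp: pairwise_def B_def orthogonal_def orthonormal_frame_def)
  moreover have "0 \<notin> B"
    using e by (auto simp: B_def orthonormal_frame_def) (metis inner_zero_left zero_neq_one)
  ultimately have "independent B"
    by (rule pairwise_orthogonal_independent)
  then have span: "span B = UNIV"
    using \<open>card B = ?n\<close> by (metis card_eq_dim dim_UNIV subset_UNIV span_UNIV top_le B_def finite_imageI finite_lessThan)
  define y where "y = x - (\<Sum>i<?n. (x \<bullet> e i) *\<^sub>R e i)"
  have y: "y \<bullet> e j = 0" if "j < ?n" for j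
  proof -
    have "(\<Sum>i<?n. (x \<bullet> e i) * (e i \<bullet> e j)) = (\<Sum>i<?n. if i = j then x \<bullet> e i else 0)"
      using e that by (intro sum.cong) (auto simp: orthonormal_frame_def)
    then show ?thesis
      using that by (simp add: y_def inner_diff_left inner_sum_left)
  qed
  have "orthogonal y z" if "z \<in> span B" for z
    using that
    by (rule orthogonal_to_span) (auto simp: B_def orthogonal_def y)
  then have "orthogonal y y" by (simp add: span)
  then show ?thesis by (simp add: orthogonal_self y_def)
qed

lemma orthonormal_frame_inner:
  fixes e :: "nat \<Rightarrow> 'a::euclidean_space"
  assumes e: "orthonormal_frame e"
  shows "(\<Sum>i<DIM('a). (x \<bullet> e i) * (y \<bullet> e i)) = x \<bullet> y"
proof -
  have "x \<bullet> y = (\<Sum>i<DIM('a). (x \<bullet> e i) *\<^sub>R e i) \<bullet> y"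
    by (simp add: orthonormal_frame_expansion[OF e])
  then show ?thesis
    by (simp add: inner_sum_left inner_commute[of y])
qed

text \<open>A quadratic in t that vanishes at 0 and is never positive has its maximum at 0, so its
  linear coefficient vanishes. This is the first-variation step for the Rayleigh quotient
  below.\<close>

lemma linear_coeff_zero:
  fixes c d :: real
  assumes "\<And>t. 2 * t * c + t\<^sup>2 * d \<le> 0"
  shows "c = 0"
proof (rule ccontr)
  assume c: "c \<noteq> 0"
  \<comment> \<open>At t = c / k the linear term equals 2 c^2 / k, while the quadratic one is at
    least -c^2 / k because k \<ge> -d.\<close>
  define k where "k = 1 + \<bar>d\<bar>"
  have k: "k > 0" "d \<ge> - k" by (auto simp: k_def)
  have "2 * (c / k) * c + (c / k)\<^sup>2 * d \<le> 0" by (rule assms)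
  moreover have "(c / k)\<^sup>2 * d \<ge> (c / k)\<^sup>2 * (- k)"
    using k by (intro mult_left_mono) auto
  moreover have "(c / k)\<^sup>2 * (- k) = - (c\<^sup>2 / k)" "2 * (c / k) * c = 2 * (c\<^sup>2 / k)"
    using k by (auto simp: power2_eq_square field_simps)
  moreover have "c\<^sup>2 / k > 0" using c k by simp
  ultimately show False by linarith
qed

text \<open>The spectral theorem by induction: the next eigenvector maximises the Rayleigh quotient
  on the unit sphere of the orthogonal complement V of those already found, and self-adjointness
  keeps V invariant.\<close>

lemma selfadjoint_partial_eigenframe:
  fixes f :: "'a::euclidean_space \<Rightarrow> 'a"
  assumes lin: "linear f" and sym: "\<And>x y. f x \<bullet> y = x \<bullet> f y"
  assumes "k \<le> DIM('a)"
  shows "\<exists>e \<mu>. (\<forall>i<k. \<forall>j<k. e i \<bullet> e j = (if i = j then 1 else 0)) \<and>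
    (\<forall>i<k. f (e i) = \<mu> i *\<^sub>R e i)"
  using assms(3)
proof (induction k)
  case 0
  then show ?case by auto
next
  case (Suc k)
  then obtain e \<mu> where e: "\<And>i j. i < k \<Longrightarrow> j < k \<Longrightarrow> e i \<bullet> e j = (if i = j then 1 else 0)"
    and \<mu>: "\<And>i. i < k \<Longrightarrow> f (e i) = \<mu> i *\<^sub>R e i"
    by auto
  define V where "V = {x. \<forall>i<k. e i \<bullet> x = 0}"
  have subV: "subspace V"
    by (auto simp: V_def subspace_def inner_add_right)
  have fV: "f x \<in> V" if "x \<in> V" for x
    using that by (auto simp: V_def sym[symmetric] \<mu>)
  have "dim (e ` {..<k}) \<le> k"
    by (metis card_image_le dim_le_card finite_imageI finite_lessThan card_lessThan order_trans span_superset)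
  then have "dim (span (e ` {..<k})) < DIM('a)"
    using Suc.prems by (simp add: dim_span)
  then obtain z where z: "z \<noteq> 0" "\<And>y. y \<in> span (e ` {..<k}) \<Longrightarrow> orthogonal z y"
    using orthogonal_to_subspace_exists by (metis dim_span)
  have zV: "z \<in> V"
    using z(2)[OF span_base] by (auto simp: V_def orthogonal_def inner_commute[of _ z])
  have cV: "closed V" by (rule closed_subspace[OF subV])
  define K where "K = V \<inter> sphere 0 1"
  have "compact K" unfolding K_def using cV by (simp add: compact_Int_closed Int_commute closed_Int_compact)
  moreover have "K \<noteq> {}"
  proof -
    have "z /\<^sub>R norm z \<in> K" using zV z(1) subV by (auto simp: K_def subspace_scale)
    then show ?thesis by auto
  qed
  moreover have "continuous_on K (\<lambda>x. f x \<bullet> x)"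
    by (intro continuous_intros linear_continuous_on linear_conv_bounded_linear[THEN iffD1] lin)
  ultimately obtain x where x: "x \<in> K" and xmax: "\<And>y. y \<in> K \<Longrightarrow> f y \<bullet> y \<le> f x \<bullet> x"
    using continuous_attains_sup[of K "\<lambda>x. f x \<bullet> x"] by auto
  define m where "m = f x \<bullet> x"
  have nx: "x \<bullet> x = 1" and xV: "x \<in> V" using x by (auto simp: K_def norm_eq_1)
  have max: "f y \<bullet> y \<le> m * (y \<bullet> y)" if "y \<in> V" for y
  proof (cases "y = 0")
    case False
    have "y /\<^sub>R norm y \<in> K" using that False subV by (auto simp: K_def subspace_scale)
    from xmax[OF this] have "f y \<bullet> y / (norm y)\<^sup>2 \<le> m"
      by (simp add: linear_cmul[OF lin] m_def power2_eq_square field_simps)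
    then show ?thesis using False by (simp add: field_simps power2_norm_eq_inner)
  qed (simp add: linear_0[OF lin])
  \<comment> \<open>Varying x inside V in the direction of the residual w gives the first-order
    coefficient f x \<bullet> w - m (x \<bullet> w) = |w|^2, so the residual vanishes.\<close>
  define w where "w = f x - m *\<^sub>R x"
  have wV: "w \<in> V" unfolding w_def using fV[OF xV] xV subV by (simp add: subspace_diff subspace_scale)
  have "f x \<bullet> w - m * (x \<bullet> w) = 0"
  proof (rule linear_coeff_zero[where d = "f w \<bullet> w - m * (w \<bullet> w)"])
    fix t :: real
    have "x + t *\<^sub>R w \<in> V" using xV wV subV by (simp add: subspace_add subspace_scale)
    from max[OF this] have "f x \<bullet> x + t * (f x \<bullet> w) + t * (f w \<bullet> x) + t\<^sup>2 * (f w \<bullet> w)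
       \<le> m * (1 + 2 * t * (x \<bullet> w) + t\<^sup>2 * (w \<bullet> w))"
      by (simp add: linear_add[OF lin] linear_cmul[OF lin] algebra_simps nx power2_eq_square inner_commute)
    moreover have "f w \<bullet> x = f x \<bullet> w" by (metis sym inner_commute)
    ultimately show "2 * t * (f x \<bullet> w - m * (x \<bullet> w)) + t\<^sup>2 * (f w \<bullet> w - m * (w \<bullet> w)) \<le> 0"
      by (simp add: algebra_simps m_def)
  qed
  moreover have "x \<bullet> f x = f x \<bullet> x" by (rule inner_commute)
  ultimately have "w \<bullet> w = 0" by (simp add: w_def inner_diff_left inner_diff_right)
  then have fx: "f x = m *\<^sub>R x" by (simp add: w_def)
  have "\<forall>i<Suc k. \<forall>j<Suc k. (e(k := x)) i \<bullet> (e(k := x)) j = (if i = j then 1 else 0)"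
    using e nx xV by (auto simp: less_Suc_eq V_def inner_commute)
  moreover have "\<forall>i<Suc k. f ((e(k := x)) i) = (\<mu>(k := m)) i *\<^sub>R (e(k := x)) i"
    using \<mu> fx by (auto simp: less_Suc_eq)
  ultimately show ?case by blast
qed

definition const_poly_matrix :: "real^'n^'m \<Rightarrow> real poly^'n^'m" where
  "const_poly_matrix A = (\<chi> i j. [:A $ i $ j:])"

lemma const_poly_sum: "[:sum g S:] = (\<Sum>x\<in>S. [:g x :: 'a::comm_monoid_add:])"
proof (induction S rule: infinite_finite_induct)
  case (insert x F)
  have "[:sum g (insert x F):] = [:g x:] + [:sum g F:]"
    using insert.hyps by simp
  then show ?case
    using insert by (simp del: add_pCons)
qed auto

lemma const_poly_matrix_mult:
  "const_poly_matrix (A ** B) = const_poly_matrix A ** const_poly_matrix B"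
  by (simp add: const_poly_matrix_def matrix_matrix_mult_def vec_eq_iff const_poly_sum mult.commute)

lemma const_poly_matrix_one: "const_poly_matrix (mat 1 :: real^'n^'n) = mat 1"
  by (auto simp: const_poly_matrix_def mat_def vec_eq_iff one_pCons)

text \<open>The diagonalisation is carried over to matrices with polynomial entries, where X - A and
  X - D are conjugate by Q; cancelling the nonzero factor det Q leaves a diagonal
  determinant.\<close>

lemma char_polynomial_diagonalizable:
  fixes A Q :: "real^'n^'n" and \<mu> :: "'n \<Rightarrow> real"
  assumes orth: "transpose Q ** Q = mat 1"
  assumes diag: "A ** Q = Q ** (\<chi> i j. if i = j then \<mu> i else 0)"
  shows "char_polynomial A = (\<Prod>i\<in>UNIV. [:- \<mu> i, 1:])"
proof -
  let ?D = "(\<chi> i j. if i = j then \<mu> i else 0) :: real^'n^'n"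
  let ?X = "mat [:0, 1:] :: real poly^'n^'n"
  let ?c = "const_poly_matrix :: real^'n^'n \<Rightarrow> _"
  have X: "?X ** M = M ** ?X" for M :: "real poly^'n^'n"
  proof -
    have "?X ** M = (\<chi> i j. [:0,1:] * M $ i $ j)" "M ** ?X = (\<chi> i j. M $ i $ j * [:0,1:])"
      by (auto simp: vec_eq_iff matrix_matrix_mult_def mat_def if_distrib if_distribR sum.If_cases
          cong: if_cong)
    then show ?thesis by (simp add: mult.commute)
  qed
  have left_diff: "(M - N) ** P = M ** P - N ** P"
    and right_diff: "P ** (M - N) = P ** M - P ** N" for M N P :: "real poly^'n^'n"
    by (simp_all add: matrix_matrix_mult_def vec_eq_iff algebra_simps sum_subtractf)
  have "(?X - ?c A) ** ?c Q = ?c Q ** (?X - ?c ?D)"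
    using arg_cong[OF diag, of const_poly_matrix]
    by (simp add: left_diff X const_poly_matrix_mult
      right_diff)
  then have "det (?X - ?c A) * det (?c Q) = det (?c Q) * det (?X - ?c ?D)"
    by (simp flip: det_mul)
  moreover have "det (?c (transpose Q)) * det (?c Q) = 1"
    by (metis const_poly_matrix_mult const_poly_matrix_one det_I det_mul orth)
  then have "det (?c Q) \<noteq> 0" by auto
  ultimately have "det (?X - ?c A) = det (?X - ?c ?D)"
    by (simp add: mult.commute)
  also have "\<dots> = (\<Prod>i\<in>UNIV. (?X - ?c ?D) $ i $ i)"
    by (rule det_diagonal) (auto simp: const_poly_matrix_def mat_def)
  also have "\<dots> = (\<Prod>i\<in>UNIV. [:- \<mu> i, 1:])"
    by (auto simp: const_poly_matrix_def mat_def)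
  finally show ?thesis
    by (simp add: char_polynomial_def const_poly_matrix_def)
qed

text \<open>Later arguments work with eigenvectors, whereas \<open>eigenvalues\<close> is built from
  roots of a polynomial. The lemma pairs vector i with entry i of the sorted list.\<close>

lemma symmetric_eigenframe:
  fixes A :: "real^'n^'n"
  assumes sym: "transpose A = A"
  shows "\<exists>e. orthonormal_frame e \<and> (\<forall>i<CARD('n). A *v e i = (eigenvalues A ! i) *\<^sub>R e i)"
    and "length (eigenvalues A) = CARD('n)"
proof -
  let ?n = "CARD('n)"
  have sa: "(A *v x) \<bullet> y = x \<bullet> (A *v y)" for x y
    by (metis dot_lmul_matrix sym transpose_matrix_vector inner_commute)
  obtain e \<mu> where *: "\<forall>i<?n. \<forall>j<?n. e i \<bullet> e j = (if i = j then 1 else 0)"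
    "\<forall>i<?n. A *v e i = \<mu> i *\<^sub>R e i"
    using selfadjoint_partial_eigenframe[of "(*v) A" ?n] sa
    by (auto simp: matrix_vector_mul_linear)
  then have e: "\<And>i j. i < ?n \<Longrightarrow> j < ?n \<Longrightarrow> e i \<bullet> e j = (if i = j then 1 else 0)"
    and \<mu>: "\<And>i. i < ?n \<Longrightarrow> A *v e i = \<mu> i *\<^sub>R e i"
    by auto
  obtain h :: "nat \<Rightarrow> 'n" where h: "bij_betw h {..<?n} UNIV"
    using ex_bij_betw_nat_finite[of "UNIV :: 'n set"] by (auto simp: atLeast0LessThan)
  define g where "g = inv_into {..<?n} h"
  have g: "g i < ?n" "h (g i) = i" for i
    using h by (auto simp: g_def bij_betw_def inv_into_into f_inv_into_f
        dest: inv_into_into[of i h "{..<?n}" for i])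
      (metis UNIV_I inv_into_into lessThan_iff)
  have ginj: "g i = g j \<longleftrightarrow> i = j" for i j using g(2) by metis
  define Q where "Q = (\<chi> i j. e (g j) $ i)"
  define \<nu> where "\<nu> i = \<mu> (g i)" for i
  have "transpose Q ** Q = mat 1"
  proof -
    have "(transpose Q ** Q) $ i $ j = e (g i) \<bullet> e (g j)" for i j
      by (simp add: Q_def transpose_def matrix_matrix_mult_def inner_vec_def)
    then show ?thesis by (auto simp: vec_eq_iff mat_def e g ginj)
  qed
  moreover have "A ** Q = Q ** (\<chi> i j. if i = j then \<nu> i else 0)"
  proof -
    have "(A ** Q) $ i $ j = (A *v e (g j)) $ i" for i j
      by (simp add: Q_def matrix_matrix_mult_def matrix_vector_mult_def)
    moreover have "(Q ** (\<chi> i j. if i = j then \<nu> i else 0)) $ i $ j = \<nu> j * e (g j) $ i" for i j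
      by (simp add: Q_def matrix_matrix_mult_def if_distrib cong: if_cong)
    ultimately show ?thesis by (simp add: vec_eq_iff \<mu> g \<nu>_def)
  qed
  ultimately have cp: "char_polynomial A = (\<Prod>i\<in>UNIV. [:- \<nu> i, 1:])"
    by (rule char_polynomial_diagonalizable)
  have pr: "proots (char_polynomial A) = image_mset \<nu> (mset_set UNIV)"
  proof -
    have "(\<Sum>i\<in>I. {#\<nu> i#}) = image_mset \<nu> (mset_set I)" if "finite I" for I
      using that by (induction I rule: finite_induct) auto
    then show ?thesis by (simp add: cp proots_prod)
  qed
  obtain xs :: "'n list" where xs: "set xs = UNIV" "distinct xs"
    using finite_distinct_list[of "UNIV :: 'n set"] by auto
  have "mset_set UNIV = mset xs" using xs mset_set_set by metis
  then have ev: "eigenvalues A = map \<nu> (sort_key \<nu> xs)"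
  proof -
    have "sort (map \<nu> xs) = map \<nu> (sort_key \<nu> xs)"
      by (rule properties_for_sort) simp_all
    then show ?thesis
      by (simp add: eigenvalues_def pr \<open>mset_set UNIV = mset xs\<close> flip: mset_map)
  qed
  \<comment> \<open>Sorting the indices by \<open>\<nu>\<close>, rather than the values themselves,
    applies one permutation to eigenvalues and eigenvectors alike.\<close>
  define ys where "ys = sort_key \<nu> xs"
  have ys: "set ys = UNIV" "distinct ys" "length ys = ?n"
    using xs distinct_card[of xs] by (auto simp: ys_def)
  show "length (eigenvalues A) = ?n" using ys ev by (simp add: ys_def)
  have "orthonormal_frame (\<lambda>i. e (g (ys ! i)))"
    using ys by (auto simp: orthonormal_frame_def e g ginj nth_eq_iff_index_eq)
  moreover have "\<forall>i<?n. A *v e (g (ys ! i)) = (eigenvalues A ! i) *\<^sub>R e (g (ys ! i))"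
    using ys by (auto simp: ev ys_def[symmetric] \<mu> g \<nu>_def)
  ultimately show "\<exists>e. orthonormal_frame e \<and> (\<forall>i<?n. A *v e i = (eigenvalues A ! i) *\<^sub>R e i)"
    by blast
qed

lemma sorted_eigenvalues: "sorted (eigenvalues A)"
  by (simp add: eigenvalues_def)

section \<open>Extremal properties of eigenvalue sums\<close>

text \<open>Summation by parts: a decreasing nonnegative weight is a nonnegative combination of
  indicators of initial segments, and x has nonnegative sum over each of these.\<close>

lemma abel_sum_nonneg:
  fixes a x :: "nat \<Rightarrow> real"
  assumes "\<And>i j. i \<le> j \<Longrightarrow> j < n \<Longrightarrow> a j \<le> a i" "\<And>i. i < n \<Longrightarrow> a i \<ge> 0"
    and "\<And>k. k \<le> n \<Longrightarrow> (\<Sum>i<k. x i) \<ge> 0"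
  shows "(\<Sum>i<n. a i * x i) \<ge> 0"
proof -
  have "(\<Sum>i<Suc k. a i * x i) \<ge> a k * (\<Sum>i<Suc k. x i)" if "k < n" for k
    using that
  proof (induction k)
    case (Suc k)
    have "a (Suc k) * (\<Sum>i<Suc k. x i) \<le> a k * (\<Sum>i<Suc k. x i)"
      using Suc.prems assms(1) assms(3)[of "Suc (Suc k)"] assms(3)[of "Suc k"]
      by (intro mult_right_mono) auto
    with Suc show ?case by (simp add: algebra_simps)
  qed simp
  from this[of "n - 1"] have "n > 0 \<Longrightarrow> (\<Sum>i<n. a i * x i) \<ge> a (n - 1) * (\<Sum>i<n. x i)"
    by (cases n) auto
  moreover have "n > 0 \<Longrightarrow> a (n - 1) * (\<Sum>i<n. x i) \<ge> 0"
    using assms by (intro mult_nonneg_nonneg) auto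
  ultimately show ?thesis by (cases "n = 0") auto
qed

text \<open>By Parseval the numbers c j lie in [0, 1] and have total mass m = \<open>card S\<close>.
  Among such weights, the smallest weighted sum of \<open>\<mu>\<close> puts mass 1 on each of the m
  smallest values.\<close>

lemma ky_fan:
  fixes e v :: "nat \<Rightarrow> 'a::euclidean_space" and \<mu> :: "nat \<Rightarrow> real"
  assumes e: "orthonormal_frame e" and v: "orthonormal_frame v"
    and mono: "\<And>i j. i \<le> j \<Longrightarrow> j < DIM('a) \<Longrightarrow> \<mu> i \<le> \<mu> j"
    and S: "S \<subseteq> {..<DIM('a)}"
  shows "(\<Sum>i<card S. \<mu> i) \<le> (\<Sum>i\<in>S. \<Sum>j<DIM('a). \<mu> j * (v i \<bullet> e j)\<^sup>2)"
proof (cases "card S = 0")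
  case True
  have "finite S" using S finite_subset by blast
  then show ?thesis using True by simp
next
  case False
  let ?n = "DIM('a)"
  define m where "m = card S"
  have fS: "finite S" using S finite_subset by blast
  have m: "0 < m" "m \<le> ?n"
    using False S card_mono[OF _ S] by (auto simp: m_def)
  define \<tau> where "\<tau> = \<mu> (m - 1)"
  define c where "c j = (\<Sum>i\<in>S. (v i \<bullet> e j)\<^sup>2)" for j
  have c1: "c j \<le> 1" if "j < ?n" for j
  proof -
    have "c j \<le> (\<Sum>i<?n. (v i \<bullet> e j)\<^sup>2)"
      unfolding c_def using S by (intro sum_mono2) auto
    also have "\<dots> = e j \<bullet> e j"
      using orthonormal_frame_inner[OF v, of "e j" "e j"] by (simp add: power2_eq_square inner_commute)
    finally show ?thesis using orthonormal_frameD(1)[OF e that] by simp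
  qed
  have c0: "c j \<ge> 0" for j by (simp add: c_def sum_nonneg)
  have "(\<Sum>j<?n. c j) = (\<Sum>i\<in>S. \<Sum>j<?n. (v i \<bullet> e j)\<^sup>2)"
    unfolding c_def by (rule sum.swap)
  also have "\<dots> = (\<Sum>i\<in>S. 1)"
  proof (rule sum.cong)
    fix i assume "i \<in> S"
    then have "v i \<bullet> v i = 1" using S orthonormal_frameD(1)[OF v, of i] by auto
    then show "(\<Sum>j<?n. (v i \<bullet> e j)\<^sup>2) = 1"
      using orthonormal_frame_inner[OF e, of "v i" "v i"] by (simp add: power2_eq_square)
  qed simp
  finally have csum: "(\<Sum>j<?n. c j) = real m" by (simp add: m_def)
  let ?\<chi> = "\<lambda>j. if j < m then 1 else 0 :: real"
  have chi: "(\<Sum>j<?n. g j * ?\<chi> j) = (\<Sum>j<m. g j)" for g :: "nat \<Rightarrow> real"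
  proof -
    have "{..<?n} \<inter> {j. j < m} = {..<m}" using m by auto
    then show ?thesis by (simp add: if_distrib[of "\<lambda>x. _ * x"] sum.If_cases cong: if_cong)
  qed
  \<comment> \<open>Relative to the threshold \<open>\<tau>\<close>, the largest of the m smallest
    values, the two factors never have opposite signs. The weights c and the indicator have equal
    mass, so \<open>\<tau>\<close> drops out of the sum.\<close>
  have "0 \<le> (\<Sum>j<?n. (\<mu> j - \<tau>) * (c j - ?\<chi> j))"
  proof (intro sum_nonneg)
    fix j assume "j \<in> {..<?n}"
    then show "0 \<le> (\<mu> j - \<tau>) * (c j - ?\<chi> j)"
      using c1[of j] c0[of j] mono[of j "m - 1"] mono[of "m - 1" j] m
      by (auto simp: \<tau>_def intro: mult_nonpos_nonpos mult_nonneg_nonneg)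
  qed
  also have "\<dots> = (\<Sum>j<?n. \<mu> j * c j) - (\<Sum>j<?n. \<mu> j * ?\<chi> j) - \<tau> * ((\<Sum>j<?n. c j) - (\<Sum>j<?n. 1 * ?\<chi> j))"
    by (simp add: sum_subtractf sum_distrib_left algebra_simps sum.distrib)
  also have "\<dots> = (\<Sum>j<?n. \<mu> j * c j) - (\<Sum>j<m. \<mu> j)"
    unfolding chi csum by simp
  also have "(\<Sum>j<?n. \<mu> j * c j) = (\<Sum>i\<in>S. \<Sum>j<?n. \<mu> j * (v i \<bullet> e j)\<^sup>2)"
    unfolding c_def sum_distrib_left by (rule sum.swap)
  finally show ?thesis by (simp add: m_def)
qed

lemma symmetric_quadratic_form:
  fixes A :: "real^'n^'n"
  assumes e: "orthonormal_frame e" and ev: "\<And>i. i < CARD('n) \<Longrightarrow> A *v e i = \<mu> i *\<^sub>R e i"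
  shows "(A *v x) \<bullet> x = (\<Sum>j<CARD('n). \<mu> j * (x \<bullet> e j)\<^sup>2)"
proof -
  have "A *v x = A *v (\<Sum>i<CARD('n). (x \<bullet> e i) *\<^sub>R e i)"
    using orthonormal_frame_expansion[OF e, of x] by simp
  also have "\<dots> = (\<Sum>i<CARD('n). (x \<bullet> e i) *\<^sub>R (\<mu> i *\<^sub>R e i))"
    by (simp add: linear_sum[OF matrix_vector_mul_linear] linear_cmul[OF matrix_vector_mul_linear] ev
       del: scaleR_scaleR)
  finally show ?thesis
    by (simp add: inner_sum_left power2_eq_square inner_commute[of "e _" x] algebra_simps del: scaleR_scaleR)
qed

lemma eigenvalues_mono:
  fixes A :: "real^'n^'n"
  assumes "transpose A = A" "i \<le> j" "j < CARD('n)"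
  shows "eigenvalues A ! i \<le> eigenvalues A ! j"
  using assms symmetric_eigenframe(2)[OF assms(1)] sorted_eigenvalues[of A]
  by (auto intro: sorted_nth_mono)

text \<open>Ky Fan bounds each initial sum of diagonal entries from below, and summation by parts
  extends this to decreasing weights. It is essential that the larger weights sit at the smaller
  eigenvalues.\<close>

lemma weighted_trace_lower_bound:
  fixes A :: "real^'n^'n"
  assumes sym: "transpose A = A" and v: "orthonormal_frame v"
    and a: "\<And>i j. i \<le> j \<Longrightarrow> j < CARD('n) \<Longrightarrow> a j \<le> a i" "\<And>i. i < CARD('n) \<Longrightarrow> a i \<ge> 0"
  shows "(\<Sum>i<CARD('n). a i * eigenvalues A ! i) \<le> (\<Sum>i<CARD('n). a i * ((A *v v i) \<bullet> v i))"
proof -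
  let ?\<mu> = "\<lambda>i. eigenvalues A ! i"
  obtain e where e: "orthonormal_frame e" and ev: "\<And>i. i < CARD('n) \<Longrightarrow> A *v e i = ?\<mu> i *\<^sub>R e i"
    using symmetric_eigenframe(1)[OF sym] by auto
  have "(\<Sum>i<CARD('n). a i * ((A *v v i) \<bullet> v i - ?\<mu> i)) \<ge> 0"
  proof (rule abel_sum_nonneg)
    fix k assume k: "k \<le> CARD('n)"
    then have "(\<Sum>i<card {..<k}. ?\<mu> i) \<le> (\<Sum>i\<in>{..<k}. \<Sum>j<DIM(real^'n). ?\<mu> j * (v i \<bullet> e j)\<^sup>2)"
      by (intro ky_fan e v eigenvalues_mono sym) auto
    then show "0 \<le> (\<Sum>i<k. (A *v v i) \<bullet> v i - ?\<mu> i)"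
      by (simp add: sum_subtractf symmetric_quadratic_form[OF e ev])
  qed (use a in auto)
  then show ?thesis
    by (simp add: algebra_simps sum_subtractf)
qed

section \<open>First-order behaviour of the logarithm of the p-fold product\<close>

definition index_sets :: "nat \<Rightarrow> nat \<Rightarrow> nat set set" where
  "index_sets p n = {I. I \<subseteq> {..<n} \<and> card I = p}"

lemma finite_index_sets [simp]: "finite (index_sets p n)"
  by (rule finite_subset[of _ "Pow {..<n}"]) (auto simp: index_sets_def)

lemma index_setsD: "I \<in> index_sets p n \<Longrightarrow> finite I \<and> I \<subseteq> {..<n} \<and> card I = p"
  by (auto simp: index_sets_def intro: finite_subset)

text \<open>The partial derivatives of the logarithm of the product of all p-fold sums of the l i.\<close>
definition log_weight :: "nat \<Rightarrow> nat \<Rightarrow> (nat \<Rightarrow> real) \<Rightarrow> nat \<Rightarrow> real" where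
  "log_weight p n l i = (\<Sum>I\<in>{I\<in>index_sets p n. i \<in> I}. 1 / sum l I)"

text \<open>Exchanging the sums over i and I gives the derivative of the sum of ln l_I in the
  direction x. For x = l every quotient is 1, which later serves as Euler's identity.\<close>

lemma log_weight_sum:
  "(\<Sum>i<n. log_weight p n l i * x i) = (\<Sum>I\<in>index_sets p n. sum x I / sum l I)"
proof -
  have "(\<Sum>i<n. log_weight p n l i * x i) = (\<Sum>i<n. \<Sum>I\<in>index_sets p n. if i \<in> I then x i / sum l I else 0)"
    by (intro sum.cong refl)
      (simp add: log_weight_def sum_distrib_right sum.inter_filter if_distribR if_distrib[of "\<lambda>x. x * _"] cong: if_cong)
  also have "\<dots> = (\<Sum>I\<in>index_sets p n. \<Sum>i<n. if i \<in> I then x i / sum l I else 0)"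
    by (rule sum.swap)
  also have "\<dots> = (\<Sum>I\<in>index_sets p n. sum x I / sum l I)"
  proof (intro sum.cong refl)
    fix I assume "I \<in> index_sets p n"
    then have "{..<n} \<inter> I = I" by (auto dest: index_setsD)
    then show "(\<Sum>i<n. if i \<in> I then x i / sum l I else 0) = sum x I / sum l I"
      by (simp add: sum.inter_restrict[symmetric] sum_divide_distrib)
  qed
  finally show ?thesis .
qed

text \<open>The transposition of i and j maps the index sets containing i bijectively onto those
  containing j. It replaces l i by l j or leaves the sum alone, so sums can only grow and
  reciprocals only shrink.\<close>

lemma log_weight_antimono:
  assumes mono: "\<And>i j. i \<le> j \<Longrightarrow> j < n \<Longrightarrow> l i \<le> l j"
    and pos: "\<And>I. I \<in> index_sets p n \<Longrightarrow> sum l I > 0"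
    and ij: "i \<le> j" "j < n"
  shows "log_weight p n l j \<le> log_weight p n l i"
proof -
  let ?\<tau> = "Transposition.transpose i j"
  have im: "?\<tau> ` I \<in> index_sets p n" if "I \<in> index_sets p n" for I
  proof -
    have "card (?\<tau> ` I) = card I" by (simp add: card_image)
    moreover have "?\<tau> ` I \<subseteq> {..<n}"
      using that ij by (auto simp: index_sets_def Transposition.transpose_def)
    ultimately show ?thesis using that by (simp add: index_sets_def)
  qed
  have "log_weight p n l j = (\<Sum>I\<in>{I\<in>index_sets p n. i \<in> I}. 1 / sum l (?\<tau> ` I))"
    unfolding log_weight_def
    by (rule sum.reindex_bij_witness[of _ "(`) ?\<tau>" "(`) ?\<tau>"])
       (use im image_eqI[of i ?\<tau> j] image_eqI[of j ?\<tau> i] in \<open>simp_all add: image_image\<close>)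
  also have "\<dots> \<le> log_weight p n l i"
    unfolding log_weight_def
  proof (intro sum_mono)
    fix I assume "I \<in> {I \<in> index_sets p n. i \<in> I}"
    then have I: "I \<in> index_sets p n" "i \<in> I" by auto
    have "sum l (?\<tau> ` I) = (\<Sum>k\<in>I. l (?\<tau> k))"
      by (subst sum.reindex) auto
    also have "\<dots> \<ge> sum l I"
    proof (cases "j \<in> I")
      case True
      then have "?\<tau> ` I = I" using I(2) by (auto simp: Transposition.transpose_def image_iff)
      then show ?thesis
        using sum.reindex[of ?\<tau> I l] by simp
    next
      case False
      then show ?thesis
        by (intro sum_mono) (use mono[OF ij] in \<open>auto simp: Transposition.transpose_def\<close>)
    qed
    finally show "1 / sum l (?\<tau> ` I) \<le> 1 / sum l I"
      using pos[OF I(1)] by (intro divide_left_mono) auto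
  qed
  finally show ?thesis .
qed

text \<open>The set of the p largest indices alone suffices: its sum is at most p times the top
  value, so its reciprocal already contributes 1 / p to the product. This is the quantitative
  ellipticity in the worst direction.\<close>

lemma log_weight_top:
  assumes mono: "\<And>i j. i \<le> j \<Longrightarrow> j < n \<Longrightarrow> l i \<le> l j"
    and pos: "\<And>I. I \<in> index_sets p n \<Longrightarrow> sum l I > 0"
    and p: "1 \<le> p" "p \<le> n"
  shows "l (n - 1) > 0" "log_weight p n l (n - 1) * l (n - 1) \<ge> 1 / p"
proof -
  define I where "I = {n - p..<n}"
  have I: "I \<in> index_sets p n" "n - 1 \<in> I" "card I = p"
    using p by (auto simp: I_def index_sets_def)
  have "sum l I \<le> of_nat (card I) * l (n - 1)"
    by (rule sum_bounded_above) (use mono p in \<open>auto simp: I_def\<close>)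
  then have le: "sum l I \<le> real p * l (n - 1)" by (simp add: I(3))
  with pos[OF I(1)] le have "real p * l (n - 1) > 0" by linarith
  then show l: "l (n - 1) > 0" by (simp add: zero_less_mult_iff)
  have "1 / sum l I \<le> log_weight p n l (n - 1)"
    unfolding log_weight_def
    by (rule member_le_sum) (use I pos in \<open>auto intro: less_imp_le\<close>)
  moreover have "1 / (real p * l (n - 1)) \<le> 1 / sum l I"
    using le pos[OF I(1)] by (intro divide_left_mono) auto
  ultimately have "1 / (real p * l (n - 1)) * l (n - 1) \<le> log_weight p n l (n - 1) * l (n - 1)"
    using l by (intro mult_right_mono) auto
  then show "log_weight p n l (n - 1) * l (n - 1) \<ge> 1 / p"
    using l by simp
qed

text \<open>The sum of the p smallest values is nonnegative, so l 0 is at least -(p - 1) times the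
  top value. Thus a bound for the top eigenvalue bounds the whole spectrum.\<close>

lemma p_sum_nonneg_abs_bound:
  fixes l :: "nat \<Rightarrow> real"
  assumes mono: "\<And>i j. i \<le> j \<Longrightarrow> j < n \<Longrightarrow> l i \<le> l j"
    and nonneg: "\<And>I. I \<in> index_sets p n \<Longrightarrow> sum l I \<ge> 0"
    and p: "1 \<le> p" "p \<le> n" and i: "i < n"
  shows "\<bar>l i\<bar> \<le> p * l (n - 1)"
proof -
  have "{..<p} \<in> index_sets p n" using p by (auto simp: index_sets_def)
  from nonneg[OF this] have "0 \<le> sum l {..<p}" .
  also have "\<dots> = l 0 + sum l {1..<p}"
    using p by (metis One_nat_def Suc_le_lessD atLeast0LessThan sum.atLeast_Suc_lessThan)
  also have "sum l {1..<p} \<le> of_nat (card {1..<p}) * l (n - 1)"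
    by (rule sum_bounded_above) (use mono p in auto)
  finally have 1: "0 \<le> l 0 + (p - 1) * l (n - 1)" using p by (simp add: of_nat_diff)
  moreover have "l 0 \<le> l i" "l i \<le> l (n - 1)" using mono i by auto
  moreover from this 1 p have "real p * l (n - 1) \<ge> 0" by (simp add: algebra_simps of_nat_diff)
  then have 2: "l (n - 1) \<ge> 0" using p by (simp add: zero_le_mult_iff)
  moreover have "l (n - 1) \<le> p * l (n - 1)" using 2 p by (simp add: mult_le_cancel_right1)
  ultimately show ?thesis using p by (simp add: abs_le_iff algebra_simps of_nat_diff)
qed

text \<open>Concavity of ln, in the form ln t \<le> t - 1 for each factor, gives a bound that is
  linear in the eigenvalues of A with weights decreasing in i. The trace bound then replaces these
  eigenvalues by diagonal entries in an arbitrary frame.\<close>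

lemma log_product_tangent:
  fixes A :: "real^'n^'n"
  assumes sym: "transpose A = A" and v: "orthonormal_frame v"
    and mono: "\<And>i j. i \<le> j \<Longrightarrow> j < CARD('n) \<Longrightarrow> l i \<le> l j"
    and pos: "\<And>I. I \<in> index_sets p CARD('n) \<Longrightarrow> sum l I > 0"
    and posA: "\<And>I. I \<in> index_sets p CARD('n) \<Longrightarrow> (\<Sum>i\<in>I. eigenvalues A ! i) > 0"
  shows "(\<Sum>I\<in>index_sets p CARD('n). ln (\<Sum>i\<in>I. eigenvalues A ! i))
    \<le> (\<Sum>I\<in>index_sets p CARD('n). ln (sum l I))
      + (\<Sum>i<CARD('n). log_weight p CARD('n) l i * ((A *v v i) \<bullet> v i - l i))"
proof -
  let ?n = "CARD('n)" and ?\<mu> = "\<lambda>i. eigenvalues A ! i"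
  have "(\<Sum>I\<in>index_sets p ?n. ln (sum ?\<mu> I))
     \<le> (\<Sum>I\<in>index_sets p ?n. ln (sum l I) + (sum ?\<mu> I / sum l I - sum l I / sum l I))"
  proof (intro sum_mono)
    fix I assume I: "I \<in> index_sets p ?n"
    have "ln (sum ?\<mu> I / sum l I) \<le> sum ?\<mu> I / sum l I - 1"
      using pos[OF I] posA[OF I] by (intro ln_le_minus_one) simp
    then show "ln (sum ?\<mu> I) \<le> ln (sum l I) + (sum ?\<mu> I / sum l I - sum l I / sum l I)"
      using pos[OF I] posA[OF I] by (simp add: ln_div)
  qed
  also have "\<dots> = (\<Sum>I\<in>index_sets p ?n. ln (sum l I))
      + ((\<Sum>i<?n. log_weight p ?n l i * ?\<mu> i) - (\<Sum>i<?n. log_weight p ?n l i * l i))"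
    by (simp add: sum.distrib sum_subtractf log_weight_sum)
  also have "(\<Sum>i<?n. log_weight p ?n l i * ?\<mu> i) \<le> (\<Sum>i<?n. log_weight p ?n l i * ((A *v v i) \<bullet> v i))"
  proof (rule weighted_trace_lower_bound[OF sym v])
    show "log_weight p ?n l i \<ge> 0" for i
      unfolding log_weight_def by (intro sum_nonneg) (auto intro: less_imp_le pos)
  qed (use log_weight_antimono mono pos in blast)
  finally show ?thesis by (simp add: algebra_simps sum_subtractf)
qed

lemma quadratic_form_le_top:
  fixes A :: "real^'n^'n"
  assumes sym: "transpose A = A"
  shows "(A *v x) \<bullet> x \<le> eigenvalues A ! (CARD('n) - 1) * (x \<bullet> x)"
proof -
  obtain e where e: "orthonormal_frame e"
    and ev: "\<And>i. i < CARD('n) \<Longrightarrow> A *v e i = (eigenvalues A ! i) *\<^sub>R e i"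
    using symmetric_eigenframe(1)[OF sym] by auto
  have "(A *v x) \<bullet> x = (\<Sum>j<CARD('n). eigenvalues A ! j * (x \<bullet> e j)\<^sup>2)"
    by (rule symmetric_quadratic_form[OF e ev])
  also have "\<dots> \<le> (\<Sum>j<CARD('n). eigenvalues A ! (CARD('n) - 1) * (x \<bullet> e j)\<^sup>2)"
    by (intro sum_mono mult_right_mono eigenvalues_mono sym) auto
  also have "\<dots> = eigenvalues A ! (CARD('n) - 1) * (x \<bullet> x)"
    using orthonormal_frame_inner[OF e, of x x]
    by (simp add: power2_eq_square flip: sum_distrib_left)
  finally show ?thesis .
qed

lemma norm_symmetric_mult_le:
  fixes A :: "real^'n^'n" and B :: real
  assumes sym: "transpose A = A" and B: "\<And>i. i < CARD('n) \<Longrightarrow> \<bar>eigenvalues A ! i\<bar> \<le> B"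
  shows "norm (A *v x) \<le> B * norm x"
proof -
  obtain e where e: "orthonormal_frame e"
    and ev: "\<And>i. i < CARD('n) \<Longrightarrow> A *v e i = (eigenvalues A ! i) *\<^sub>R e i"
    using symmetric_eigenframe(1)[OF sym] by auto
  have B0: "B \<ge> 0" using B[of 0] by force
  have co: "(A *v x) \<bullet> e i = eigenvalues A ! i * (x \<bullet> e i)" if "i < CARD('n)" for i
  proof -
    have "(A *v x) \<bullet> e i = x \<bullet> (A *v e i)"
      by (metis dot_lmul_matrix sym transpose_matrix_vector inner_commute)
    then show ?thesis by (simp add: ev that)
  qed
  have "(norm (A *v x))\<^sup>2 = (\<Sum>i<CARD('n). ((A *v x) \<bullet> e i)\<^sup>2)"
    using orthonormal_frame_inner[OF e, of "A *v x" "A *v x"]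
    by (simp add: power2_norm_eq_inner) (simp add: power2_eq_square)
  also have "\<dots> \<le> (\<Sum>i<CARD('n). B\<^sup>2 * (x \<bullet> e i)\<^sup>2)"
  proof (intro sum_mono)
    fix i assume "i \<in> {..<CARD('n)}"
    then have "(eigenvalues A ! i)\<^sup>2 \<le> B\<^sup>2"
      using B[of i] by (simp add: abs_le_square_iff[symmetric])
    then show "((A *v x) \<bullet> e i)\<^sup>2 \<le> B\<^sup>2 * (x \<bullet> e i)\<^sup>2"
      using \<open>i \<in> _\<close> by (simp add: co power_mult_distrib mult_right_mono)
  qed
  also have "\<dots> = (B * norm x)\<^sup>2"
    using orthonormal_frame_inner[OF e, of x x]
    by (simp add: power_mult_distrib power2_norm_eq_inner flip: sum_distrib_left)
      (simp add: power2_eq_square)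
  finally show ?thesis using B0 by (simp add: power2_le_iff_abs_le)
qed

text \<open>The norm of a matrix is here the Frobenius norm; bounding it by the sum of the row norms
  produces the factor n.\<close>

lemma norm_symmetric_le:
  fixes A :: "real^'n^'n" and B :: real
  assumes sym: "transpose A = A" and B: "\<And>i. i < CARD('n) \<Longrightarrow> \<bar>eigenvalues A ! i\<bar> \<le> B"
  shows "norm A \<le> CARD('n) * B"
proof -
  have "norm A \<le> (\<Sum>i\<in>UNIV. norm (A $ i))"
    by (simp add: norm_vec_def L2_set_le_sum)
  also have "\<dots> = (\<Sum>i\<in>UNIV. norm (A *v axis i 1))"
  proof (intro sum.cong refl)
    fix i :: 'n
    have "A *v axis i 1 = A $ i"
      by (metis matrix_vector_mult_basis row_def row_transpose column_def sym vec_nth_inverse)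
    then show "norm (A $ i) = norm (A *v axis i 1)" by simp
  qed
  also have "\<dots> \<le> (\<Sum>i\<in>(UNIV::'n set). B)"
    by (intro sum_mono)
      (metis norm_symmetric_mult_le[OF sym B] norm_axis_1 mult.right_neutral)
  finally show ?thesis by simp
qed

section \<open>Partial derivatives and second derivatives along lines\<close>

text \<open>\<open>frechet_derivative\<close> is chosen from the set of all derivatives at x, so it
  is enough that both functions have the same set.\<close>

lemma frechet_derivative_cong_open:
  assumes "open S" "x \<in> S" "\<And>y. y \<in> S \<Longrightarrow> g y = h y"
  shows "frechet_derivative g (at x) = frechet_derivative h (at x)"
proof -
  have "(g has_derivative g') (at x) \<longleftrightarrow> (h has_derivative g') (at x)" for g'
    using has_derivative_transform_within_open[OF _ assms(1,2), where f = g and g = h]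
      has_derivative_transform_within_open[OF _ assms(1,2), where f = h and g = g] assms(3)
    by metis
  then show ?thesis by (simp add: frechet_derivative_def)
qed

lemma partial_deriv_cong_open:
  assumes "open S" "x \<in> S" "\<And>y. y \<in> S \<Longrightarrow> g y = h y"
  shows "partial_deriv v g x = partial_deriv v h x"
  unfolding partial_deriv_def using frechet_derivative_cong_open[OF assms] by simp

lemma partial_deriv_add:
  assumes "f differentiable at x" "g differentiable at x"
  shows "partial_deriv v (\<lambda>y. f y + g y) x = partial_deriv v f x + partial_deriv v g x"
proof -
  have "((\<lambda>y. f y + g y) has_derivative (\<lambda>v. frechet_derivative f (at x) v + frechet_derivative g (at x) v)) (at x)"
    using assms by (intro has_derivative_add) (simp_all add: frechet_derivative_works[symmetric])
  from frechet_derivative_at[OF this] show ?thesis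
    by (simp add: partial_deriv_def fun_eq_iff)
qed

lemma partial_deriv_cmult:
  assumes "f differentiable at x"
  shows "partial_deriv v (\<lambda>y. c * f y) x = c * partial_deriv v f x"
proof -
  have "((\<lambda>y. c * f y) has_derivative (\<lambda>v. c * frechet_derivative f (at x) v)) (at x)"
    using assms by (intro has_derivative_mult_right) (simp add: frechet_derivative_works[symmetric])
  from frechet_derivative_at[OF this] show ?thesis
    by (simp add: partial_deriv_def fun_eq_iff)
qed

lemma partial_deriv_grad:
  assumes "g differentiable at x"
  shows "partial_deriv v g x = grad g x \<bullet> v"
proof -
  have lin: "linear (frechet_derivative g (at x))"
    using assms by (rule linear_frechet_derivative)
  have "frechet_derivative g (at x) v = frechet_derivative g (at x) (\<Sum>b\<in>Basis. (v \<bullet> b) *\<^sub>R b)"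
    by (simp add: euclidean_representation)
  also have "\<dots> = (\<Sum>b\<in>Basis. (v \<bullet> b) * frechet_derivative g (at x) b)"
    by (simp add: linear_sum[OF lin] linear_cmul[OF lin])
  finally show ?thesis
    unfolding partial_deriv_def grad_def inner_sum_left
    by (simp add: inner_commute[of v] mult.commute)
qed

lemma has_derivative_grad:
  assumes "g differentiable at x"
  shows "(g has_derivative (\<lambda>v. grad g x \<bullet> v)) (at x)"
proof -
  have "frechet_derivative g (at x) = (\<lambda>v. grad g x \<bullet> v)"
    using partial_deriv_grad[OF assms] by (auto simp: partial_deriv_def)
  then show ?thesis using assms frechet_derivative_works by metis
qed

lemma partial_deriv_basis_sum:
  assumes "g differentiable at x"
  shows "partial_deriv v g x = (\<Sum>b\<in>Basis. (v \<bullet> b) * partial_deriv b g x)"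
  unfolding partial_deriv_grad[OF assms, of v] grad_def inner_sum_left
  by (intro sum.cong) (simp_all add: inner_commute mult.commute)

lemma has_real_derivative_line:
  assumes "g differentiable at (x + t *\<^sub>R v)"
  shows "((\<lambda>t. g (x + t *\<^sub>R v)) has_real_derivative partial_deriv v g (x + t *\<^sub>R v)) (at t)"
proof -
  have "((\<lambda>t. x + t *\<^sub>R v) has_derivative (\<lambda>h. h *\<^sub>R v)) (at t)"
    by (auto intro!: derivative_eq_intros)
  from has_derivative_compose[OF this has_derivative_grad[OF assms]]
  show ?thesis
    by (simp add: has_field_derivative_def partial_deriv_grad[OF assms] mult.commute[of _ "_ \<bullet> _"])
qed

lemma Ck_on_cong:
  assumes "open S" "\<And>y. y \<in> S \<Longrightarrow> g y = h y"
  shows "Ck_on k S g \<longleftrightarrow> Ck_on k S h"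
  using assms(2)
proof (induction k arbitrary: g h)
  case 0
  then show ?case by (simp cong: continuous_on_cong)
next
  case (Suc k)
  have "g differentiable at x \<longleftrightarrow> h differentiable at x" if "x \<in> S" for x
    unfolding differentiable_def
    using has_derivative_transform_within_open[OF _ assms(1) that, where f = g and g = h]
      has_derivative_transform_within_open[OF _ assms(1) that, where f = h and g = g] Suc.prems
    by metis
  moreover have "Ck_on k S (partial_deriv b g) \<longleftrightarrow> Ck_on k S (partial_deriv b h)" for b
    by (rule Suc.IH) (use partial_deriv_cong_open[OF assms(1)] Suc.prems in blast)
  ultimately show ?case by simp
qed

lemma Ck_on_imp_continuous_on: "Ck_on k S g \<Longrightarrow> continuous_on S g"
  by (cases k) (auto intro: continuous_at_imp_continuous_on differentiable_imp_continuous_within)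

lemma Ck_on_Suc_imp: "Ck_on (Suc k) S g \<Longrightarrow> Ck_on k S g"
proof (induction k arbitrary: g)
  case 0
  then show ?case using Ck_on_imp_continuous_on[of 1 S g] by simp
next
  case (Suc k)
  then show ?case by simp
qed

lemma Ck_on_mono: "Ck_on k S g \<Longrightarrow> j \<le> k \<Longrightarrow> Ck_on j S g"
  by (induction k) (auto simp: le_Suc_eq simp del: Ck_on.simps dest: Ck_on_Suc_imp)

lemma Ck_on_const: "Ck_on k S (\<lambda>x. c :: real)"
proof (induction k arbitrary: c)
  case (Suc k)
  have "partial_deriv b (\<lambda>x. c) = (\<lambda>x. 0)" for b :: 'a
    by (simp add: partial_deriv_def fun_eq_iff)
  then show ?case using Suc by simp
qed simp

lemma Ck_on_add:
  assumes "open S" "Ck_on k S f" "Ck_on k S g"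
  shows "Ck_on k S (\<lambda>x. f x + g x)"
  using assms(2,3)
proof (induction k arbitrary: f g)
  case (Suc k)
  have "Ck_on k S (partial_deriv b (\<lambda>x. f x + g x))" if "b \<in> Basis" for b
  proof -
    have "Ck_on k S (\<lambda>x. partial_deriv b f x + partial_deriv b g x)"
      using Suc that by auto
    then show ?thesis
      using Suc.prems by (subst Ck_on_cong[OF assms(1), where h = "\<lambda>x. partial_deriv b f x + partial_deriv b g x"])
        (auto intro: partial_deriv_add)
  qed
  then show ?case using Suc.prems by auto
qed (auto intro: continuous_on_add)

lemma Ck_on_cmult:
  assumes "open S" "Ck_on k S f"
  shows "Ck_on k S (\<lambda>x. c * f x)"
  using assms(2)
proof (induction k arbitrary: f)
  case (Suc k)
  have "Ck_on k S (partial_deriv b (\<lambda>x. c * f x))" if "b \<in> Basis" for b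
  proof -
    have "Ck_on k S (\<lambda>x. c * partial_deriv b f x)"
      using Suc that by auto
    then show ?thesis
      using Suc.prems by (subst Ck_on_cong[OF assms(1), where h = "\<lambda>x. c * partial_deriv b f x"])
        (auto intro: partial_deriv_cmult)
  qed
  then show ?case using Suc.prems by auto
qed (auto intro: continuous_on_mult)

lemma Ck_on_sum:
  assumes "open S" "finite I" "\<And>i. i \<in> I \<Longrightarrow> Ck_on k S (f i)"
  shows "Ck_on k S (\<lambda>x. \<Sum>i\<in>I. f i x)"
  using assms(2,3)
  by (induction I rule: finite_induct) (auto intro!: Ck_on_add Ck_on_const assms(1) simp del: Ck_on.simps)

text \<open>\<open>Ck_on\<close> speaks of coordinate directions, while eigenframes require all
  directions v. The derivative along v is a fixed linear combination of the coordinate ones.\<close>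

lemma Ck_on_partial_deriv:
  assumes "open S" "Ck_on (Suc k) S g"
  shows "Ck_on k S (partial_deriv v g)"
proof -
  have "Ck_on k S (\<lambda>x. \<Sum>b\<in>Basis. (v \<bullet> b) * partial_deriv b g x)"
    using assms by (intro Ck_on_sum Ck_on_cmult) auto
  then show ?thesis
    by (subst Ck_on_cong[OF assms(1)]) (use assms in \<open>auto intro!: partial_deriv_basis_sum\<close>)
qed

section \<open>Symmetry of mixed derivatives\<close>

lemma mixed_difference_mean_value:
  assumes "Ck_on 2 S g" "open S" and h: "h > 0"
    and sub: "\<And>s t. 0 \<le> s \<Longrightarrow> s \<le> h \<Longrightarrow> 0 \<le> t \<Longrightarrow> t \<le> h \<Longrightarrow> x + s *\<^sub>R v + t *\<^sub>R w \<in> S"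
  shows "\<exists>s t. 0 < s \<and> s < h \<and> 0 < t \<and> t < h \<and>
    g (x + h *\<^sub>R v + h *\<^sub>R w) - g (x + h *\<^sub>R v) - g (x + h *\<^sub>R w) + g x
      = h\<^sup>2 * partial_deriv w (partial_deriv v g) (x + s *\<^sub>R v + t *\<^sub>R w)"
proof -
  have g1: "g differentiable at y" and g2: "partial_deriv v g differentiable at y" if "y \<in> S" for y
    using assms(1,2) Ck_on_partial_deriv[of S 1 g v] that by (auto simp: numeral_2_eq_2)
  have d1: "((\<lambda>s. g (x + s *\<^sub>R v + t *\<^sub>R w)) has_real_derivative partial_deriv v g (x + s *\<^sub>R v + t *\<^sub>R w)) (at s)"
    if "0 \<le> s" "s \<le> h" "0 \<le> t" "t \<le> h" for s t
    using has_real_derivative_line[where g = g and x = "x + t *\<^sub>R w" and t = s and v = v] g1[OF sub[OF that]]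
    by (simp add: algebra_simps)
  have "\<exists>s>0. s < h \<and> (g (x + h *\<^sub>R v + h *\<^sub>R w) - g (x + h *\<^sub>R v + 0 *\<^sub>R w)) - (g (x + 0 *\<^sub>R v + h *\<^sub>R w) - g (x + 0 *\<^sub>R v + 0 *\<^sub>R w))
    = (h - 0) * (partial_deriv v g (x + s *\<^sub>R v + h *\<^sub>R w) - partial_deriv v g (x + s *\<^sub>R v + 0 *\<^sub>R w))"
    by (rule MVT2) (use h in \<open>auto intro!: DERIV_diff d1[of _ h] d1[of _ 0, simplified]\<close>)
  then obtain s where s: "0 < s" "s < h"
    "g (x + h *\<^sub>R v + h *\<^sub>R w) - g (x + h *\<^sub>R v) - g (x + h *\<^sub>R w) + g x
    = h * (partial_deriv v g (x + s *\<^sub>R v + h *\<^sub>R w) - partial_deriv v g (x + s *\<^sub>R v + 0 *\<^sub>R w))"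
    by auto
  have "\<exists>t>0. t < h \<and> partial_deriv v g (x + s *\<^sub>R v + h *\<^sub>R w) - partial_deriv v g (x + s *\<^sub>R v + 0 *\<^sub>R w)
    = (h - 0) * partial_deriv w (partial_deriv v g) (x + s *\<^sub>R v + t *\<^sub>R w)"
    by (rule MVT2) (use h s in \<open>auto intro!: has_real_derivative_line g2 sub\<close>)
  then obtain t where "0 < t" "t < h"
    "partial_deriv v g (x + s *\<^sub>R v + h *\<^sub>R w) - partial_deriv v g (x + s *\<^sub>R v + 0 *\<^sub>R w)
     = h * partial_deriv w (partial_deriv v g) (x + s *\<^sub>R v + t *\<^sub>R w)"
    by auto
  with s show ?thesis by (auto simp: power2_eq_square mult.assoc)
qed

text \<open>The second difference over a small parallelogram is symmetric in v and w. Two mean value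
  arguments express it as h^2 times either mixed derivative at nearby points, and continuity makes
  these agree at x.\<close>

lemma partial_deriv_commute:
  assumes S: "open S" and g: "Ck_on 2 S g" and x: "x \<in> S"
  shows "partial_deriv v (partial_deriv w g) x = partial_deriv w (partial_deriv v g) x"
proof (rule ccontr)
  assume ne: "\<not> ?thesis"
  define \<epsilon> where "\<epsilon> = \<bar>partial_deriv v (partial_deriv w g) x - partial_deriv w (partial_deriv v g) x\<bar> / 2"
  have \<epsilon>: "\<epsilon> > 0" using ne by (simp add: \<epsilon>_def)
  have cont: "isCont (partial_deriv a (partial_deriv b g)) x" for a b
  proof -
    have "Ck_on 0 S (partial_deriv a (partial_deriv b g))"
      using g by (intro Ck_on_partial_deriv S) (simp_all add: numeral_2_eq_2 del: Ck_on.simps)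
    then show ?thesis using S x by (simp add: continuous_on_eq_continuous_at)
  qed
  obtain d1 where d1: "d1 > 0" "\<And>y. dist y x < d1 \<Longrightarrow>
      dist (partial_deriv v (partial_deriv w g) y) (partial_deriv v (partial_deriv w g) x) < \<epsilon>"
    using cont[of v w] \<epsilon> unfolding continuous_at_eps_delta by metis
  obtain d2 where d2: "d2 > 0" "\<And>y. dist y x < d2 \<Longrightarrow>
      dist (partial_deriv w (partial_deriv v g) y) (partial_deriv w (partial_deriv v g) x) < \<epsilon>"
    using cont[of w v] \<epsilon> unfolding continuous_at_eps_delta by metis
  obtain d3 where d3: "d3 > 0" "ball x d3 \<subseteq> S"
    using S x open_contains_ball by blast
  define d where "d = min d1 (min d2 d3)"
  have d: "d > 0" using d1 d2 d3 by (simp add: d_def)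
  \<comment> \<open>The parallelogram with sides h v and h w then stays within distance d / 2 of x;
    the summand 1 keeps the quotient meaningful for v = w = 0.\<close>
  define h where "h = d / (2 * (norm v + norm w + 1))"
  have np: "norm v + norm w + 1 > 0" by (smt (verit) norm_ge_zero)
  have h: "h > 0" using d np by (simp add: h_def)
  have close: "dist (x + s *\<^sub>R a + t *\<^sub>R b) x < d"
    if "0 \<le> s" "s \<le> h" "0 \<le> t" "t \<le> h" "norm a + norm b = norm v + norm w" for s t and a b :: 'a
  proof -
    have "dist (x + s *\<^sub>R a + t *\<^sub>R b) x = norm (s *\<^sub>R a + t *\<^sub>R b)" by (simp add: dist_norm algebra_simps)
    also have "\<dots> \<le> s * norm a + t * norm b" using that norm_triangle_ineq[of "s *\<^sub>R a" "t *\<^sub>R b"] by simp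
    also have "\<dots> \<le> h * norm a + h * norm b" using that by (intro add_mono mult_right_mono) auto
    also have "\<dots> = h * (norm v + norm w)" using that by (simp flip: distrib_left)
    also have "\<dots> \<le> h * (norm v + norm w + 1)" using h by simp
    also have "\<dots> = d / 2" using np unfolding h_def by (simp add: divide_simps)
    finally show ?thesis using d by simp
  qed
  have inS: "y \<in> S" if "dist y x < d" for y
    using that d3 by (auto simp: d_def dist_commute subset_eq)
  obtain s t where st: "0 < s" "s < h" "0 < t" "t < h"
    "g (x + h *\<^sub>R v + h *\<^sub>R w) - g (x + h *\<^sub>R v) - g (x + h *\<^sub>R w) + g x
      = h\<^sup>2 * partial_deriv w (partial_deriv v g) (x + s *\<^sub>R v + t *\<^sub>R w)"
    using mixed_difference_mean_value[OF g S h, of x v w] close inS by blast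
  obtain s' t' where st': "0 < s'" "s' < h" "0 < t'" "t' < h"
    "g (x + h *\<^sub>R w + h *\<^sub>R v) - g (x + h *\<^sub>R w) - g (x + h *\<^sub>R v) + g x
      = h\<^sup>2 * partial_deriv v (partial_deriv w g) (x + s' *\<^sub>R w + t' *\<^sub>R v)"
    using mixed_difference_mean_value[OF g S h, of x w v] close[where a = w and b = v] inS
    by (metis add.commute)
  have swap: "x + h *\<^sub>R w + h *\<^sub>R v = x + h *\<^sub>R v + h *\<^sub>R w" by simp
  have "h\<^sup>2 * partial_deriv v (partial_deriv w g) (x + s' *\<^sub>R w + t' *\<^sub>R v)
    = h\<^sup>2 * partial_deriv w (partial_deriv v g) (x + s *\<^sub>R v + t *\<^sub>R w)"
    using st(5) st'(5) unfolding swap by linarith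
  then have eq: "partial_deriv v (partial_deriv w g) (x + s' *\<^sub>R w + t' *\<^sub>R v)
    = partial_deriv w (partial_deriv v g) (x + s *\<^sub>R v + t *\<^sub>R w)"
    using h by simp
  have "dist (x + s *\<^sub>R v + t *\<^sub>R w) x < d2" "dist (x + s' *\<^sub>R w + t' *\<^sub>R v) x < d1"
    using close[of s t v w] close[of s' t' w v] st st' by (auto simp: d_def)
  from d2(2)[OF this(1)] d1(2)[OF this(2)] eq show False
    unfolding \<epsilon>_def dist_real_def by (smt (verit) field_sum_of_halves)
qed

lemma partial_deriv_commute3:
  assumes S: "open S" and g: "Ck_on 3 S g" and x: "x \<in> S"
  shows "partial_deriv a (partial_deriv b (partial_deriv b g)) x
    = partial_deriv b (partial_deriv b (partial_deriv a g)) x"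
proof -
  have g2: "Ck_on 2 S g" by (rule Ck_on_mono[OF g]) simp
  have "Ck_on 2 S (partial_deriv b g)"
    using g by (intro Ck_on_partial_deriv S) (simp_all add: numeral_eq_Suc del: Ck_on.simps)
  then have "partial_deriv a (partial_deriv b (partial_deriv b g)) x
    = partial_deriv b (partial_deriv a (partial_deriv b g)) x"
    by (rule partial_deriv_commute[OF S _ x])
  also have "\<dots> = partial_deriv b (partial_deriv b (partial_deriv a g)) x"
    by (rule partial_deriv_cong_open[OF S x]) (rule partial_deriv_commute[OF S g2])
  finally show ?thesis .
qed

lemma partial_deriv_commute4:
  assumes S: "open S" and g: "Ck_on 4 S g" and x: "x \<in> S"
  shows "partial_deriv a (partial_deriv a (partial_deriv b (partial_deriv b g))) x
    = partial_deriv b (partial_deriv b (partial_deriv a (partial_deriv a g))) x"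
proof -
  have g3: "Ck_on 3 S g" by (rule Ck_on_mono[OF g]) simp
  have "partial_deriv a (partial_deriv a (partial_deriv b (partial_deriv b g))) x
    = partial_deriv a (partial_deriv b (partial_deriv b (partial_deriv a g))) x"
    by (rule partial_deriv_cong_open[OF S x]) (rule partial_deriv_commute3[OF S g3])
  also have "\<dots> = partial_deriv b (partial_deriv b (partial_deriv a (partial_deriv a g))) x"
    by (rule partial_deriv_commute3[OF S _ x], rule Ck_on_partial_deriv[OF S])
      (use g in \<open>simp add: numeral_eq_Suc del: Ck_on.simps\<close>)
  finally show ?thesis .
qed

text \<open>The bridge between the matrix, which carries the eigenvalues, and iterated directional
  derivatives, on which all the calculus is done.\<close>

lemma hessian_bilinear:
  fixes g :: "real^'n \<Rightarrow> real"
  assumes S: "open S" and g: "Ck_on 2 S g" and x: "x \<in> S"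
  shows "(hessian g x *v b) \<bullet> a = partial_deriv a (partial_deriv b g) x"
proof -
  let ?D = "\<lambda>j. partial_deriv (axis j 1) g"
  have rep: "h differentiable at y \<Longrightarrow> partial_deriv v h y = (\<Sum>j\<in>UNIV. v $ j * partial_deriv (axis j 1) h y)"
    for h :: "real^'n \<Rightarrow> real" and v y
  proof -
    assume h: "h differentiable at y"
    have B: "(Basis :: (real^'n) set) = range (\<lambda>j. axis j 1)"
      by (auto simp: Basis_vec_def)
    have inj: "inj (\<lambda>j. axis j 1 :: real^'n)"
      by (auto simp: inj_on_def axis_eq_axis)
    show ?thesis
      unfolding partial_deriv_basis_sum[OF h, of v] B sum.reindex[OF inj]
      by (simp add: inner_axis)
  qed
  have g1: "g differentiable at y" if "y \<in> S" for y
    using g that by (simp add: numeral_2_eq_2)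
  have d1: "partial_deriv v g differentiable at x" for v
    using Ck_on_partial_deriv[OF S, of 1 g v] g x by (simp add: numeral_2_eq_2)
  have "partial_deriv a (partial_deriv b g) x = partial_deriv a (\<lambda>y. \<Sum>j\<in>UNIV. b $ j * ?D j y) x"
    by (rule partial_deriv_cong_open[OF S x]) (rule rep[OF g1])
  also have "\<dots> = (\<Sum>j\<in>UNIV. b $ j * partial_deriv a (?D j) x)"
  proof -
    have "((\<lambda>y. \<Sum>j\<in>UNIV. b $ j * ?D j y) has_derivative (\<lambda>h. \<Sum>j\<in>UNIV. b $ j * (grad (?D j) x \<bullet> h))) (at x)"
      by (intro has_derivative_sum has_derivative_mult_right has_derivative_grad d1)
    from fun_cong[OF frechet_derivative_at[OF this], of a] show ?thesis
      unfolding partial_deriv_def[of a "\<lambda>y. \<Sum>j\<in>UNIV. b $ j * ?D j y"] partial_deriv_grad[OF d1]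
      by (rule sym)
  qed
  also have "\<dots> = (\<Sum>j\<in>UNIV. b $ j * (\<Sum>i\<in>UNIV. a $ i * hessian g x $ i $ j))"
    by (simp add: rep[OF d1, of a] hessian_def)
  also have "\<dots> = (\<Sum>i\<in>UNIV. \<Sum>j\<in>UNIV. b $ j * (a $ i * hessian g x $ i $ j))"
    unfolding sum_distrib_left by (rule sum.swap)
  also have "\<dots> = (hessian g x *v b) \<bullet> a"
    unfolding matrix_vector_mult_def inner_vec_def
    by (simp add: sum_distrib_right) (intro sum.cong refl; simp)
  finally show ?thesis by simp
qed

lemma hessian_symmetric:
  fixes g :: "real^'n \<Rightarrow> real"
  assumes S: "open S" and g: "Ck_on 2 S g" and x: "x \<in> S"
  shows "Finite_Cartesian_Product.transpose (hessian g x) = hessian g x"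
  by (simp add: Finite_Cartesian_Product.transpose_def hessian_def vec_eq_iff partial_deriv_commute[OF S g x])

text \<open>The first derivative is required near 0, the second only at 0, which is all that a
  second-order test uses. As a relation with explicit values a and b it is closed under the rules
  below, so that derivatives of composite expressions are computed by unification.\<close>

definition has_deriv2 :: "(real \<Rightarrow> real) \<Rightarrow> real \<Rightarrow> real \<Rightarrow> bool" where
  "has_deriv2 g a b \<longleftrightarrow> (\<exists>g'. (\<forall>\<^sub>F t in nhds 0. (g has_real_derivative g' t) (at t)) \<and>
     g' 0 = a \<and> (g' has_real_derivative b) (at 0))"

lemma has_deriv2_imp_isCont: "has_deriv2 g a b \<Longrightarrow> isCont g 0"
  by (auto simp: has_deriv2_def dest!: eventually_nhds_x_imp_x intro: DERIV_isCont)

lemma has_deriv2_imp_DERIV: "has_deriv2 g a b \<Longrightarrow> (g has_real_derivative a) (at 0)"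
  by (auto simp: has_deriv2_def dest!: eventually_nhds_x_imp_x)

lemma has_deriv2_const: "has_deriv2 (\<lambda>t. c) 0 0"
  unfolding has_deriv2_def by (rule exI[of _ "\<lambda>t. 0"]) auto

lemma has_deriv2_add:
  assumes "has_deriv2 f a b" "has_deriv2 g c d"
  shows "has_deriv2 (\<lambda>t. f t + g t) (a + c) (b + d)"
proof -
  obtain f' g' where *: "\<forall>\<^sub>F t in nhds 0. (f has_real_derivative f' t) (at t)" "f' 0 = a" "(f' has_real_derivative b) (at 0)"
    "\<forall>\<^sub>F t in nhds 0. (g has_real_derivative g' t) (at t)" "g' 0 = c" "(g' has_real_derivative d) (at 0)"
    using assms by (auto simp: has_deriv2_def)
  have "\<forall>\<^sub>F t in nhds 0. ((\<lambda>t. f t + g t) has_real_derivative f' t + g' t) (at t)"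
    using *(1,4) by eventually_elim (rule DERIV_add)
  then show ?thesis
    unfolding has_deriv2_def using *
    by (intro exI[of _ "\<lambda>t. f' t + g' t"] conjI DERIV_add) auto
qed

lemma has_deriv2_mult:
  assumes "has_deriv2 f a b" "has_deriv2 g c d"
  shows "has_deriv2 (\<lambda>t. f t * g t) (a * g 0 + c * f 0) (b * g 0 + 2 * (a * c) + d * f 0)"
proof -
  obtain f' g' where *: "\<forall>\<^sub>F t in nhds 0. (f has_real_derivative f' t) (at t)" "f' 0 = a" "(f' has_real_derivative b) (at 0)"
    "\<forall>\<^sub>F t in nhds 0. (g has_real_derivative g' t) (at t)" "g' 0 = c" "(g' has_real_derivative d) (at 0)"
    using assms by (auto simp: has_deriv2_def)
  have "\<forall>\<^sub>F t in nhds 0. ((\<lambda>t. f t * g t) has_real_derivative f' t * g t + g' t * f t) (at t)"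
    using *(1,4) by eventually_elim (rule DERIV_mult)
  moreover have "((\<lambda>t. f' t * g t + g' t * f t) has_real_derivative b * g 0 + 2 * (a * c) + d * f 0) (at 0)"
    using * has_deriv2_imp_DERIV[OF assms(1)] has_deriv2_imp_DERIV[OF assms(2)]
    by (auto intro!: derivative_eq_intros)
  ultimately show ?thesis
    unfolding has_deriv2_def using *(2,5) by (intro exI[of _ "\<lambda>t. f' t * g t + g' t * f t"]) auto
qed

lemma has_deriv2_cmult:
  "has_deriv2 f a b \<Longrightarrow> has_deriv2 (\<lambda>t. c * f t) (c * a) (c * b)"
  using has_deriv2_mult[OF has_deriv2_const[of c], of f a b] by (simp add: mult.commute)

lemma has_deriv2_diff:
  "has_deriv2 f a b \<Longrightarrow> has_deriv2 g c d \<Longrightarrow> has_deriv2 (\<lambda>t. f t - g t) (a - c) (b - d)"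
  using has_deriv2_add[of f a b "\<lambda>t. (-1) * g t" "-c" "-d"] has_deriv2_cmult[of g c d "-1"] by simp

lemma has_deriv2_sum:
  assumes "finite I" "\<And>i. i \<in> I \<Longrightarrow> has_deriv2 (f i) (a i) (b i)"
  shows "has_deriv2 (\<lambda>t. \<Sum>i\<in>I. f i t) (\<Sum>i\<in>I. a i) (\<Sum>i\<in>I. b i)"
  using assms by (induction I rule: finite_induct) (auto intro: has_deriv2_const has_deriv2_add)

lemma has_deriv2_power2:
  "has_deriv2 f a b \<Longrightarrow> has_deriv2 (\<lambda>t. (f t)\<^sup>2) (2 * f 0 * a) (2 * a\<^sup>2 + 2 * f 0 * b)"
  using has_deriv2_mult[of f a b f a b] by (simp add: power2_eq_square algebra_simps)

lemma has_deriv2_ln: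
  assumes "has_deriv2 f a b" "f 0 > 0"
  shows "has_deriv2 (\<lambda>t. ln (f t)) (a / f 0) (b / f 0 - (a / f 0)\<^sup>2)"
proof -
  obtain f' where *: "\<forall>\<^sub>F t in nhds 0. (f has_real_derivative f' t) (at t)" "f' 0 = a" "(f' has_real_derivative b) (at 0)"
    using assms by (auto simp: has_deriv2_def)
  have "(f \<longlongrightarrow> f 0) (nhds 0)"
    using has_deriv2_imp_isCont[OF assms(1)] by (simp add: isCont_def tendsto_nhds_iff)
  then have "\<forall>\<^sub>F t in nhds 0. f t > 0"
    using assms(2) by (rule order_tendstoD)
  with *(1) have "\<forall>\<^sub>F t in nhds 0. ((\<lambda>t. ln (f t)) has_real_derivative f' t / f t) (at t)"
    by eventually_elim (auto intro!: derivative_eq_intros)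
  moreover have "((\<lambda>t. f' t / f t) has_real_derivative b / f 0 - (a / f 0)\<^sup>2) (at 0)"
    using * has_deriv2_imp_DERIV[OF assms(1)] assms(2)
    by (auto intro!: derivative_eq_intros simp: field_simps power2_eq_square)
  ultimately show ?thesis
    unfolding has_deriv2_def using *(2) by (intro exI[of _ "\<lambda>t. f' t / f t"]) auto
qed

lemma has_deriv2_explicit:
  assumes "\<And>t. (g has_real_derivative g' t) (at t)" "g' 0 = a" "(g' has_real_derivative b) (at 0)"
  shows "has_deriv2 g a b"
  using assms unfolding has_deriv2_def by (intro exI[of _ g']) auto

text \<open>If b were positive, the first derivative would be positive just to the right of 0, and
  the mean value theorem would lift g above g 0.\<close>

lemma has_deriv2_local_max:
  assumes g: "has_deriv2 g a b" and max: "\<forall>\<^sub>F t in nhds 0. g t \<le> g 0"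
  shows "a = 0" "b \<le> 0"
proof -
  obtain d where d: "d > 0" "\<And>t. \<bar>t\<bar> < d \<Longrightarrow> g t \<le> g 0"
    using max by (auto simp: eventually_nhds_metric dist_real_def)
  show a: "a = 0"
    by (rule DERIV_local_max[OF has_deriv2_imp_DERIV[OF g] d(1)]) (use d in auto)
  obtain g' where *: "\<forall>\<^sub>F t in nhds 0. (g has_real_derivative g' t) (at t)" "g' 0 = 0" "(g' has_real_derivative b) (at 0)"
    using g a by (auto simp: has_deriv2_def)
  obtain d' where d': "d' > 0" "\<And>t. \<bar>t\<bar> < d' \<Longrightarrow> (g has_real_derivative g' t) (at t)"
    using *(1) by (auto simp: eventually_nhds_metric dist_real_def)
  show "b \<le> 0"
  proof (rule ccontr)
    assume "\<not> b \<le> 0"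
    then obtain r where r: "r > 0" "\<And>h. 0 < h \<Longrightarrow> h < r \<Longrightarrow> g' h > 0"
      using DERIV_pos_inc_right[OF *(3)] *(2) by auto
    define h where "h = min d (min d' r) / 2"
    have h: "0 < h" "h < d" "h < d'" "h < r" using d(1) d'(1) r(1) by (auto simp: h_def)
    obtain z where "0 < z" "z < h" "g h - g 0 = (h - 0) * g' z"
      using MVT2[OF h(1), of g g'] d'(2) h by auto
    moreover have "h * g' z > 0" using h r(2)[of z] \<open>0 < z\<close> \<open>z < h\<close> by simp
    ultimately show False using d(2)[of h] h by auto
  qed
qed

lemma has_deriv2_local_min:
  assumes g: "has_deriv2 g a b" and min: "\<forall>\<^sub>F t in nhds 0. g t \<ge> g 0"
  shows "a = 0" "b \<ge> 0"
  using has_deriv2_local_max[OF has_deriv2_cmult[OF g, of "-1"]] min by auto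

lemma eventually_line_in_open:
  fixes x :: "'a::real_normed_vector"
  assumes "open S" "x \<in> S"
  shows "\<forall>\<^sub>F t in nhds 0. x + t *\<^sub>R v \<in> S"
proof -
  have "((\<lambda>t. x + t *\<^sub>R v) \<longlongrightarrow> x + 0 *\<^sub>R v) (nhds 0)"
    by (intro tendsto_intros filterlim_ident)
  then show ?thesis using assms by (simp add: topological_tendstoD)
qed

lemma has_deriv2_line:
  assumes S: "open S" and g: "Ck_on 2 S g" and x: "x \<in> S"
  shows "has_deriv2 (\<lambda>t. g (x + t *\<^sub>R v)) (partial_deriv v g x) (partial_deriv v (partial_deriv v g) x)"
proof -
  have g1: "g differentiable at y" if "y \<in> S" for y
    using g that by (simp add: numeral_2_eq_2)
  have d1: "partial_deriv v g differentiable at x"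
    using Ck_on_partial_deriv[OF S, of 1 g v] g x by (simp add: numeral_2_eq_2)
  have "\<forall>\<^sub>F t in nhds 0. ((\<lambda>t. g (x + t *\<^sub>R v)) has_real_derivative partial_deriv v g (x + t *\<^sub>R v)) (at t)"
    using eventually_line_in_open[OF S x, of v]
    by eventually_elim (intro has_real_derivative_line g1)
  moreover have "((\<lambda>t. partial_deriv v g (x + t *\<^sub>R v)) has_real_derivative
      partial_deriv v (partial_deriv v g) x) (at 0)"
    using has_real_derivative_line[of "partial_deriv v g" x 0 v] d1 by simp
  ultimately show ?thesis
    unfolding has_deriv2_def
    by (intro exI[of _ "\<lambda>t. partial_deriv v g (x + t *\<^sub>R v)"]) auto
qed

section \<open>The inequality at a maximum point\<close>

text \<open>The computation at the maximum, stripped of analysis. With \<phi> = w - u and H = u_mm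
  the letters stand for q_i = D_i \<phi> / \<phi>, r_i = D_ii \<phi> / \<phi>, P_i = D_i H / H, R_i
  = D_ii H, u_i = D_i u, and s_i for the sum over j of u_j u_jii. E1 and E2 are the first-order and
  the weighted second-order condition for the logarithm of the test function; E3 comes from the
  equation differentiated once, E4 from the rotating frame, E5 from the barrier.\<close>

lemma pogorelov_algebra:
  fixes a l q r P R s u :: "nat \<Rightarrow> real"
  assumes m: "m < n" and \<delta>: "\<delta> > 0" and \<beta>: "\<beta> = 1 + \<delta>" and \<epsilon>: "\<epsilon> = \<delta> / (4 + 3 * \<delta>)"
    and K: "K \<ge> 1" and \<alpha>: "\<alpha> > 0" "64 * real n * K\<^sup>2 * (1 + 2 / \<delta>) * \<alpha> \<le> 1"
    and L: "l m > 0" "\<And>i. i < n \<Longrightarrow> l i \<le> l m"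
    and a: "a m > 0" "\<And>i. i < n \<Longrightarrow> a m \<le> a i" and \<kappa>: "a m * l m \<ge> \<kappa>"
    and \<phi>: "\<phi> > 0" "16 * real n * \<beta>\<^sup>2 * K\<^sup>2 \<le> \<alpha> * \<epsilon>\<^sup>2 * \<phi>\<^sup>2 * (l m)\<^sup>2"
    and E1: "\<And>i. i < n \<Longrightarrow> \<beta> * q i + P i + 2 * \<alpha> * u i * l i = 0"
    and q: "\<And>i. i < n \<Longrightarrow> \<bar>q i\<bar> \<le> K / \<phi>" and u: "\<And>i. i < n \<Longrightarrow> \<bar>u i\<bar> \<le> K"
    and E2: "(\<Sum>i<n. a i * (\<beta> * (r i - (q i)\<^sup>2) + R i / l m - (P i)\<^sup>2 + 2 * \<alpha> * ((l i)\<^sup>2 + s i))) \<le> 0"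
    and E3: "(\<Sum>i<n. a i * s i) \<ge> - D"
    and E4: "(\<Sum>i<n. a i * R i) \<ge> - B + (\<Sum>i<n. if l i < l m then 2 * (a i - a m) / (l m - l i) * (l m * P i)\<^sup>2 else 0)"
    and E5: "(\<Sum>i<n. a i * r i) \<ge> - N / \<phi>"
  shows "\<alpha> / 2 * \<kappa> * l m \<le> \<beta> * N / \<phi> + B / l m + 2 * \<alpha> * D"
proof -
  define \<Lambda> where "\<Lambda> = l m"
  have \<Lambda>: "\<Lambda> > 0" using L by (simp add: \<Lambda>_def)
  have \<beta>1: "\<beta> > 1" using \<beta> \<delta> by simp
  have \<epsilon>0: "0 < \<epsilon>" "\<epsilon> \<le> 1" using \<delta> by (auto simp: \<epsilon> field_simps)
  have n1: "real n \<ge> 1" using m by simp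
  have K2: "K\<^sup>2 \<ge> 1" using K by simp
  have \<alpha>s: "64 * real n * K\<^sup>2 * \<alpha> \<le> 1" "8 * K\<^sup>2 * (1 + 2 / \<delta>) * \<alpha> \<le> 1"
  proof -
    have d: "1 + 2 / \<delta> \<ge> 1" using \<delta> by simp
    have "64 * real n * K\<^sup>2 * \<alpha> * 1 \<le> 64 * real n * K\<^sup>2 * \<alpha> * (1 + 2 / \<delta>)"
      using d \<alpha> by (intro mult_left_mono) auto
    then show "64 * real n * K\<^sup>2 * \<alpha> \<le> 1" using \<alpha>(2) by (simp add: mult.commute mult.left_commute)
    have "8 * 1 * (K\<^sup>2 * (1 + 2 / \<delta>) * \<alpha>) \<le> 64 * real n * (K\<^sup>2 * (1 + 2 / \<delta>) * \<alpha>)"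
      using d \<alpha> n1 K2 by (intro mult_right_mono) auto
    also have "\<dots> \<le> 1" using \<alpha>(2) by (simp only: mult_ac)
    finally show "8 * K\<^sup>2 * (1 + 2 / \<delta>) * \<alpha> \<le> 1" by (simp only: mult_ac mult_1_left)
  qed
  have \<alpha>K: "64 * K\<^sup>2 * \<alpha> \<le> 1"
  proof -
    have "64 * 1 * (K\<^sup>2 * \<alpha>) \<le> 64 * real n * (K\<^sup>2 * \<alpha>)"
      using \<alpha> n1 K2 by (intro mult_right_mono) auto
    then show ?thesis using \<alpha>s(1) by (simp add: mult.assoc)
  qed
  have q2: "(q i)\<^sup>2 \<le> K\<^sup>2 / \<phi>\<^sup>2" if "i < n" for i
    using power_mono[OF q[OF that], of 2] by (simp add: power_divide)
  have u2: "(u i)\<^sup>2 \<le> K\<^sup>2" if "i < n" for i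
    using power_mono[OF u[OF that], of 2] by simp
  \<comment> \<open>The assumed lower bound on \<phi> * l m turns the bound K / \<phi> for q i into
    smallness relative to \<open>\<Lambda>\<close>.\<close>
  have K\<phi>: "16 * real n * \<beta>\<^sup>2 * (K\<^sup>2 / \<phi>\<^sup>2) \<le> \<alpha> * \<epsilon>\<^sup>2 * \<Lambda>\<^sup>2"
    using \<phi> by (simp add: \<Lambda>_def divide_le_eq mult_ac)
  have \<epsilon>\<Lambda>: "\<alpha> * \<epsilon>\<^sup>2 * \<Lambda>\<^sup>2 \<le> \<alpha> * \<Lambda>\<^sup>2"
    using \<epsilon>0 \<alpha> power_le_one[of \<epsilon> 2] by (simp add: mult_left_le_one_le mult_right_le_one_le)
  have \<beta>q: "16 * \<beta>\<^sup>2 * (q i)\<^sup>2 \<le> \<alpha> * \<epsilon>\<^sup>2 * \<Lambda>\<^sup>2" if "i < n" for i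
  proof -
    have "16 * \<beta>\<^sup>2 * (q i)\<^sup>2 \<le> 16 * \<beta>\<^sup>2 * (K\<^sup>2 / \<phi>\<^sup>2)"
      using q2[OF that] by (intro mult_left_mono) auto
    also have "\<dots> = 1 * (16 * \<beta>\<^sup>2 * (K\<^sup>2 / \<phi>\<^sup>2))" by simp
    also have "\<dots> \<le> n * (16 * \<beta>\<^sup>2 * (K\<^sup>2 / \<phi>\<^sup>2))"
      using n1 by (intro mult_right_mono) auto
    also have "\<dots> \<le> \<alpha> * \<epsilon>\<^sup>2 * \<Lambda>\<^sup>2" using K\<phi> by (simp add: mult_ac)
    finally show ?thesis .
  qed
  have n\<beta>q: "16 * real n * \<beta>\<^sup>2 * (q i)\<^sup>2 \<le> \<alpha> * \<Lambda>\<^sup>2" if "i < n" for i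
  proof -
    have "16 * real n * \<beta>\<^sup>2 * (q i)\<^sup>2 \<le> 16 * real n * \<beta>\<^sup>2 * (K\<^sup>2 / \<phi>\<^sup>2)"
      using q2[OF that] by (intro mult_left_mono) auto
    then show ?thesis using K\<phi> \<epsilon>\<Lambda> by linarith
  qed
  have \<alpha>ul: "64 * real n * (\<alpha> * u i * l i)\<^sup>2 \<le> \<alpha> * (l i)\<^sup>2"
    "8 * (1 + 2 / \<delta>) * (\<alpha> * u i * l i)\<^sup>2 \<le> \<alpha> * (l i)\<^sup>2"
    "64 * (\<alpha> * u i * l i)\<^sup>2 \<le> \<alpha> * (l i)\<^sup>2" if "i < n" for i
  proof -
    have *: "c * (\<alpha> * u i * l i)\<^sup>2 \<le> \<alpha> * (l i)\<^sup>2" if c: "c \<ge> 0" "c * K\<^sup>2 * \<alpha> \<le> 1" for c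
    proof -
      have "c * (\<alpha> * u i * l i)\<^sup>2 = (c * \<alpha>\<^sup>2 * (l i)\<^sup>2) * (u i)\<^sup>2" by (simp add: power_mult_distrib)
      also have "\<dots> \<le> (c * \<alpha>\<^sup>2 * (l i)\<^sup>2) * K\<^sup>2"
        using c u2[OF \<open>i < n\<close>] by (intro mult_left_mono) auto
      also have "\<dots> = (c * K\<^sup>2 * \<alpha>) * (\<alpha> * (l i)\<^sup>2)" by (simp add: power2_eq_square)
      also have "\<dots> \<le> 1 * (\<alpha> * (l i)\<^sup>2)" using c \<alpha> by (intro mult_right_mono) auto
      finally show ?thesis by simp
    qed
    show "64 * real n * (\<alpha> * u i * l i)\<^sup>2 \<le> \<alpha> * (l i)\<^sup>2" using \<alpha>s(1) by (intro *) (auto simp: mult_ac)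
    show "8 * (1 + 2 / \<delta>) * (\<alpha> * u i * l i)\<^sup>2 \<le> \<alpha> * (l i)\<^sup>2"
    proof (rule *)
      show "8 * (1 + 2 / \<delta>) * K\<^sup>2 * \<alpha> \<le> 1" using \<alpha>s(2) by (simp only: mult_ac)
    qed (use \<delta> in simp)
    show "64 * (\<alpha> * u i * l i)\<^sup>2 \<le> \<alpha> * (l i)\<^sup>2" using \<alpha>K by (intro *) auto
  qed
  have P2: "(P i)\<^sup>2 \<le> 2 * \<beta>\<^sup>2 * (q i)\<^sup>2 + 8 * (\<alpha> * u i * l i)\<^sup>2" if "i < n" for i
  proof -
    have "P i = - (\<beta> * q i + 2 * (\<alpha> * u i * l i))" using E1[OF that] by (simp add: mult.assoc)
    then have "(P i)\<^sup>2 = (\<beta> * q i + 2 * (\<alpha> * u i * l i))\<^sup>2" by (simp only: power2_minus)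
    also have "\<dots> \<le> 2 * (\<beta> * q i)\<^sup>2 + 2 * (2 * (\<alpha> * u i * l i))\<^sup>2"
      using zero_le_power2[of "\<beta> * q i - 2 * (\<alpha> * u i * l i)"]
      by (simp add: power2_sum power2_diff)
    finally show ?thesis by (simp add: power_mult_distrib)
  qed
  \<comment> \<open>The value of \<open>\<epsilon>\<close> is tuned so that c equals 1 + (1 +
    \<delta> / 2) / \<beta>. On the other hand c bounds 2 \<Lambda> / (\<Lambda> - l_i) from below
    as long as l_i \<ge> -\<epsilon> \<Lambda>.\<close>
  define c where "c = 2 / (1 + \<epsilon>)"
  have c: "0 < c" "c \<le> 2" using \<epsilon>0 by (auto simp: c_def field_simps)
  have c\<beta>: "1 + (1 + \<delta> / 2) / \<beta> \<le> c"
    using \<delta> by (simp add: c_def \<epsilon> \<beta> field_simps)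
  \<comment> \<open>Each direction keeps \<alpha> a_i l_i^2 up to a loss of 1 / n times half of
    \<alpha> a_m \<Lambda>^2. Summed over i, the losses use up only half of the term with i =
    m.\<close>
  have point: "a i * (- \<beta> * (q i)\<^sup>2 - (P i)\<^sup>2 + 2 * \<alpha> * (l i)\<^sup>2)
      + (if l i < l m then 2 * (a i - a m) / (l m - l i) * (l m * P i)\<^sup>2 else 0) / \<Lambda>
    \<ge> a i * (\<alpha> * (l i)\<^sup>2) - \<alpha> / (2 * real n) * (a m * \<Lambda>\<^sup>2)" (is "?lhs \<ge> ?rhs") if i: "i < n" for i
  proof (cases "- \<epsilon> * \<Lambda> \<le> l i \<and> l i < \<Lambda>")
    \<comment> \<open>Here, in particular for i = m, |l_i| is at least \<epsilon> \<Lambda>, so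
      \<alpha> l_i^2 dominates q_i^2 and hence P_i^2; the third-order term is merely
      nonnegative.\<close>
    case False
    have ai: "a i > 0" using a(1) a(2)[OF i] by linarith
    have "l i = \<Lambda> \<or> l i < - (\<epsilon> * \<Lambda>)" using False L(2)[OF i] by (auto simp: \<Lambda>_def)
    then have "(\<epsilon> * \<Lambda>)\<^sup>2 \<le> (l i)\<^sup>2"
    proof
      assume "l i = \<Lambda>"
      then show ?thesis using \<epsilon>0 \<Lambda> by (intro power_mono) (auto simp: mult_left_le_one_le)
    next
      assume "l i < - (\<epsilon> * \<Lambda>)"
      then have "\<epsilon> * \<Lambda> \<le> - l i" by simp
      then have "(\<epsilon> * \<Lambda>)\<^sup>2 \<le> (- l i)\<^sup>2" using \<epsilon>0 \<Lambda> by (intro power_mono) auto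
      then show ?thesis by simp
    qed
    then have "\<alpha> * \<epsilon>\<^sup>2 * \<Lambda>\<^sup>2 \<le> \<alpha> * (l i)\<^sup>2" using \<alpha> by (simp add: power_mult_distrib mult.assoc)
    then have "16 * \<beta>\<^sup>2 * (q i)\<^sup>2 \<le> \<alpha> * (l i)\<^sup>2" using \<beta>q[OF i] by linarith
    moreover have "\<beta> * (q i)\<^sup>2 \<le> \<beta>\<^sup>2 * (q i)\<^sup>2"
      using \<beta>1 by (intro mult_right_mono) (auto simp: power2_eq_square)
    ultimately have "- \<beta> * (q i)\<^sup>2 - (P i)\<^sup>2 + 2 * \<alpha> * (l i)\<^sup>2 \<ge> \<alpha> * (l i)\<^sup>2"
      using P2[OF i] \<alpha>ul(3)[OF i] zero_le_power2[of "\<alpha> * u i * l i"] by linarith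
    then have "a i * (- \<beta> * (q i)\<^sup>2 - (P i)\<^sup>2 + 2 * \<alpha> * (l i)\<^sup>2) \<ge> a i * (\<alpha> * (l i)\<^sup>2)"
      using ai by (intro mult_left_mono) auto
    moreover have "(if l i < l m then 2 * (a i - a m) / (l m - l i) * (l m * P i)\<^sup>2 else 0) / \<Lambda> \<ge> 0"
      using a(2)[OF i] \<Lambda> by auto
    moreover have "\<alpha> / (2 * real n) * (a m * \<Lambda>\<^sup>2) \<ge> 0" using \<alpha> a(1) by simp
    ultimately show ?thesis by linarith
  next
    case True
    have ai: "a i > 0" using a(1) a(2)[OF i] by linarith
    have "\<beta> * (q i)\<^sup>2 = (P i + 2 * (\<alpha> * u i * l i))\<^sup>2 / \<beta>"
    proof -
      have "P i + 2 * (\<alpha> * u i * l i) = - (\<beta> * q i)" using E1[OF i] by (simp add: mult.assoc)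
      then show ?thesis using \<beta>1 by (simp add: power2_eq_square)
    qed
    \<comment> \<open>Young's inequality with weights 1 + \<delta> / 2 and 1 + 2 / \<delta>. Taking
      weight 1 + \<delta> / 2 rather than 1 spends half of the margin in the exponent, so that the
      factor of P_i^2 stays below 2.\<close>
    also have "\<dots> \<le> ((1 + \<delta> / 2) * (P i)\<^sup>2 + (1 + 2 / \<delta>) * (2 * (\<alpha> * u i * l i))\<^sup>2) / \<beta>"
    proof (intro divide_right_mono)
      let ?y = "2 * (\<alpha> * u i * l i)"
      have "(1 + \<delta> / 2) * (P i)\<^sup>2 + (1 + 2 / \<delta>) * ?y\<^sup>2 - (P i + ?y)\<^sup>2 = (\<delta> * P i - 2 * ?y)\<^sup>2 / (2 * \<delta>)"
        using \<delta> by (simp add: power2_eq_square field_simps)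
      also have "\<dots> \<ge> 0" using \<delta> by simp
      finally show "(P i + ?y)\<^sup>2 \<le> (1 + \<delta> / 2) * (P i)\<^sup>2 + (1 + 2 / \<delta>) * ?y\<^sup>2" by linarith
    qed (use \<beta>1 in auto)
    also have "\<dots> \<le> (1 + \<delta> / 2) / \<beta> * (P i)\<^sup>2 + (1 + 2 / \<delta>) * (2 * (\<alpha> * u i * l i))\<^sup>2"
    proof -
      let ?B = "(1 + 2 / \<delta>) * (2 * (\<alpha> * u i * l i))\<^sup>2"
      have "?B \<ge> 0" using \<delta> by simp
      then have "?B / \<beta> \<le> ?B" using \<beta>1 by (simp only: divide_le_eq mult_le_cancel_left1) auto
      then show ?thesis
        unfolding add_divide_distrib[of _ ?B] by (simp only: times_divide_eq_left add_left_mono)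
    qed
    also have "(1 + 2 / \<delta>) * (2 * (\<alpha> * u i * l i))\<^sup>2 = 8 * (1 + 2 / \<delta>) * (\<alpha> * u i * l i)\<^sup>2 / 2"
      by (simp only: power_mult_distrib) simp
    also have "\<dots> \<le> \<alpha> * (l i)\<^sup>2"
    proof -
      have half: "x / 2 \<le> y" if "x \<le> y" "0 \<le> y" for x y :: real using that by simp
      show ?thesis by (rule half[OF \<alpha>ul(2)[OF i]]) (use \<alpha> in simp)
    qed
    finally have "\<beta> * (q i)\<^sup>2 + (P i)\<^sup>2 \<le> (1 + (1 + \<delta> / 2) / \<beta>) * (P i)\<^sup>2 + \<alpha> * (l i)\<^sup>2"
      by (simp add: distrib_right)
    also have "\<dots> \<le> c * (P i)\<^sup>2 + \<alpha> * (l i)\<^sup>2"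
      using c\<beta> by (intro add_mono mult_right_mono) auto
    finally have X: "a i * (- \<beta> * (q i)\<^sup>2 - (P i)\<^sup>2 + 2 * \<alpha> * (l i)\<^sup>2) \<ge> a i * (\<alpha> * (l i)\<^sup>2 - c * (P i)\<^sup>2)"
      using ai by (intro mult_left_mono) auto
    have "(a i - a m) * (P i)\<^sup>2 * c \<le> (a i - a m) * (P i)\<^sup>2 * (2 * \<Lambda> / (\<Lambda> - l i))"
    proof (intro mult_left_mono)
      have "\<Lambda> - l i \<le> (1 + \<epsilon>) * \<Lambda>" using True by (simp add: algebra_simps)
      then show "c \<le> 2 * \<Lambda> / (\<Lambda> - l i)"
        using True \<epsilon>0 \<Lambda> by (simp add: c_def field_simps)
    qed (use a(2)[OF i] in auto)
    also have "\<dots> = (if l i < l m then 2 * (a i - a m) / (l m - l i) * (l m * P i)\<^sup>2 else 0) / \<Lambda>"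
      using True \<Lambda> by (simp add: \<Lambda>_def power2_eq_square field_simps)
    finally have Y: "(a i - a m) * (P i)\<^sup>2 * c \<le> \<dots>" .
    \<comment> \<open>The good terms carry a_i - a_m instead of a_i, which leaves a remainder a_m c
      P_i^2. Since |l_i| \<le> \<Lambda> in this case, it fits into the allowed loss.\<close>
    have "\<bar>l i\<bar> \<le> \<Lambda>"
    proof -
      have "\<epsilon> * \<Lambda> \<le> \<Lambda>" using \<epsilon>0 \<Lambda> by (simp add: mult_left_le_one_le)
      then show ?thesis using True by (auto simp: abs_le_iff)
    qed
    then have l2: "(l i)\<^sup>2 \<le> \<Lambda>\<^sup>2" using power_mono[of "\<bar>l i\<bar>" \<Lambda> 2] by simp
    have "4 * real n * (P i)\<^sup>2 \<le> 4 * real n * (2 * \<beta>\<^sup>2 * (q i)\<^sup>2 + 8 * (\<alpha> * u i * l i)\<^sup>2)"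
      using P2[OF i] by (intro mult_left_mono) auto
    also have "\<dots> = (16 * real n * \<beta>\<^sup>2 * (q i)\<^sup>2 + 64 * real n * (\<alpha> * u i * l i)\<^sup>2) / 2"
      by (simp add: algebra_simps)
    also have "\<dots> \<le> (\<alpha> * \<Lambda>\<^sup>2 + \<alpha> * \<Lambda>\<^sup>2) / 2"
    proof (intro divide_right_mono add_mono n\<beta>q[OF i])
      have "\<alpha> * (l i)\<^sup>2 \<le> \<alpha> * \<Lambda>\<^sup>2" using l2 \<alpha>(1) by (intro mult_left_mono) auto
      with \<alpha>ul(1)[OF i] show "64 * real n * (\<alpha> * u i * l i)\<^sup>2 \<le> \<alpha> * \<Lambda>\<^sup>2" by (rule order_trans)
    qed simp
    finally have "(P i)\<^sup>2 \<le> \<alpha> * \<Lambda>\<^sup>2 / (4 * real n)" using n1 by (simp add: field_simps)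
    then have "c * (P i)\<^sup>2 \<le> 2 * (\<alpha> * \<Lambda>\<^sup>2 / (4 * real n))"
      using c by (intro mult_mono) auto
    then have "a m * (c * (P i)\<^sup>2) \<le> a m * (2 * (\<alpha> * \<Lambda>\<^sup>2 / (4 * real n)))"
      using a(1) by (intro mult_left_mono) auto
    then have Z: "a m * c * (P i)\<^sup>2 \<le> \<alpha> / (2 * real n) * (a m * \<Lambda>\<^sup>2)" by (simp add: mult_ac)
    have "a i * (\<alpha> * (l i)\<^sup>2 - c * (P i)\<^sup>2) = a i * (\<alpha> * (l i)\<^sup>2) - (a i - a m) * (P i)\<^sup>2 * c - a m * c * (P i)\<^sup>2"
      by (simp add: algebra_simps)
    then show ?thesis using X Y Z by linarith
  qed
  define E where "E i = (if l i < l m then 2 * (a i - a m) / (l m - l i) * (l m * P i)\<^sup>2 else 0)" for i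
  define Q where "Q i = a i * (- \<beta> * (q i)\<^sup>2 - (P i)\<^sup>2 + 2 * \<alpha> * (l i)\<^sup>2)" for i
  have "(\<Sum>i<n. a i * (\<alpha> * (l i)\<^sup>2) - \<alpha> / (2 * real n) * (a m * \<Lambda>\<^sup>2)) \<le> (\<Sum>i<n. Q i + E i / \<Lambda>)"
    unfolding Q_def E_def by (intro sum_mono) (use point in auto)
  moreover have "(\<Sum>i<n. a i * (\<alpha> * (l i)\<^sup>2)) \<ge> a m * (\<alpha> * \<Lambda>\<^sup>2)"
  proof -
    have "0 \<le> a i" if "i < n" for i using a(1) a(2)[OF that] by linarith
    then show ?thesis
      unfolding \<Lambda>_def using m \<alpha>
      by (intro member_le_sum[of m "{..<n}" "\<lambda>i. a i * (\<alpha> * (l i)\<^sup>2)"]) auto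
  qed
  moreover have "(\<Sum>i<n. \<alpha> / (2 * real n) * (a m * \<Lambda>\<^sup>2)) = \<alpha> / 2 * (a m * \<Lambda>\<^sup>2)"
    using n1 by simp
  moreover have "a m * (\<alpha> * \<Lambda>\<^sup>2) = 2 * (\<alpha> / 2 * (a m * \<Lambda>\<^sup>2))" by simp
  ultimately have 1: "\<alpha> / 2 * (a m * \<Lambda>\<^sup>2) \<le> (\<Sum>i<n. Q i) + (\<Sum>i<n. E i) / \<Lambda>"
    unfolding sum_subtractf sum.distrib sum_divide_distrib by linarith
  have "(\<Sum>i<n. a i * (\<beta> * (r i - (q i)\<^sup>2) + R i / l m - (P i)\<^sup>2 + 2 * \<alpha> * ((l i)\<^sup>2 + s i)))
    = (\<Sum>i<n. \<beta> * (a i * r i) + (a i * R i) / \<Lambda> + 2 * \<alpha> * (a i * s i) + Q i)"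
    by (intro sum.cong refl) (simp add: Q_def \<Lambda>_def algebra_simps)
  also have "\<dots> = \<beta> * (\<Sum>i<n. a i * r i) + (\<Sum>i<n. a i * R i) / \<Lambda> + 2 * \<alpha> * (\<Sum>i<n. a i * s i) + (\<Sum>i<n. Q i)"
    by (simp only: sum.distrib sum_distrib_left sum_divide_distrib)
  finally have 2: "\<beta> * (\<Sum>i<n. a i * r i) + (\<Sum>i<n. a i * R i) / \<Lambda> + 2 * \<alpha> * (\<Sum>i<n. a i * s i) + (\<Sum>i<n. Q i) \<le> 0"
    using E2 by simp
  have 3: "\<beta> * (\<Sum>i<n. a i * r i) \<ge> \<beta> * (- N / \<phi>)"
    using E5 \<beta>1 by (intro mult_left_mono) auto
  have 4: "(\<Sum>i<n. a i * R i) / \<Lambda> \<ge> - B / \<Lambda> + (\<Sum>i<n. E i) / \<Lambda>"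
    using divide_right_mono[OF E4, of \<Lambda>] \<Lambda> unfolding E_def add_divide_distrib by simp
  have 5: "2 * \<alpha> * (\<Sum>i<n. a i * s i) \<ge> 2 * \<alpha> * (- D)"
    using E3 \<alpha> by (intro mult_left_mono) auto
  have "\<alpha> / 2 * \<kappa> * \<Lambda> \<le> \<alpha> / 2 * (a m * \<Lambda>) * \<Lambda>"
    using \<kappa> \<alpha> \<Lambda> by (intro mult_right_mono mult_left_mono) (auto simp: \<Lambda>_def)
  also have "\<dots> = \<alpha> / 2 * (a m * \<Lambda>\<^sup>2)" by (simp add: power2_eq_square)
  finally have 6: "\<alpha> / 2 * \<kappa> * \<Lambda> \<le> \<alpha> / 2 * (a m * \<Lambda>\<^sup>2)" .
  have "\<beta> * (- N / \<phi>) = - (\<beta> * N / \<phi>)" "- B / \<Lambda> = - (B / \<Lambda>)" "2 * \<alpha> * (- D) = - (2 * \<alpha> * D)"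
    by simp_all
  with 1 2 3 4 5 6 show ?thesis unfolding \<Lambda>_def[symmetric] by linarith
qed

text \<open>These are sin(\<sigma> t) / \<sigma> and (cos(\<sigma> t) - 1) / \<sigma>^2, continued
  by t and -t^2 / 2 at \<sigma> = 0; the last identity is sin^2 + cos^2 = 1. The scaling makes the
  frame formulas free of division by \<sigma>.\<close>

lemma rotation_coefficients_exist:
  fixes \<sigma> :: real
  shows "\<exists>S C. has_deriv2 S 1 0 \<and> S 0 = 0 \<and> has_deriv2 C 0 (-1) \<and> C 0 = 0 \<and>
    (\<forall>t. (S t)\<^sup>2 + 2 * C t + \<sigma>\<^sup>2 * (C t)\<^sup>2 = 0)"
proof (cases "\<sigma> = 0")
  case True
  have "has_deriv2 (\<lambda>t. t) 1 0"
    by (rule has_deriv2_explicit[where g' = "\<lambda>t. 1"]) (auto intro!: derivative_eq_intros)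
  moreover have "has_deriv2 (\<lambda>t. - t\<^sup>2 / 2) 0 (-1)"
    by (rule has_deriv2_explicit[where g' = "\<lambda>t. - t"]) (auto intro!: derivative_eq_intros)
  ultimately show ?thesis using True by (intro exI[of _ "\<lambda>t. t"] exI[of _ "\<lambda>t. - t\<^sup>2 / 2"]) auto
next
  case False
  have "has_deriv2 (\<lambda>t. sin (\<sigma> * t) / \<sigma>) 1 0"
    by (rule has_deriv2_explicit[where g' = "\<lambda>t. cos (\<sigma> * t)"])
      (use False in \<open>auto intro!: derivative_eq_intros\<close>)
  moreover have "has_deriv2 (\<lambda>t. (cos (\<sigma> * t) - 1) / \<sigma>\<^sup>2) 0 (-1)"
    by (rule has_deriv2_explicit[where g' = "\<lambda>t. - sin (\<sigma> * t) / \<sigma>"])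
      (use False in \<open>auto intro!: derivative_eq_intros simp: power2_eq_square\<close>)
  moreover have "(sin (\<sigma> * t) / \<sigma>)\<^sup>2 + 2 * ((cos (\<sigma> * t) - 1) / \<sigma>\<^sup>2) + \<sigma>\<^sup>2 * ((cos (\<sigma> * t) - 1) / \<sigma>\<^sup>2)\<^sup>2 = 0" for t
  proof -
    have "\<sigma>\<^sup>2 * ((cos (\<sigma> * t) - 1) / \<sigma>\<^sup>2)\<^sup>2 = (cos (\<sigma> * t) - 1)\<^sup>2 / \<sigma>\<^sup>2"
      using False by (simp add: power2_eq_square)
    then have "(sin (\<sigma> * t) / \<sigma>)\<^sup>2 + 2 * ((cos (\<sigma> * t) - 1) / \<sigma>\<^sup>2) + \<sigma>\<^sup>2 * ((cos (\<sigma> * t) - 1) / \<sigma>\<^sup>2)\<^sup>2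
      = ((sin (\<sigma> * t))\<^sup>2 + 2 * (cos (\<sigma> * t) - 1) + (cos (\<sigma> * t) - 1)\<^sup>2) / \<sigma>\<^sup>2"
      by (simp add: power_divide add_divide_distrib)
    also have "(sin (\<sigma> * t))\<^sup>2 + 2 * (cos (\<sigma> * t) - 1) + (cos (\<sigma> * t) - 1)\<^sup>2
      = ((sin (\<sigma> * t))\<^sup>2 + (cos (\<sigma> * t))\<^sup>2) - 1"
      by (simp add: power2_diff)
    finally show ?thesis by (simp only: sin_cos_squared_add) simp
  qed
  ultimately show ?thesis
    by (intro exI[of _ "\<lambda>t. sin (\<sigma> * t) / \<sigma>"] exI[of _ "\<lambda>t. (cos (\<sigma> * t) - 1) / \<sigma>\<^sup>2"]) auto
qed

text \<open>For nonzero z this is the frame turned in the plane of e_m and z, where \<sigma> = |z|: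
  e_m goes to cos e_m + sin z / \<sigma>, and the other members change only through their component
  along z. \<open>s m = 0\<close> makes z orthogonal to e_m, and the form also covers z = 0.\<close>

lemma rotated_orthonormal_frame:
  fixes e :: "nat \<Rightarrow> 'a::euclidean_space"
  assumes e: "orthonormal_frame e" and m: "m < DIM('a)" and sm: "s m = 0"
    and z: "z = (\<Sum>i<DIM('a). s i *\<^sub>R e i)"
    and SC: "S\<^sup>2 + 2 * C + (\<Sum>i<DIM('a). (s i)\<^sup>2) * C\<^sup>2 = 0"
  shows "orthonormal_frame (\<lambda>i. if i = m then e m + ((\<Sum>i<DIM('a). (s i)\<^sup>2) * C) *\<^sub>R e m + S *\<^sub>R z
    else e i + s i *\<^sub>R (C *\<^sub>R z - S *\<^sub>R e m))"
proof -
  let ?n = "DIM('a)"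
  define \<sigma>2 where "\<sigma>2 = (\<Sum>i<?n. (s i)\<^sup>2)"
  have ze: "z \<bullet> e j = s j" if "j < ?n" for j
  proof -
    have "z \<bullet> e j = (\<Sum>i<?n. if i = j then s i else 0)"
      unfolding z inner_sum_left
      by (intro sum.cong refl) (use e that in \<open>auto simp: orthonormal_frame_def\<close>)
    then show ?thesis using that by simp
  qed
  have zz: "z \<bullet> z = \<sigma>2"
    using orthonormal_frame_inner[OF e, of z z] by (simp add: ze \<sigma>2_def power2_eq_square)
  have ee: "e i \<bullet> e j = (if i = j then 1 else 0)" if "i < ?n" "j < ?n" for i j
    using e that by (simp add: orthonormal_frame_def)
  note [simp] = ze[OF m] sm zz ze ee m
  have ez: "e j \<bullet> z = s j" if "j < ?n" for j using ze[OF that] by (simp add: inner_commute)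
  note [simp] = ez
  have mm: "(e m + (\<sigma>2 * C) *\<^sub>R e m + S *\<^sub>R z) \<bullet> (e m + (\<sigma>2 * C) *\<^sub>R e m + S *\<^sub>R z) = 1"
  proof -
    have "(e m + (\<sigma>2 * C) *\<^sub>R e m + S *\<^sub>R z) \<bullet> (e m + (\<sigma>2 * C) *\<^sub>R e m + S *\<^sub>R z)
      = 1 + \<sigma>2 * (S\<^sup>2 + 2 * C + \<sigma>2 * C\<^sup>2)"
      by (simp add: inner_add_left inner_add_right algebra_simps power2_eq_square)
    then show ?thesis using SC by (simp add: \<sigma>2_def)
  qed
  have mi: "(e m + (\<sigma>2 * C) *\<^sub>R e m + S *\<^sub>R z) \<bullet> (e i + s i *\<^sub>R (C *\<^sub>R z - S *\<^sub>R e m)) = 0"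
    if "i < ?n" "i \<noteq> m" for i
    using that by (simp add: inner_add_left inner_add_right inner_diff_left inner_diff_right algebra_simps)
  have ij: "(e i + s i *\<^sub>R (C *\<^sub>R z - S *\<^sub>R e m)) \<bullet> (e j + s j *\<^sub>R (C *\<^sub>R z - S *\<^sub>R e m))
    = (if i = j then 1 else 0)" if "i < ?n" "i \<noteq> m" "j < ?n" "j \<noteq> m" for i j
  proof -
    have "(e i + s i *\<^sub>R (C *\<^sub>R z - S *\<^sub>R e m)) \<bullet> (e j + s j *\<^sub>R (C *\<^sub>R z - S *\<^sub>R e m))
      = (if i = j then 1 else 0) + s i * s j * (S\<^sup>2 + 2 * C + \<sigma>2 * C\<^sup>2)"
      using that
      by (simp add: inner_add_left inner_add_right inner_diff_left inner_diff_right algebra_simps power2_eq_square)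
    then show ?thesis using SC by (simp add: \<sigma>2_def)
  qed
  define y where "y = e m + (\<sigma>2 * C) *\<^sub>R e m + S *\<^sub>R z"
  define x where "x i = e i + s i *\<^sub>R (C *\<^sub>R z - S *\<^sub>R e m)" for i
  have "orthonormal_frame (\<lambda>i. if i = m then y else x i)"
    unfolding orthonormal_frame_def
    using mm mi ij by (simp add: inner_commute[of "x _" y] flip: x_def y_def)
  then show ?thesis unfolding x_def y_def \<sigma>2_def .
qed

section \<open>Second-order comparison along rotating frames\<close>

lemma hessian_form_expand:
  fixes u :: "real^'n \<Rightarrow> real"
  assumes S: "open S" and u: "Ck_on 2 S u" and x: "x \<in> S"
  defines "B \<equiv> \<lambda>a b. partial_deriv a (partial_deriv b u) x"
  shows "B (a + b) c = B a c + B b c" "B c (a + b) = B c a + B c b"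
    "B (r *\<^sub>R a) b = r * B a b" "B a (r *\<^sub>R b) = r * B a b"
    "B (a - b) c = B a c - B b c" "B c (a - b) = B c a - B c b"
    "finite I \<Longrightarrow> B (\<Sum>i\<in>I. s i *\<^sub>R v i) c = (\<Sum>i\<in>I. s i * B (v i) c)"
  unfolding B_def hessian_bilinear[OF S u x, symmetric]
  by (simp_all add: inner_add_left inner_add_right inner_diff_left inner_diff_right
      matrix_vector_right_distrib matrix_vector_mult_diff_distrib
      linear_cmul[OF matrix_vector_mul_linear] inner_sum_right)

text \<open>Along x0 + t e_m, with the frame turning as t varies, the tangent inequality minus the
  lower bound for \<open>\<psi>\<close> is nonnegative and vanishes at t = 0. Its second derivative
  is therefore nonnegative; the rotation is responsible for the squares of third
  derivatives.\<close>

lemma rotated_frame_second_order_bound: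
  fixes u :: "real^'n \<Rightarrow> real" and e :: "nat \<Rightarrow> real^'n"
  assumes S: "open S" and u: "Ck_on 4 S u" and x0: "x0 \<in> S"
    and e: "orthonormal_frame e" and m: "m < CARD('n)"
    and diag: "\<And>i j. i < CARD('n) \<Longrightarrow> j < CARD('n) \<Longrightarrow>
      partial_deriv (e i) (partial_deriv (e j) u) x0 = (if i = j then l i else 0)"
    and tangent: "\<And>x v. x \<in> S \<Longrightarrow> orthonormal_frame v \<Longrightarrow>
      \<psi> x \<le> \<psi> x0 + (\<Sum>i<CARD('n). a i * (partial_deriv (v i) (partial_deriv (v i) u) x - l i))"
    and lower: "\<forall>\<^sub>F t in nhds 0. \<psi> (x0 + t *\<^sub>R e m) \<ge> \<psi> x0 + t * d - L * t\<^sup>2"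
  defines "T \<equiv> \<lambda>i. partial_deriv (e i) (partial_deriv (e m) (partial_deriv (e m) u)) x0"
  shows "(\<Sum>i<CARD('n). a i * partial_deriv (e i) (partial_deriv (e i) (partial_deriv (e m) (partial_deriv (e m) u))) x0)
    \<ge> - (2 * L) + (\<Sum>i<CARD('n). if l i < l m then 2 * (a i - a m) / (l m - l i) * (T i)\<^sup>2 else 0)"
proof -
  let ?n = "CARD('n)" and ?D = "partial_deriv :: real^'n \<Rightarrow> _"
  have Ck: "Ck_on 2 S u" "Ck_on 3 S u" by (auto intro: Ck_on_mono[OF u])
  have Ck': "Ck_on 3 S (?D v u)" "Ck_on 2 S (?D v (?D w u))" for v w
  proof -
    show *: "Ck_on 3 S (?D v u)" for v
      using u by (intro Ck_on_partial_deriv[OF S, of 3 u]) (simp add: numeral_eq_Suc del: Ck_on.simps)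
    show "Ck_on 2 S (?D v (?D w u))"
      using *[of w] by (intro Ck_on_partial_deriv[OF S, of 2 "?D w u"]) (simp add: numeral_eq_Suc del: Ck_on.simps)
  qed
  \<comment> \<open>The speed of rotation towards e_i. It maximises 4 s T_i - 2 s^2 (l_m - l_i), and
    it is the rate at which first-order perturbation theory turns a simple eigenvector e_m along
    this line. Where l_i is not below l_m, no turn towards e_i is made.\<close>
  define s where "s i = (if l i < l m then T i / (l m - l i) else 0)" for i
  have sm: "s m = 0" by (simp add: s_def)
  define z where "z = (\<Sum>i<?n. s i *\<^sub>R e i)"
  define \<sigma>2 where "\<sigma>2 = (\<Sum>i<?n. (s i)\<^sup>2)"
  have \<sigma>2: "(sqrt \<sigma>2)\<^sup>2 = \<sigma>2" by (simp add: \<sigma>2_def sum_nonneg)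
  obtain Sn Cs where S': "has_deriv2 Sn 1 0" "Sn 0 = 0" and C': "has_deriv2 Cs 0 (-1)" "Cs 0 = 0"
    and SC: "\<And>t. (Sn t)\<^sup>2 + 2 * Cs t + \<sigma>2 * (Cs t)\<^sup>2 = 0"
    using rotation_coefficients_exist[of "sqrt \<sigma>2"] \<sigma>2 by auto
  define v where "v t i = (if i = m then e m + (\<sigma>2 * Cs t) *\<^sub>R e m + Sn t *\<^sub>R z
    else e i + s i *\<^sub>R (Cs t *\<^sub>R z - Sn t *\<^sub>R e m))" for t i
  have dim: "DIM(real^'n) = ?n" by simp
  have v: "orthonormal_frame (v t)" for t
    unfolding v_def[abs_def] \<sigma>2_def
    by (rule rotated_orthonormal_frame[OF e, of m s z "Sn t" "Cs t", unfolded dim])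
      (use m sm SC[of t] in \<open>simp_all add: z_def \<sigma>2_def\<close>)
  define B where "B p q t = ?D p (?D q u) (x0 + t *\<^sub>R e m)" for p q t
  define B1 where "B1 p q = ?D (e m) (?D p (?D q u)) x0" for p q
  define B2 where "B2 p q = ?D (e m) (?D (e m) (?D p (?D q u))) x0" for p q
  have B: "has_deriv2 (B p q) (B1 p q) (B2 p q)" for p q
    using has_deriv2_line[OF S Ck'(2) x0] by (simp add: B_def[abs_def] B1_def B2_def)
  have B_sym: "B p q t = B q p t" if "x0 + t *\<^sub>R e m \<in> S" for p q t
    unfolding B_def by (rule partial_deriv_commute[OF S Ck(1) that])
  note B_exp = hessian_form_expand[OF S Ck(1)]
  have B0: "B (e i) z 0 = s i * l i" "B z (e i) 0 = s i * l i" if "i < ?n" for i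
  proof -
    have "B z (e i) 0 = (\<Sum>j<?n. s j * B (e j) (e i) 0)"
      unfolding B_def z_def by (simp add: B_exp(7)[OF x0])
    also have "\<dots> = (\<Sum>j<?n. if j = i then s i * l i else 0)"
      by (intro sum.cong refl) (use diag that in \<open>auto simp: B_def\<close>)
    finally show "B z (e i) 0 = s i * l i" using that by simp
    then show "B (e i) z 0 = s i * l i" using B_sym[of 0] x0 by simp
  qed
  have Bzz: "B z z 0 = (\<Sum>i<?n. (s i)\<^sup>2 * l i)"
  proof -
    have "B z z 0 = (\<Sum>j<?n. s j * B (e j) z 0)"
      unfolding B_def z_def by (simp add: B_exp(7)[OF x0])
    then show ?thesis by (simp add: B0 power2_eq_square mult.assoc)
  qed
  have Bmm: "B (e m) (e m) 0 = l m" using diag m by (simp add: B_def)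
  have B1m: "B1 (e i) (e m) = T i" for i
  proof -
    have "B1 (e i) (e m) = ?D (e m) (?D (e i) (?D (e m) u)) x0" by (simp add: B1_def)
    also have "\<dots> = ?D (e i) (?D (e m) (?D (e m) u)) x0"
      by (rule partial_deriv_commute[OF S _ x0]) (rule Ck_on_mono[OF Ck'(1)], simp)
    finally show ?thesis by (simp add: T_def)
  qed
  have B1z: "B1 z (e m) = (\<Sum>i<?n. s i * T i)"
  proof -
    have "has_deriv2 (\<lambda>t. \<Sum>i<?n. s i * B (e i) (e m) t) (\<Sum>i<?n. s i * B1 (e i) (e m)) (\<Sum>i<?n. s i * B2 (e i) (e m))"
      by (intro has_deriv2_sum has_deriv2_cmult B) simp
    moreover have "\<forall>\<^sub>F t in nhds 0. B z (e m) t = (\<Sum>i<?n. s i * B (e i) (e m) t)"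
      using eventually_line_in_open[OF S x0, of "e m"]
      by eventually_elim (simp add: B_def z_def B_exp(7))
    ultimately have "(B z (e m) has_real_derivative (\<Sum>i<?n. s i * B1 (e i) (e m))) (at 0)"
      using has_deriv2_imp_DERIV DERIV_cong_ev[of 0 0 "B z (e m)" "\<lambda>t. \<Sum>i<?n. s i * B (e i) (e m) t"]
      by blast
    moreover have "(B z (e m) has_real_derivative B1 z (e m)) (at 0)"
      by (rule has_deriv2_imp_DERIV[OF B])
    ultimately have "B1 z (e m) = (\<Sum>i<?n. s i * B1 (e i) (e m))" by (intro DERIV_unique)
    then show ?thesis by (simp add: B1m)
  qed
  \<comment> \<open>\<open>Sn\<close> vanishes to first and \<open>Cs\<close> to second order at 0.
    Hence only low derivatives of B survive, and of the products with two such factors only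
    \<open>Sn\<close> times \<open>Sn\<close> contributes.\<close>
  have dC: "has_deriv2 (\<lambda>t. Cs t * B p q t) 0 (- B p q 0)" for p q
    using has_deriv2_mult[OF C'(1) B[of p q]] C'(2) by simp
  have dS: "has_deriv2 (\<lambda>t. Sn t * B p q t) (B p q 0) (2 * B1 p q)" for p q
    using has_deriv2_mult[OF S'(1) B[of p q]] S'(2) by simp
  have dCC: "has_deriv2 (\<lambda>t. Cs t * (Cs t * B p q t)) 0 0" for p q
    using has_deriv2_mult[OF C'(1) dC[of p q]] C'(2) by simp
  have dCS: "has_deriv2 (\<lambda>t. Cs t * (Sn t * B p q t)) 0 0" for p q
    using has_deriv2_mult[OF C'(1) dS[of p q]] C'(2) S'(2) by simp
  have dSS: "has_deriv2 (\<lambda>t. Sn t * (Sn t * B p q t)) 0 (2 * B p q 0)" for p q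
    using has_deriv2_mult[OF S'(1) dS[of p q]] S'(2) by simp
  \<comment> \<open>The diagonal entry of D^2 u in the turned frame, expanded into products of the
    kinds just treated; the square of 1 + \<sigma>2 * Cs is rewritten as 1 - \<sigma>2 * Sn^2 by
    \<open>SC\<close>.\<close>
  define E where "E t i = (if i = m then
      B (e m) (e m) t - \<sigma>2 * (Sn t * (Sn t * B (e m) (e m) t)) + 2 * (Sn t * B z (e m) t)
        + 2 * \<sigma>2 * (Cs t * (Sn t * B z (e m) t)) + Sn t * (Sn t * B z z t)
    else B (e i) (e i) t + 2 * s i * (Cs t * B (e i) z t) - 2 * s i * (Sn t * B (e i) (e m) t)
      + (s i)\<^sup>2 * (Cs t * (Cs t * B z z t)) - 2 * (s i)\<^sup>2 * (Cs t * (Sn t * B z (e m) t))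
      + (s i)\<^sup>2 * (Sn t * (Sn t * B (e m) (e m) t)))" for t i
  have E: "?D (v t i) (?D (v t i) u) (x0 + t *\<^sub>R e m) = E t i" if "x0 + t *\<^sub>R e m \<in> S" for t i
  proof (cases "i = m")
    case True
    have "?D (v t m) (?D (v t m) u) (x0 + t *\<^sub>R e m)
      = (1 + \<sigma>2 * Cs t)\<^sup>2 * B (e m) (e m) t + (1 + \<sigma>2 * Cs t) * Sn t * (B (e m) z t + B z (e m) t)
        + (Sn t)\<^sup>2 * B z z t"
      unfolding v_def B_def by (simp add: B_exp[OF that] algebra_simps power2_eq_square)
    also have "(1 + \<sigma>2 * Cs t)\<^sup>2 = 1 - \<sigma>2 * (Sn t)\<^sup>2"
    proof -
      have "(1 + \<sigma>2 * Cs t)\<^sup>2 = 1 - \<sigma>2 * (Sn t)\<^sup>2 + \<sigma>2 * ((Sn t)\<^sup>2 + 2 * Cs t + \<sigma>2 * (Cs t)\<^sup>2)"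
        by (simp add: power2_eq_square algebra_simps)
      then show ?thesis using SC by simp
    qed
    also have "B (e m) z t = B z (e m) t" by (rule B_sym[OF that])
    finally show ?thesis
      unfolding True E_def by (simp add: algebra_simps power2_eq_square)
  next
    case False
    have "?D (v t i) (?D (v t i) u) (x0 + t *\<^sub>R e m)
      = B (e i) (e i) t + s i * (Cs t * (B (e i) z t + B z (e i) t) - Sn t * (B (e i) (e m) t + B (e m) (e i) t))
        + (s i)\<^sup>2 * ((Cs t)\<^sup>2 * B z z t - Cs t * Sn t * (B z (e m) t + B (e m) z t) + (Sn t)\<^sup>2 * B (e m) (e m) t)"
      using False unfolding v_def B_def by (simp add: B_exp[OF that] algebra_simps power2_eq_square)
    also have "B z (e i) t = B (e i) z t" by (rule B_sym[OF that])
    also have "B (e m) (e i) t = B (e i) (e m) t" by (rule B_sym[OF that])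
    also have "B (e m) z t = B z (e m) t" by (rule B_sym[OF that])
    finally show ?thesis
      using False unfolding E_def by (simp add: algebra_simps power2_eq_square)
  qed
  \<comment> \<open>The zeros are kept as the rules for \<open>has_deriv2\<close> produce them, so
    that the definitions match syntactically.\<close>
  define E1 where "E1 i = (if i = m then B1 (e m) (e m) - \<sigma>2 * 0 + 2 * B z (e m) 0 + 2 * \<sigma>2 * 0 + 0
    else B1 (e i) (e i) + 2 * s i * 0 - 2 * s i * B (e i) (e m) 0 + (s i)\<^sup>2 * 0 - 2 * (s i)\<^sup>2 * 0 + (s i)\<^sup>2 * 0)" for i
  define E2 where "E2 i = (if i = m then
      B2 (e m) (e m) - \<sigma>2 * (2 * B (e m) (e m) 0) + 2 * (2 * B1 z (e m)) + 2 * \<sigma>2 * 0 + 2 * B z z 0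
    else B2 (e i) (e i) + 2 * s i * (- B (e i) z 0) - 2 * s i * (2 * B1 (e i) (e m))
      + (s i)\<^sup>2 * 0 - 2 * (s i)\<^sup>2 * 0 + (s i)\<^sup>2 * (2 * B (e m) (e m) 0))" for i
  have dE: "has_deriv2 (\<lambda>t. E t i) (E1 i) (E2 i)" for i
  proof (cases "i = m")
    case True
    show ?thesis
      unfolding E_def E1_def E2_def if_P[OF True]
      by (intro has_deriv2_add has_deriv2_diff has_deriv2_cmult dC dS dCC dCS dSS B)
  next
    case False
    show ?thesis
      unfolding E_def E1_def E2_def if_not_P[OF False]
      by (intro has_deriv2_add has_deriv2_diff has_deriv2_cmult dC dS dCC dCS dSS B)
  qed
  define h where "h t = (\<Sum>i<?n. a i * (E t i - l i)) - (t * d - L * t\<^sup>2)" for t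
  have "has_deriv2 (\<lambda>t. t * d - L * t\<^sup>2) d (- (2 * L))"
    by (rule has_deriv2_explicit[where g' = "\<lambda>t. d - 2 * L * t"]) (auto intro!: derivative_eq_intros)
  then have dh: "has_deriv2 h ((\<Sum>i<?n. a i * (E1 i - 0)) - d) ((\<Sum>i<?n. a i * (E2 i - 0)) - - (2 * L))"
    unfolding h_def[abs_def]
    by (intro has_deriv2_diff has_deriv2_sum has_deriv2_cmult dE has_deriv2_const) simp_all
  have E0: "E 0 i = l i" if "i < ?n" for i
    using diag[OF that that] m Bmm by (simp add: E_def S'(2) C'(2) B_def)
  have "h 0 = 0" by (simp add: h_def E0)
  moreover have "\<forall>\<^sub>F t in nhds 0. 0 \<le> h t"
    using eventually_line_in_open[OF S x0, of "e m"] lower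
  proof eventually_elim
    case (elim t)
    from tangent[OF elim(1) v[of t]] elim show ?case
      by (simp add: E h_def)
  qed
  ultimately have "0 \<le> (\<Sum>i<?n. a i * (E2 i - 0)) - - (2 * L)"
    using has_deriv2_local_min(2)[OF dh] by simp
  moreover have "(\<Sum>i<?n. a i * E2 i) = (\<Sum>i<?n. a i * B2 (e i) (e i))
    - (\<Sum>i<?n. if l i < l m then 2 * (a i - a m) / (l m - l i) * (T i)\<^sup>2 else 0)"
  proof -
    \<comment> \<open>A rotation preserves the trace: each entry i other than m loses W i, and entry
      m gains the sum of all these. Weighted by a, the effect is minus the sum of (a_i - a_m) W_i,
      and the choice of s gives W_i = 2 T_i^2 / (l_m - l_i) when l_i < l_m.\<close>
    define W where "W i = 4 * s i * T i - 2 * (s i)\<^sup>2 * (l m - l i)" for i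
    have Wm: "W m = 0" by (simp add: W_def sm)
    have *: "E2 i = B2 (e i) (e i) - W i + (if i = m then (\<Sum>j<?n. W j) else 0)" if "i < ?n" for i
    proof (cases "i = m")
      case True
      have "(\<Sum>j<?n. W j) = 4 * (\<Sum>j<?n. s j * T j) - 2 * (\<sigma>2 * l m) + 2 * (\<Sum>j<?n. (s j)\<^sup>2 * l j)"
        unfolding \<sigma>2_def sum_distrib_left sum_distrib_right sum_subtractf[symmetric] sum.distrib[symmetric] W_def
        by (intro sum.cong refl) (simp add: algebra_simps)
      then show ?thesis
        using True by (simp add: E2_def Wm Bmm B1z Bzz)
    next
      case False
      then show ?thesis
        by (simp add: E2_def W_def B0[OF that] B1m Bmm algebra_simps power2_eq_square)
    qed
    have "(\<Sum>i<?n. a i * E2 i) = (\<Sum>i<?n. a i * B2 (e i) (e i) - a i * W i + (if i = m then a m * (\<Sum>j<?n. W j) else 0))"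
      by (intro sum.cong refl) (simp add: * distrib_left right_diff_distrib)
    also have "\<dots> = (\<Sum>i<?n. a i * B2 (e i) (e i)) - (\<Sum>i<?n. a i * W i) + a m * (\<Sum>j<?n. W j)"
      using m by (simp add: sum.distrib sum_subtractf)
    also have "\<dots> = (\<Sum>i<?n. a i * B2 (e i) (e i)) - (\<Sum>i<?n. (a i - a m) * W i)"
      by (simp add: sum_distrib_left sum_subtractf left_diff_distrib)
    also have "(\<Sum>i<?n. (a i - a m) * W i) = (\<Sum>i<?n. if l i < l m then 2 * (a i - a m) / (l m - l i) * (T i)\<^sup>2 else 0)"
    proof (intro sum.cong refl)
      fix i
      show "(a i - a m) * W i = (if l i < l m then 2 * (a i - a m) / (l m - l i) * (T i)\<^sup>2 else 0)"
      proof (cases "l i < l m")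
        case True
        define g where "g = l m - l i"
        have g: "g \<noteq> 0" using True by (simp add: g_def)
        have "W i = 2 * (T i)\<^sup>2 / g"
          using True g by (simp add: W_def s_def power2_eq_square flip: g_def)
        then show ?thesis using True by (simp add: g_def)
      qed (simp add: W_def s_def)
    qed
    finally show ?thesis .
  qed
  moreover have "B2 (e i) (e i) = ?D (e i) (?D (e i) (?D (e m) (?D (e m) u))) x0" for i
    unfolding B2_def by (rule partial_deriv_commute4[OF S u x0])
  ultimately show ?thesis by simp
qed

text \<open>In a fixed eigenframe the two sides of the tangent inequality touch at x0, so their
  derivatives along v agree. This is the equation differentiated once, with no eigenvalue being
  differentiated.\<close>

lemma tangent_first_order:
  fixes u :: "real^'n \<Rightarrow> real" and e :: "nat \<Rightarrow> real^'n"
  assumes S: "open S" and u: "Ck_on 4 S u" and x0: "x0 \<in> S"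
    and e: "orthonormal_frame e"
    and diag: "\<And>i. i < CARD('n) \<Longrightarrow> partial_deriv (e i) (partial_deriv (e i) u) x0 = l i"
    and tangent: "\<And>x v. x \<in> S \<Longrightarrow> orthonormal_frame v \<Longrightarrow>
      \<psi> x \<le> \<psi> x0 + (\<Sum>i<CARD('n). a i * (partial_deriv (v i) (partial_deriv (v i) u) x - l i))"
    and \<psi>': "((\<lambda>t. \<psi> (x0 + t *\<^sub>R v)) has_real_derivative d) (at 0)"
  shows "(\<Sum>i<CARD('n). a i * partial_deriv (e i) (partial_deriv (e i) (partial_deriv v u)) x0) = d"
proof -
  let ?n = "CARD('n)" and ?D = "partial_deriv :: real^'n \<Rightarrow> _"
  have Ck': "Ck_on 2 S (?D v (?D w u))" for v w
  proof -
    have "Ck_on 3 S (?D w u)"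
      using u by (intro Ck_on_partial_deriv[OF S, of 3 u]) (simp add: numeral_eq_Suc del: Ck_on.simps)
    then show ?thesis by (intro Ck_on_partial_deriv[OF S, of 2 "?D w u"]) (simp add: numeral_eq_Suc del: Ck_on.simps)
  qed
  define h where "h t = (\<Sum>i<?n. a i * (?D (e i) (?D (e i) u) (x0 + t *\<^sub>R v) - l i)) - \<psi> (x0 + t *\<^sub>R v)" for t
  have "((\<lambda>t. ?D (e i) (?D (e i) u) (x0 + t *\<^sub>R v)) has_real_derivative ?D v (?D (e i) (?D (e i) u)) x0) (at 0)" for i
    by (rule has_deriv2_imp_DERIV[OF has_deriv2_line[OF S Ck' x0]])
  then have "(h has_real_derivative (\<Sum>i<?n. a i * (?D v (?D (e i) (?D (e i) u)) x0 - 0)) - d) (at 0)"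
    unfolding h_def[abs_def]
    by (intro DERIV_diff DERIV_sum DERIV_cmult \<psi>' DERIV_const)
  moreover have "\<forall>\<^sub>F t in nhds 0. h 0 \<le> h t"
    using eventually_line_in_open[OF S x0, of v]
  proof eventually_elim
    case (elim t)
    from tangent[OF elim e] show ?case by (simp add: h_def diag)
  qed
  then obtain \<epsilon> where "\<epsilon> > 0" "\<forall>t. \<bar>0 - t\<bar> < \<epsilon> \<longrightarrow> h 0 \<le> h t"
    by (auto simp: eventually_nhds_metric dist_real_def)
  ultimately have "(\<Sum>i<?n. a i * (?D v (?D (e i) (?D (e i) u)) x0 - 0)) - d = 0"
    by (rule DERIV_local_min)
  moreover have "?D v (?D (e i) (?D (e i) u)) x0 = ?D (e i) (?D (e i) (?D v u)) x0" for i
    by (rule partial_deriv_commute3[OF S _ x0]) (rule Ck_on_mono[OF u], simp)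
  ultimately show ?thesis by simp
qed

text \<open>As f is only of class C^{1,1}, a quadratic lower bound replaces the second derivative
  of ln f(x, u x).\<close>
lemma ln_composite_line_expansion:
  fixes u :: "'a::euclidean_space \<Rightarrow> real" and f :: "'a \<times> real \<Rightarrow> real"
  assumes S: "open S" and u: "Ck_on 2 S u" and x0: "x0 \<in> S" and v: "norm v = 1"
    and fd: "\<And>y. y \<in> S \<times> UNIV \<Longrightarrow> f differentiable at y"
    and f0: "f0 > 0" "\<And>y. y \<in> S \<times> UNIV \<Longrightarrow> f y \<ge> f0"
    and M: "M \<ge> 0" "\<And>y. y \<in> S \<times> UNIV \<Longrightarrow> norm (grad f y) \<le> M"
      "\<And>y z. y \<in> S \<times> UNIV \<Longrightarrow> z \<in> S \<times> UNIV \<Longrightarrow> norm (grad f y - grad f z) \<le> M * norm (y - z)"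
    and K: "K \<ge> 0" "\<And>x. x \<in> S \<Longrightarrow> norm (grad u x) \<le> K"
  defines "d \<equiv> (grad f (x0, u x0) \<bullet> (v, partial_deriv v u x0)) / f (x0, u x0)"
    and "\<psi> \<equiv> \<lambda>x. ln (f (x, u x))"
  shows "((\<lambda>t. \<psi> (x0 + t *\<^sub>R v)) has_real_derivative d) (at 0)" (is ?A)
    and "\<bar>d\<bar> \<le> M * (1 + K) / f0" (is ?B)
    and "\<forall>\<^sub>F t in nhds 0. \<psi> (x0 + t *\<^sub>R v) \<ge> \<psi> x0 + t * d -
      ((M * (1 + K)\<^sup>2 + M * (\<bar>partial_deriv v (partial_deriv v u) x0\<bar> + 1)) / f0 + (M * (1 + K))\<^sup>2 / f0\<^sup>2) * t\<^sup>2" (is ?C)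
proof -
  define y where "y t = (x0 + t *\<^sub>R v, u (x0 + t *\<^sub>R v))" for t
  define b where "b t = partial_deriv v u (x0 + t *\<^sub>R v)" for t
  define \<rho> where "\<rho> t = grad f (y t) \<bullet> (v, b t)" for t
  \<comment> \<open>The 1 is slack for continuity: close to x0 the second derivative along v differs
    by less than 1 from its value at x0.\<close>
  define \<Lambda> where "\<Lambda> = \<bar>partial_deriv v (partial_deriv v u) x0\<bar> + 1"
  have u1: "u differentiable at x" if "x \<in> S" for x
    using u that by (simp add: numeral_2_eq_2)
  have u2: "partial_deriv v u differentiable at x" if "x \<in> S" for x
    using Ck_on_partial_deriv[OF S, of 1 u v] u that by (simp add: numeral_2_eq_2)
  have yS: "y t \<in> S \<times> UNIV \<longleftrightarrow> x0 + t *\<^sub>R v \<in> S" for t by (simp add: y_def)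
  have du: "((\<lambda>t. u (x0 + t *\<^sub>R v)) has_real_derivative b t) (at t)" if "x0 + t *\<^sub>R v \<in> S" for t
    unfolding b_def by (rule has_real_derivative_line[OF u1[OF that]])
  have df: "((\<lambda>t. f (y t)) has_real_derivative \<rho> t) (at t)" if "x0 + t *\<^sub>R v \<in> S" for t
  proof -
    have "(y has_derivative (\<lambda>h. (h *\<^sub>R v, h * b t))) (at t)"
      unfolding y_def[abs_def]
      using du[OF that] by (auto intro!: derivative_eq_intros simp: has_field_derivative_def mult.commute)
    from has_derivative_compose[OF this has_derivative_grad[OF fd[of "y t"]]] that
    have "((\<lambda>t. f (y t)) has_derivative (\<lambda>h. grad f (y t) \<bullet> (h *\<^sub>R v, h * b t))) (at t)"
      by (simp add: yS)
    moreover have "(\<lambda>h. grad f (y t) \<bullet> (h *\<^sub>R v, h * b t)) = (*) (\<rho> t)"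
    proof
      fix h
      have "(h *\<^sub>R v, h * b t) = h *\<^sub>R (v, b t)" by simp
      then show "grad f (y t) \<bullet> (h *\<^sub>R v, h * b t) = \<rho> t * h"
        by (simp add: \<rho>_def del: scaleR_Pair)
    qed
    ultimately show ?thesis by (simp add: has_field_derivative_def)
  qed
  have fpos: "f (y t) > 0" "f (y t) \<ge> f0" if "x0 + t *\<^sub>R v \<in> S" for t
    using f0(2)[of "y t"] f0(1) that by (auto simp: yS)
  have d\<psi>: "((\<lambda>t. \<psi> (x0 + t *\<^sub>R v)) has_real_derivative \<rho> t / f (y t)) (at t)" if "x0 + t *\<^sub>R v \<in> S" for t
    using DERIV_chain2[OF DERIV_ln_divide[OF fpos(1)[OF that]] df[OF that]]
    by (simp add: \<psi>_def y_def[symmetric])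
  have d0: "d = \<rho> 0 / f (y 0)" by (simp add: d_def \<rho>_def y_def b_def)
  show ?A using d\<psi>[of 0] x0 d0 by simp
  have b: "\<bar>b t\<bar> \<le> K" if "x0 + t *\<^sub>R v \<in> S" for t
  proof -
    have "\<bar>b t\<bar> \<le> norm (grad u (x0 + t *\<^sub>R v)) * norm v"
      unfolding b_def partial_deriv_grad[OF u1[OF that]] by (rule Cauchy_Schwarz_ineq2)
    then show ?thesis using K(2)[OF that] v by simp
  qed
  have nv: "norm (v, b t) \<le> 1 + K" if "x0 + t *\<^sub>R v \<in> S" for t
    using norm_Pair_le[of v "b t"] b[OF that] v by simp
  have \<rho>: "\<bar>\<rho> t\<bar> \<le> M * (1 + K)" if "x0 + t *\<^sub>R v \<in> S" for t
  proof -
    have "\<bar>\<rho> t\<bar> \<le> norm (grad f (y t)) * norm (v, b t)"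
      unfolding \<rho>_def by (rule Cauchy_Schwarz_ineq2)
    also have "\<dots> \<le> M * (1 + K)"
      using M(1) M(2)[of "y t"] nv[OF that] that by (intro mult_mono) (auto simp: yS)
    finally show ?thesis .
  qed
  show ?B
  proof -
    have "\<bar>d\<bar> = \<bar>\<rho> 0\<bar> / f (y 0)" using fpos(1)[of 0] x0 by (simp add: d0 abs_div)
    also have "\<dots> \<le> M * (1 + K) / f0"
      using \<rho>[of 0] fpos[of 0] x0 f0(1) by (intro frac_le) auto
    finally show ?thesis .
  qed
  have "isCont (\<lambda>t. partial_deriv v (partial_deriv v u) (x0 + t *\<^sub>R v)) 0"
  proof -
    have "Ck_on 0 S (partial_deriv v (partial_deriv v u))"
      using u by (intro Ck_on_partial_deriv S) (simp_all add: numeral_2_eq_2 del: Ck_on.simps)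
    then have "isCont (partial_deriv v (partial_deriv v u)) (x0 + 0 *\<^sub>R v)"
      using S x0 by (simp add: continuous_on_eq_continuous_at)
    then show ?thesis
      by (rule isCont_o2[where f = "\<lambda>t. x0 + t *\<^sub>R v", rotated]) (intro continuous_intros)
  qed
  then have "\<forall>\<^sub>F t in nhds 0. dist (partial_deriv v (partial_deriv v u) (x0 + t *\<^sub>R v)) (partial_deriv v (partial_deriv v u) x0) < 1"
    using tendstoD[of "\<lambda>t. partial_deriv v (partial_deriv v u) (x0 + t *\<^sub>R v)" "partial_deriv v (partial_deriv v u) x0" "nhds 0" 1]
    by (simp add: isCont_def tendsto_nhds_iff)
  then have "\<forall>\<^sub>F t in nhds 0. x0 + t *\<^sub>R v \<in> S \<and> \<bar>partial_deriv v (partial_deriv v u) (x0 + t *\<^sub>R v)\<bar> \<le> \<Lambda>"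
    using eventually_line_in_open[OF S x0, of v]
    by eventually_elim (auto simp: \<Lambda>_def dist_real_def)
  then obtain \<epsilon> where \<epsilon>: "\<epsilon> > 0" "\<And>t. \<bar>t\<bar> < \<epsilon> \<Longrightarrow> x0 + t *\<^sub>R v \<in> S"
    "\<And>t. \<bar>t\<bar> < \<epsilon> \<Longrightarrow> \<bar>partial_deriv v (partial_deriv v u) (x0 + t *\<^sub>R v)\<bar> \<le> \<Lambda>"
    by (auto simp: eventually_nhds_metric dist_real_def)
  \<comment> \<open>A mean value bound on [-|t|, |t|], applied to u, to its derivative, to f along
    the curve, and finally to \<open>\<psi>\<close> minus its linear part.\<close>
  have lip: "\<bar>g t - g 0\<bar> \<le> c * \<bar>t\<bar>"
    if t: "\<bar>t\<bar> < \<epsilon>" and g: "\<And>s. \<bar>s\<bar> \<le> \<bar>t\<bar> \<Longrightarrow> (g has_real_derivative g' s) (at s)"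
      "\<And>s. \<bar>s\<bar> \<le> \<bar>t\<bar> \<Longrightarrow> \<bar>g' s\<bar> \<le> c" for g g' t c
  proof -
    have "norm (g t - g 0) \<le> c * norm (t - 0)"
      by (rule field_differentiable_bound[where S = "{-\<bar>t\<bar>..\<bar>t\<bar>}" and f' = g'])
        (use g in \<open>auto intro: has_field_derivative_at_within\<close>)
    then show ?thesis by simp
  qed
  define L where "L = (M * (1 + K)\<^sup>2 + M * \<Lambda>) / f0 + (M * (1 + K))\<^sup>2 / f0\<^sup>2"
  have d\<rho>: "\<bar>\<rho> t / f (y t) - d\<bar> \<le> L * \<bar>t\<bar>" if t: "\<bar>t\<bar> < \<epsilon>" for t
  proof -
    have tS: "x0 + s *\<^sub>R v \<in> S" if "\<bar>s\<bar> \<le> \<bar>t\<bar>" for s using \<epsilon>(2)[of s] that t by simp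
    have u_lip: "\<bar>u (x0 + t *\<^sub>R v) - u x0\<bar> \<le> K * \<bar>t\<bar>"
      using lip[OF t, of "\<lambda>t. u (x0 + t *\<^sub>R v)" b K] du b tS by simp
    have b_lip: "\<bar>b t - b 0\<bar> \<le> \<Lambda> * \<bar>t\<bar>"
      using \<epsilon>(3) t tS
      by (intro lip[OF t, of b "\<lambda>s. partial_deriv v (partial_deriv v u) (x0 + s *\<^sub>R v)"])
        (auto simp: b_def[abs_def] intro!: has_real_derivative_line u2)
    have f_lip: "\<bar>f (y t) - f (y 0)\<bar> \<le> M * (1 + K) * \<bar>t\<bar>"
      using lip[OF t, of "\<lambda>t. f (y t)" \<rho> "M * (1 + K)"] df \<rho> tS by simp
    have "norm (y t - y 0) \<le> (1 + K) * \<bar>t\<bar>"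
    proof -
      have "y t - y 0 = (t *\<^sub>R v, u (x0 + t *\<^sub>R v) - u x0)" by (simp add: y_def)
      then have "norm (y t - y 0) \<le> \<bar>t\<bar> + \<bar>u (x0 + t *\<^sub>R v) - u x0\<bar>"
        using norm_Pair_le[of "t *\<^sub>R v" "u (x0 + t *\<^sub>R v) - u x0"] v by simp
      then show ?thesis using u_lip by (simp add: algebra_simps)
    qed
    then have "norm (grad f (y t) - grad f (y 0)) \<le> M * ((1 + K) * \<bar>t\<bar>)"
      using M(3)[of "y t" "y 0"] M(1) tS[of t] x0 mult_left_mono[of _ _ M]
      by (force simp: yS)
    then have "\<bar>(grad f (y t) - grad f (y 0)) \<bullet> (v, b t)\<bar> \<le> M * ((1 + K) * \<bar>t\<bar>) * (1 + K)"
      using nv[OF tS[of t]] M(1) K(1)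
      by (intro order_trans[OF Cauchy_Schwarz_ineq2] mult_mono) auto
    moreover have "\<bar>grad f (y 0) \<bullet> (0, b t - b 0)\<bar> \<le> M * (\<Lambda> * \<bar>t\<bar>)"
      using M(2)[of "y 0"] x0 b_lip M(1)
      by (intro order_trans[OF Cauchy_Schwarz_ineq2] mult_mono) (auto simp: yS)
    moreover have "\<rho> t - \<rho> 0 = (grad f (y t) - grad f (y 0)) \<bullet> (v, b t) + grad f (y 0) \<bullet> (0, b t - b 0)"
    proof -
      have "(0, b t - b 0) = (v, b t) - (v, b 0)" by simp
      then show ?thesis by (simp add: \<rho>_def inner_diff_left inner_diff_right del: diff_Pair)
    qed
    ultimately have "\<bar>\<rho> t - \<rho> 0\<bar> \<le> M * ((1 + K) * \<bar>t\<bar>) * (1 + K) + M * (\<Lambda> * \<bar>t\<bar>)"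
      by linarith
    also have "\<dots> = (M * (1 + K)\<^sup>2 + M * \<Lambda>) * \<bar>t\<bar>"
      by (simp add: algebra_simps power2_eq_square)
    finally have \<rho>_lip: "\<bar>\<rho> t - \<rho> 0\<bar> \<le> (M * (1 + K)\<^sup>2 + M * \<Lambda>) * \<bar>t\<bar>" .
    have ft: "f (y t) > 0" "f (y 0) > 0" "f (y t) \<ge> f0" "f (y 0) \<ge> f0"
      using fpos[of t] fpos[of 0] tS[of t] x0 by auto
    have "\<rho> t / f (y t) - d = (\<rho> t - \<rho> 0) / f (y t) + \<rho> 0 * (f (y 0) - f (y t)) / (f (y t) * f (y 0))"
      using ft by (simp add: d0 field_simps)
    also have "\<bar>\<dots>\<bar> \<le> \<bar>\<rho> t - \<rho> 0\<bar> / f (y t) + \<bar>\<rho> 0\<bar> * \<bar>f (y t) - f (y 0)\<bar> / (f (y t) * f (y 0))"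
      using ft by (intro order_trans[OF abs_triangle_ineq]) (simp add: abs_mult abs_div abs_minus_commute)
    also have "\<dots> \<le> (M * (1 + K)\<^sup>2 + M * \<Lambda>) * \<bar>t\<bar> / f0 + M * (1 + K) * (M * (1 + K) * \<bar>t\<bar>) / (f0 * f0)"
      using \<rho>_lip \<rho>[of 0] f_lip ft f0(1) x0 M(1) K(1)
      by (intro add_mono frac_le mult_mono) auto
    also have "\<dots> = L * \<bar>t\<bar>" by (simp add: L_def power2_eq_square add_divide_distrib distrib_right)
    finally show ?thesis .
  qed
  have "\<psi> (x0 + t *\<^sub>R v) \<ge> \<psi> x0 + t * d - L * t\<^sup>2" if t: "\<bar>t\<bar> < \<epsilon>" for t
  proof -
    \<comment> \<open>The derivative of \<open>\<psi>\<close> minus its linear part is at most L |t|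
      in size on the interval, so a single mean value bound yields the quadratic error.\<close>
    have "\<bar>(\<psi> (x0 + t *\<^sub>R v) - t * d) - (\<psi> (x0 + 0 *\<^sub>R v) - 0 * d)\<bar> \<le> L * \<bar>t\<bar> * \<bar>t\<bar>"
    proof (rule lip[OF t, where g = "\<lambda>t. \<psi> (x0 + t *\<^sub>R v) - t * d" and g' = "\<lambda>s. \<rho> s / f (y s) - d"])
      fix s assume s: "\<bar>s\<bar> \<le> \<bar>t\<bar>"
      show "((\<lambda>t. \<psi> (x0 + t *\<^sub>R v) - t * d) has_real_derivative \<rho> s / f (y s) - d) (at s)"
        using d\<psi>[of s] \<epsilon>(2)[of s] s t by (auto intro!: derivative_eq_intros)
      have "L \<ge> 0" using M(1) K(1) f0(1) by (simp add: L_def \<Lambda>_def)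
      then show "\<bar>\<rho> s / f (y s) - d\<bar> \<le> L * \<bar>t\<bar>"
        using d\<rho>[of s] s t mult_left_mono[OF s, of L] by linarith
    qed
    moreover have "L * \<bar>t\<bar> * \<bar>t\<bar> = L * t\<^sup>2" by (simp add: power2_eq_square)
    ultimately show ?thesis by auto
  qed
  then show ?C
    using \<epsilon>(1) by (auto simp: eventually_nhds_metric dist_real_def L_def \<Lambda>_def)
qed

section \<open>The estimate at a maximum of the test function\<close>

text \<open>\<open>C11_closure\<close> provides the upper bounds that make the real suprema dominate
  their values. All three suprema are nonnegative, so each is at most the norm; for the last one
  this follows from a diagonal pair, with quotient 0.\<close>

lemma C11_norm_grad_bounds:
  fixes g :: "'a::euclidean_space \<Rightarrow> real"
  assumes g: "C11_closure S g"
  shows "x \<in> S \<Longrightarrow> norm (grad g x) \<le> C11_norm S g"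
    and "x \<in> S \<Longrightarrow> y \<in> S \<Longrightarrow> norm (grad g x - grad g y) \<le> C11_norm S g * norm (x - y)"
proof -
  obtain L where L: "L-lipschitz_on S (grad g)" using g by (auto simp: C11_closure_def)
  let ?q = "\<lambda>(x, y). dist (grad g x) (grad g y) / dist x y"
  have bdd: "bdd_above ((\<lambda>x. \<bar>g x\<bar>) ` S)" "bdd_above ((\<lambda>x. norm (grad g x)) ` S)"
    using g by (auto simp: C11_closure_def bounded_iff bdd_above_def)
  have bdq: "bdd_above (?q ` (S \<times> S))"
  proof (rule bdd_aboveI[of _ L])
    fix z assume "z \<in> ?q ` (S \<times> S)"
    then obtain x y where xy: "x \<in> S" "y \<in> S" "z = dist (grad g x) (grad g y) / dist x y" by auto
    then show "z \<le> L"
      using lipschitz_onD[OF L xy(1,2)] lipschitz_on_nonneg[OF L] by (cases "x = y") (auto simp: divide_le_eq)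
  qed
  have le: "(SUP x\<in>S. \<bar>g x\<bar>) \<ge> 0 \<and> norm (grad g x) \<le> (SUP x\<in>S. norm (grad g x)) \<and>
      (SUP z\<in>S \<times> S. ?q z) \<ge> 0" if "x \<in> S" for x
  proof (intro conjI)
    show "(SUP x\<in>S. \<bar>g x\<bar>) \<ge> 0" using cSUP_upper[OF that bdd(1)] by linarith
    show "norm (grad g x) \<le> (SUP x\<in>S. norm (grad g x))" by (rule cSUP_upper[OF that bdd(2)])
    have "?q (x, x) \<le> (SUP z\<in>S \<times> S. ?q z)" by (rule cSUP_upper[OF _ bdq]) (use that in auto)
    then show "(SUP z\<in>S \<times> S. ?q z) \<ge> 0" by simp
  qed
  show "x \<in> S \<Longrightarrow> norm (grad g x) \<le> C11_norm S g"
    using le[of x] by (simp add: C11_norm_def)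
  assume xy: "x \<in> S" "y \<in> S"
  have "?q (x, y) \<le> (SUP z\<in>S \<times> S. ?q z)" by (rule cSUP_upper[OF _ bdq]) (use xy in auto)
  also have "\<dots> \<le> C11_norm S g"
    using le[OF xy(1)] norm_ge_zero[of "grad g x"] unfolding C11_norm_def by linarith
  finally have "dist (grad g x) (grad g y) / dist x y \<le> C11_norm S g" by simp
  then show "norm (grad g x - grad g y) \<le> C11_norm S g * norm (x - y)"
    by (cases "x = y") (auto simp: dist_norm divide_le_eq)
qed

text \<open>Difference quotients of the gradient are at most L. The bound is used only
  qualitatively, to keep the maximum of the test function away from the boundary.\<close>

lemma grad_lipschitz_second_deriv_le:
  assumes S: "open S" and u: "Ck_on 2 S u" and L: "L-lipschitz_on S (grad u)"
    and x: "x \<in> S" and v: "norm v = 1"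
  shows "partial_deriv v (partial_deriv v u) x \<le> L"
proof -
  let ?g = "\<lambda>t. partial_deriv v u (x + t *\<^sub>R v)"
  have u1: "u differentiable at y" if "y \<in> S" for y
    using u that by (simp add: numeral_2_eq_2)
  have d1: "partial_deriv v u differentiable at x"
    using Ck_on_partial_deriv[OF S, of 1 u v] u x by (simp add: numeral_2_eq_2)
  have "(?g has_real_derivative partial_deriv v (partial_deriv v u) x) (at 0)"
    using has_real_derivative_line[of "partial_deriv v u" x 0 v] d1 by simp
  then have lim: "((\<lambda>t. (?g t - ?g 0) / (t - 0)) \<longlongrightarrow> partial_deriv v (partial_deriv v u) x) (at 0)"
    by (simp only: has_field_derivative_iff)
  have "\<forall>\<^sub>F t in at 0. (?g t - ?g 0) / (t - 0) \<le> L"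
  proof -
    have "\<forall>\<^sub>F t in at 0. x + t *\<^sub>R v \<in> S"
      using eventually_line_in_open[OF S x, of v] by (auto simp: eventually_at_filter elim: eventually_mono)
    moreover have "\<forall>\<^sub>F t in at 0. t \<noteq> (0::real)" by (simp add: eventually_at_filter)
    ultimately show ?thesis
    proof eventually_elim
      case (elim t)
      have "\<bar>?g t - ?g 0\<bar> = \<bar>(grad u (x + t *\<^sub>R v) - grad u x) \<bullet> v\<bar>"
        using elim x by (simp add: partial_deriv_grad[OF u1] inner_diff_left)
      also have "\<dots> \<le> norm (grad u (x + t *\<^sub>R v) - grad u x) * norm v"
        by (rule Cauchy_Schwarz_ineq2)
      also have "\<dots> \<le> L * \<bar>t\<bar>"
        using lipschitz_onD[OF L elim(1) x] v by (simp add: dist_norm)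
      finally have "\<bar>(?g t - ?g 0) / (t - 0)\<bar> \<le> L"
        using elim by (simp add: abs_div divide_le_eq)
      then show ?case by linarith
    qed
  qed
  then show ?thesis
    by (rule tendsto_upperbound[OF lim]) simp
qed

lemma M_op_index_sets:
  fixes g :: "real^'n \<Rightarrow> real"
  shows "M_op p g x = (\<Prod>I\<in>index_sets p CARD('n). \<Sum>i\<in>I. eigenvalues (hessian g x) ! i)"
  by (simp add: M_op_def index_sets_def)

text \<open>The estimate must be uniform in the domain and the functions, so the quantitative data
  are the numbers f0, K and M. K \<ge> 1 is a normalisation that keeps K^2 away from 0 in the choice
  of \<alpha>.\<close>

locale touching_barrier =
  fixes p :: nat and \<Omega> :: "(real^'n) set" and u w :: "real^'n \<Rightarrow> real"
    and f :: "(real^'n) \<times> real \<Rightarrow> real" and f0 K M :: real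
  assumes p: "1 \<le> p" "p \<le> CARD('n)"
    and op: "open \<Omega>" and bdd: "bounded \<Omega>"
    and u4: "Ck_on 4 \<Omega> u" and pu: "p_plurisubharmonic p \<Omega> u" and pw: "p_plurisubharmonic p \<Omega> w"
    and eq: "\<And>x. x \<in> \<Omega> \<Longrightarrow> M_op p u x = f (x, u x)"
    and f0: "f0 > 0" "\<And>y. y \<in> \<Omega> \<times> UNIV \<Longrightarrow> f y \<ge> f0"
    and fd: "\<And>y. y \<in> \<Omega> \<times> UNIV \<Longrightarrow> f differentiable at y"
    and M: "M \<ge> 0" "\<And>y. y \<in> \<Omega> \<times> UNIV \<Longrightarrow> norm (grad f y) \<le> M"
      "\<And>y z. y \<in> \<Omega> \<times> UNIV \<Longrightarrow> z \<in> \<Omega> \<times> UNIV \<Longrightarrow> norm (grad f y - grad f z) \<le> M * norm (y - z)"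
    and K: "K \<ge> 1" "\<And>x. x \<in> \<Omega> \<Longrightarrow> norm (grad u x) + norm (grad w x) \<le> K"
    and cu: "continuous_on (closure \<Omega>) u" and cw: "continuous_on (closure \<Omega>) w"
    and wu: "\<And>x. x \<in> \<Omega> \<Longrightarrow> w x > u x" and bc: "\<And>x. x \<in> frontier \<Omega> \<Longrightarrow> w x = u x"
    and lip: "\<exists>L. L-lipschitz_on \<Omega> (grad u)"
begin

abbreviation "eig x i \<equiv> eigenvalues (hessian u x) ! i"

lemma Ck_u: "k \<le> 4 \<Longrightarrow> Ck_on k \<Omega> u"
  by (rule Ck_on_mono[OF u4])

lemma Ck_w: "Ck_on 2 \<Omega> w"
  using pw by (simp add: p_plurisubharmonic_def)

lemma grad_bounds: "x \<in> \<Omega> \<Longrightarrow> norm (grad u x) \<le> K"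
  using K(2)[of x] norm_ge_zero[of "grad w x"] by linarith

lemma partial_bounds:
  assumes x: "x \<in> \<Omega>" and v: "norm v = 1"
  shows "\<bar>partial_deriv v u x\<bar> \<le> K" "\<bar>partial_deriv v w x - partial_deriv v u x\<bar> \<le> K"
proof -
  have d: "u differentiable at x" "w differentiable at x"
    using Ck_u[of 2] Ck_w x by (auto simp: numeral_2_eq_2)
  have "\<bar>partial_deriv v u x\<bar> \<le> norm (grad u x)" "\<bar>partial_deriv v w x\<bar> \<le> norm (grad w x)"
    using Cauchy_Schwarz_ineq2[of "grad u x" v] Cauchy_Schwarz_ineq2[of "grad w x" v] v
    by (simp_all add: partial_deriv_grad[OF d(1)] partial_deriv_grad[OF d(2)])
  then show "\<bar>partial_deriv v u x\<bar> \<le> K" "\<bar>partial_deriv v w x - partial_deriv v u x\<bar> \<le> K"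
    using K(2)[OF x] grad_bounds[OF x] by auto
qed

lemma hessian_u_symmetric: "x \<in> \<Omega> \<Longrightarrow> Finite_Cartesian_Product.transpose (hessian u x) = hessian u x"
  by (rule hessian_symmetric[OF op Ck_u]) simp_all

lemma eig_mono: "x \<in> \<Omega> \<Longrightarrow> i \<le> j \<Longrightarrow> j < CARD('n) \<Longrightarrow> eig x i \<le> eig x j"
  by (rule eigenvalues_mono[OF hessian_u_symmetric])

text \<open>The product of the nonnegative p-fold sums equals f > 0, so no factor vanishes and
  logarithms may be taken.\<close>

lemma eig_sum_pos:
  assumes x: "x \<in> \<Omega>" and I: "I \<in> index_sets p CARD('n)"
  shows "(\<Sum>i\<in>I. eig x i) > 0"
proof -
  have "(\<Prod>I\<in>index_sets p CARD('n). \<Sum>i\<in>I. eig x i) = f (x, u x)"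
    using eq[OF x] by (simp add: M_op_index_sets)
  moreover have "f (x, u x) > 0" using f0(1) f0(2)[of "(x, u x)"] x by auto
  ultimately have "(\<Sum>i\<in>I. eig x i) \<noteq> 0" using I prod_zero[of "index_sets p CARD('n)" "\<lambda>I. \<Sum>i\<in>I. eig x i"] by auto
  moreover have "(\<Sum>i\<in>I. eig x i) \<ge> 0"
    using pu x I by (auto simp: p_plurisubharmonic_def index_sets_def)
  ultimately show ?thesis by simp
qed

lemma ln_f_eq:
  assumes x: "x \<in> \<Omega>"
  shows "ln (f (x, u x)) = (\<Sum>I\<in>index_sets p CARD('n). ln (\<Sum>i\<in>I. eig x i))"
  unfolding eq[OF x, symmetric] M_op_index_sets
  by (rule ln_prod) (simp_all add: eig_sum_pos[OF x, THEN less_imp_neq, THEN not_sym])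

lemma eigenframe:
  assumes x: "x \<in> \<Omega>"
  obtains e where "orthonormal_frame e"
    "\<And>i j. i < CARD('n) \<Longrightarrow> j < CARD('n) \<Longrightarrow>
      partial_deriv (e i) (partial_deriv (e j) u) x = (if i = j then eig x i else 0)"
proof -
  obtain e where e: "orthonormal_frame e"
    "\<And>i. i < CARD('n) \<Longrightarrow> hessian u x *v e i = eig x i *\<^sub>R e i"
    using symmetric_eigenframe(1)[OF hessian_u_symmetric[OF x]] by auto
  have "partial_deriv (e i) (partial_deriv (e j) u) x = (if i = j then eig x i else 0)"
    if "i < CARD('n)" "j < CARD('n)" for i j
    using that e by (simp add: hessian_bilinear[OF op Ck_u x, symmetric] orthonormal_frame_def)
  with e(1) show thesis by (rule that)
qed

lemma tangent:
  assumes x0: "x0 \<in> \<Omega>" and x: "x \<in> \<Omega>" and v: "orthonormal_frame v"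
  shows "ln (f (x, u x)) \<le> ln (f (x0, u x0)) + (\<Sum>i<CARD('n). log_weight p CARD('n) (eig x0) i *
      (partial_deriv (v i) (partial_deriv (v i) u) x - eig x0 i))"
  using log_product_tangent[OF hessian_u_symmetric[OF x] v, of "eig x0" p] eig_mono[OF x0] eig_sum_pos[OF x0] eig_sum_pos[OF x]
  by (simp add: ln_f_eq x x0 hessian_bilinear[OF op Ck_u x])

text \<open>The linearised operator at u is applied to w. Nonnegative p-fold sums of the eigenvalues
  of D^2 w give a nonnegative weighted sum, and the trace bound passes to the frame v, which in
  general does not diagonalise D^2 w.\<close>

lemma barrier_trace_nonneg:
  assumes x0: "x0 \<in> \<Omega>" and v: "orthonormal_frame v"
  shows "(\<Sum>i<CARD('n). log_weight p CARD('n) (eig x0) i * partial_deriv (v i) (partial_deriv (v i) w) x0) \<ge> 0"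
proof -
  let ?a = "log_weight p CARD('n) (eig x0)"
  have "0 \<le> (\<Sum>I\<in>index_sets p CARD('n). (\<Sum>i\<in>I. eigenvalues (hessian w x0) ! i) / (\<Sum>i\<in>I. eig x0 i))"
  proof (rule sum_nonneg, rule divide_nonneg_pos)
    fix I assume I: "I \<in> index_sets p CARD('n)"
    then show "0 \<le> (\<Sum>i\<in>I. eigenvalues (hessian w x0) ! i)"
      using pw x0 by (auto simp: p_plurisubharmonic_def index_sets_def)
    show "0 < (\<Sum>i\<in>I. eig x0 i)" by (rule eig_sum_pos[OF x0 I])
  qed
  also have "\<dots> = (\<Sum>i<CARD('n). ?a i * eigenvalues (hessian w x0) ! i)"
    by (simp add: log_weight_sum)
  also have "\<dots> \<le> (\<Sum>i<CARD('n). ?a i * ((hessian w x0 *v v i) \<bullet> v i))"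
  proof (rule weighted_trace_lower_bound[OF hessian_symmetric[OF op Ck_w x0] v])
    show "?a j \<le> ?a i" if "i \<le> j" "j < CARD('n)" for i j
      by (rule log_weight_antimono[OF eig_mono[OF x0] eig_sum_pos[OF x0] that])
    show "?a i \<ge> 0" for i
      unfolding log_weight_def by (intro sum_nonneg) (auto intro: less_imp_le eig_sum_pos[OF x0])
  qed
  finally show ?thesis by (simp add: hessian_bilinear[OF op Ck_w x0])
qed

text \<open>The quadratic error in the expansion of ln f(x, u x) along e_m, when u_mm = \<Lambda>.
  It is affine in \<Lambda>, hence bounded after division by \<Lambda> \<ge> 1.\<close>

definition psi_second_bound :: "real \<Rightarrow> real" where
  "psi_second_bound \<Lambda> = (M * (1 + K)\<^sup>2 + M * (\<Lambda> + 1)) / f0 + (M * (1 + K))\<^sup>2 / f0\<^sup>2"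

text \<open>With the direction frozen at e_m, \<open>max\<close> compares a function of class C^2
  near x0 with its own value at x0, written through the top eigenvalue. The logarithm is tested
  along each eigenvector, and \<open>large\<close> describes the regime in which D ln (w - u) is
  small against \<Lambda>.\<close>

lemma max_point_bound:
  fixes \<alpha> \<delta> :: real
  assumes x0: "x0 \<in> \<Omega>" and e: "orthonormal_frame e"
    and diag: "\<And>i j. i < CARD('n) \<Longrightarrow> j < CARD('n) \<Longrightarrow>
      partial_deriv (e i) (partial_deriv (e j) u) x0 = (if i = j then eig x0 i else 0)"
    and \<delta>: "\<delta> > 0" and \<alpha>: "\<alpha> > 0" "64 * real CARD('n) * K\<^sup>2 * (1 + 2 / \<delta>) * \<alpha> \<le> 1"
    and max: "\<And>x. x \<in> \<Omega> \<Longrightarrow>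
      (w x - u x) powr (1 + \<delta>) * partial_deriv (e (CARD('n) - 1)) (partial_deriv (e (CARD('n) - 1)) u) x * exp (\<alpha> * (norm (grad u x))\<^sup>2)
      \<le> (w x0 - u x0) powr (1 + \<delta>) * eig x0 (CARD('n) - 1) * exp (\<alpha> * (norm (grad u x0))\<^sup>2)"
    and large: "16 * real CARD('n) * (1 + \<delta>)\<^sup>2 * K\<^sup>2 \<le> \<alpha> * (\<delta> / (4 + 3 * \<delta>))\<^sup>2 * (w x0 - u x0)\<^sup>2 * (eig x0 (CARD('n) - 1))\<^sup>2"
  shows "\<alpha> / 2 * (1 / p) * eig x0 (CARD('n) - 1) \<le> (1 + \<delta>) * card (index_sets p CARD('n)) / (w x0 - u x0)
    + 2 * psi_second_bound (eig x0 (CARD('n) - 1)) / eig x0 (CARD('n) - 1) + 2 * \<alpha> * (CARD('n) * (K * (M * (1 + K) / f0)))"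
proof -
  let ?n = "CARD('n)" and ?D = "partial_deriv :: real^'n \<Rightarrow> _" and ?m = "CARD('n) - 1"
  let ?l = "eig x0" and ?a = "log_weight p CARD('n) (eig x0)"
  define \<phi> where "\<phi> = w x0 - u x0"
  define \<Lambda> where "\<Lambda> = ?l ?m"
  have m: "?m < ?n" by simp
  have \<phi>: "\<phi> > 0" using wu[OF x0] by (simp add: \<phi>_def)
  have K0: "K \<ge> 0" using K(1) by simp
  have \<Lambda>: "\<Lambda> > 0" and top: "?a ?m * \<Lambda> \<ge> 1 / p"
    unfolding \<Lambda>_def using log_weight_top[OF eig_mono[OF x0] eig_sum_pos[OF x0] p] by auto
  have am: "?a ?m > 0"
  proof -
    have "0 < 1 / real p" using p by simp
    then have "0 < ?a ?m * \<Lambda>" using top by linarith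
    then show ?thesis using \<Lambda> by (simp add: zero_less_mult_iff)
  qed
  have amin: "?a ?m \<le> ?a i" if "i < ?n" for i
    by (rule log_weight_antimono[OF eig_mono[OF x0] eig_sum_pos[OF x0]]) (use that in auto)
  have ne: "norm (e i) = 1" if "i < ?n" for i using orthonormal_frameD(2)[OF e] that by simp
  have Ck': "Ck_on 2 \<Omega> (?D v u)" "Ck_on 2 \<Omega> (?D v (?D v' u))" for v v'
  proof -
    have *: "Ck_on 3 \<Omega> (?D v u)" for v
      by (rule Ck_on_partial_deriv[OF op]) (use u4 in \<open>simp add: numeral_eq_Suc del: Ck_on.simps\<close>)
    show "Ck_on 2 \<Omega> (?D v u)" by (rule Ck_on_mono[OF *]) simp
    show "Ck_on 2 \<Omega> (?D v (?D v' u))"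
      by (rule Ck_on_partial_deriv[OF op]) (use *[of v'] in \<open>simp add: numeral_eq_Suc del: Ck_on.simps\<close>)
  qed
  have u1: "u differentiable at x" if "x \<in> \<Omega>" for x
    using Ck_u[of 1] that by simp
  define H where "H = ?D (e ?m) (?D (e ?m) u)"
  have H2: "Ck_on 2 \<Omega> H" unfolding H_def by (rule Ck')
  have H0: "H x0 = \<Lambda>" using diag[OF m m] by (simp add: H_def \<Lambda>_def)
  have grad_sum: "(norm (grad u x))\<^sup>2 = (\<Sum>j<?n. (?D (e j) u x)\<^sup>2)" if "x \<in> \<Omega>" for x
    using orthonormal_frame_inner[OF e, of "grad u x" "grad u x"]
    by (simp add: power2_norm_eq_inner partial_deriv_grad[OF u1[OF that]]) (simp add: power2_eq_square)
  define q where "q i = (?D (e i) w x0 - ?D (e i) u x0) / \<phi>" for i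
  define r where "r i = (?D (e i) (?D (e i) w) x0 - ?D (e i) (?D (e i) u) x0) / \<phi>" for i
  define P where "P i = ?D (e i) H x0 / \<Lambda>" for i
  define R where "R i = ?D (e i) (?D (e i) H) x0" for i
  define s where "s i = (\<Sum>j<?n. ?D (e j) u x0 * ?D (e i) (?D (e i) (?D (e j) u)) x0)" for i
  define U where "U i = ?D (e i) u x0" for i
  have deriv_test: "(1 + \<delta>) * q i + P i + 2 * \<alpha> * U i * ?l i = 0 \<and>
      (1 + \<delta>) * (r i - (q i)\<^sup>2) + R i / \<Lambda> - (P i)\<^sup>2 + 2 * \<alpha> * ((?l i)\<^sup>2 + s i) \<le> 0" if i: "i < ?n" for i
  proof -
    let ?x = "\<lambda>t. x0 + t *\<^sub>R e i"
    define g where "g t = (1 + \<delta>) * ln (w (?x t) - u (?x t)) + ln (H (?x t))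
      + \<alpha> * (\<Sum>j<?n. (?D (e j) u (?x t))\<^sup>2)" for t
    have d1: "has_deriv2 (\<lambda>t. ln (w (?x t) - u (?x t))) (q i) (r i - (q i)\<^sup>2)"
      using has_deriv2_ln[OF has_deriv2_diff[OF has_deriv2_line[OF op Ck_w x0, of "e i"]
            has_deriv2_line[OF op Ck_u[of 2] x0, of "e i"]]] \<phi>
      by (simp add: q_def r_def \<phi>_def)
    have d2: "has_deriv2 (\<lambda>t. ln (H (?x t))) (P i) (R i / \<Lambda> - (P i)\<^sup>2)"
      using has_deriv2_ln[OF has_deriv2_line[OF op H2 x0, of "e i"]] \<Lambda> H0
      by (simp add: P_def R_def)
    have d3: "has_deriv2 (\<lambda>t. \<Sum>j<?n. (?D (e j) u (?x t))\<^sup>2)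
        (\<Sum>j<?n. 2 * ?D (e j) u x0 * ?D (e i) (?D (e j) u) x0)
        (\<Sum>j<?n. 2 * (?D (e i) (?D (e j) u) x0)\<^sup>2 + 2 * ?D (e j) u x0 * ?D (e i) (?D (e i) (?D (e j) u)) x0)"
    proof (rule has_deriv2_sum)
      fix j
      show "has_deriv2 (\<lambda>t. (?D (e j) u (?x t))\<^sup>2) (2 * ?D (e j) u x0 * ?D (e i) (?D (e j) u) x0)
        (2 * (?D (e i) (?D (e j) u) x0)\<^sup>2 + 2 * ?D (e j) u x0 * ?D (e i) (?D (e i) (?D (e j) u)) x0)"
        using has_deriv2_power2[OF has_deriv2_line[OF op Ck'(1) x0, of "e j" "e i"]] by simp
    qed simp
    have s1: "(\<Sum>j<?n. 2 * ?D (e j) u x0 * ?D (e i) (?D (e j) u) x0) = 2 * U i * ?l i"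
    proof -
      have "(\<Sum>j<?n. 2 * ?D (e j) u x0 * ?D (e i) (?D (e j) u) x0) = (\<Sum>j<?n. if j = i then 2 * U i * ?l i else 0)"
        by (intro sum.cong refl) (use diag i in \<open>auto simp: U_def\<close>)
      then show ?thesis using i by simp
    qed
    have s2: "(\<Sum>j<?n. 2 * (?D (e i) (?D (e j) u) x0)\<^sup>2 + 2 * ?D (e j) u x0 * ?D (e i) (?D (e i) (?D (e j) u)) x0)
      = 2 * ((?l i)\<^sup>2 + s i)"
    proof -
      have "(\<Sum>j<?n. (?D (e i) (?D (e j) u) x0)\<^sup>2) = (\<Sum>j<?n. if j = i then (?l i)\<^sup>2 else 0)"
        by (intro sum.cong refl) (use diag i in auto)
      then have sq: "(\<Sum>j<?n. (?D (e i) (?D (e j) u) x0)\<^sup>2) = (?l i)\<^sup>2" using i by simp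
      show ?thesis
        unfolding sq[symmetric] s_def sum_distrib_left sum.distrib distrib_left by (simp only: mult.assoc)
    qed
    have g: "has_deriv2 g ((1 + \<delta>) * q i + P i + \<alpha> * (2 * U i * ?l i))
        ((1 + \<delta>) * (r i - (q i)\<^sup>2) + (R i / \<Lambda> - (P i)\<^sup>2) + \<alpha> * (2 * ((?l i)\<^sup>2 + s i)))"
      unfolding g_def[abs_def]
      by (intro has_deriv2_add has_deriv2_cmult d1 d2 d3[unfolded s1 s2])
    \<comment> \<open>H may be negative elsewhere in the domain; logarithms are taken only close to
      x0, where continuity keeps it positive.\<close>
    have "isCont (\<lambda>t. H (?x t)) 0"
      by (rule has_deriv2_imp_isCont[OF has_deriv2_line[OF op H2 x0]])
    then have "((\<lambda>t. H (?x t)) \<longlongrightarrow> \<Lambda>) (nhds 0)"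
      using H0 by (simp add: isCont_def tendsto_nhds_iff)
    then have "\<forall>\<^sub>F t in nhds 0. H (?x t) > 0" using \<Lambda> by (rule order_tendstoD)
    then have "\<forall>\<^sub>F t in nhds 0. g t \<le> g 0"
      using eventually_line_in_open[OF op x0, of "e i"]
    proof eventually_elim
      case (elim t)
      have ln_form: "ln ((w x - u x) powr (1 + \<delta>) * h * exp (\<alpha> * (norm (grad u x))\<^sup>2))
        = (1 + \<delta>) * ln (w x - u x) + ln h + \<alpha> * (\<Sum>j<?n. (?D (e j) u x)\<^sup>2)"
        if "x \<in> \<Omega>" "h > 0" for x h
        using wu[OF that(1)] that(2) by (simp add: ln_mult ln_powr grad_sum[OF that(1)])
      have "(w (?x t) - u (?x t)) powr (1 + \<delta>) * H (?x t) * exp (\<alpha> * (norm (grad u (?x t)))\<^sup>2)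
        \<le> (w x0 - u x0) powr (1 + \<delta>) * \<Lambda> * exp (\<alpha> * (norm (grad u x0))\<^sup>2)"
        using max[OF elim(2)] by (simp add: H_def \<Lambda>_def)
      moreover have "0 < (w (?x t) - u (?x t)) powr (1 + \<delta>) * H (?x t) * exp (\<alpha> * (norm (grad u (?x t)))\<^sup>2)"
        using wu[OF elim(2)] elim(1) by simp
      ultimately have "ln ((w (?x t) - u (?x t)) powr (1 + \<delta>) * H (?x t) * exp (\<alpha> * (norm (grad u (?x t)))\<^sup>2))
        \<le> ln ((w x0 - u x0) powr (1 + \<delta>) * \<Lambda> * exp (\<alpha> * (norm (grad u x0))\<^sup>2))"
        by (simp add: ln_mono)
      then show ?case
        unfolding ln_form[OF elim(2) elim(1)] ln_form[OF x0 \<Lambda>] by (simp add: g_def H0)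
    qed
    from has_deriv2_local_max[OF g this] show ?thesis by (simp add: mult_ac)
  qed
  define d where "d v = (grad f (x0, u x0) \<bullet> (v, ?D v u x0)) / f (x0, u x0)" for v
  have E3: "(\<Sum>i<?n. ?a i * s i) \<ge> - (?n * (K * (M * (1 + K) / f0)))"
  proof -
    \<comment> \<open>The contracted third derivatives of u are the first derivatives of ln f(x, u
      x), which are bounded by M (1 + K) / f0.\<close>
    have dd: "(\<Sum>i<?n. ?a i * ?D (e i) (?D (e i) (?D (e j) u)) x0) = d (e j)" if "j < ?n" for j
      unfolding d_def
      by (rule tangent_first_order[OF op u4 x0 e, where \<psi> = "\<lambda>x. ln (f (x, u x))" and l = ?l])
        (use diag tangent[OF x0] ln_composite_line_expansion(1)[OF op Ck_u[of 2] x0 ne[OF that] fd f0 M K0 grad_bounds] in auto)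
    have "(\<Sum>i<?n. ?a i * s i) = (\<Sum>j<?n. \<Sum>i<?n. ?D (e j) u x0 * (?a i * ?D (e i) (?D (e i) (?D (e j) u)) x0))"
      unfolding s_def sum_distrib_left by (subst sum.swap) (simp add: mult_ac)
    also have "\<dots> = (\<Sum>j<?n. ?D (e j) u x0 * d (e j))"
      by (intro sum.cong refl) (simp add: dd flip: sum_distrib_left)
    finally have eq: "(\<Sum>i<?n. ?a i * s i) = (\<Sum>j<?n. ?D (e j) u x0 * d (e j))" .
    have "\<bar>\<Sum>j<?n. ?D (e j) u x0 * d (e j)\<bar> \<le> (\<Sum>j<?n. K * (M * (1 + K) / f0))"
    proof (rule order_trans[OF sum_abs sum_mono])
      fix j assume "j \<in> {..<?n}"
      then have j: "j < ?n" by simp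
      have "\<bar>d (e j)\<bar> \<le> M * (1 + K) / f0"
        unfolding d_def by (rule ln_composite_line_expansion(2)[OF op Ck_u[of 2] x0 ne[OF j] fd f0 M K0 grad_bounds]) simp_all
      then show "\<bar>?D (e j) u x0 * d (e j)\<bar> \<le> K * (M * (1 + K) / f0)"
        unfolding abs_mult using partial_bounds(1)[OF x0 ne[OF j]] K0 by (intro mult_mono) auto
    qed
    then show ?thesis unfolding eq by simp
  qed
  have E4: "(\<Sum>i<?n. ?a i * R i) \<ge> - (2 * psi_second_bound \<Lambda>) +
      (\<Sum>i<?n. if ?l i < ?l ?m then 2 * (?a i - ?a ?m) / (?l ?m - ?l i) * (?l ?m * P i)\<^sup>2 else 0)"
  proof -
    have "\<forall>\<^sub>F t in nhds 0. ln (f (x0 + t *\<^sub>R e ?m, u (x0 + t *\<^sub>R e ?m)))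
      \<ge> ln (f (x0, u x0)) + t * d (e ?m) - psi_second_bound \<Lambda> * t\<^sup>2"
      using ln_composite_line_expansion(3)[OF op Ck_u[of 2] x0 ne[OF m] fd f0 M K0 grad_bounds] H0 \<Lambda>
      by (simp add: d_def psi_second_bound_def H_def)
    from rotated_frame_second_order_bound[OF op u4 x0 e m diag, where \<psi> = "\<lambda>x. ln (f (x, u x))", OF _ _ tangent[OF x0] this]
    have "(\<Sum>i<?n. ?a i * R i) \<ge> - (2 * psi_second_bound \<Lambda>) +
      (\<Sum>i<?n. if ?l i < ?l ?m then 2 * (?a i - ?a ?m) / (?l ?m - ?l i) * (?D (e i) H x0)\<^sup>2 else 0)"
      unfolding R_def H_def .
    moreover have "?D (e i) H x0 = ?l ?m * P i" for i
      using \<Lambda> unfolding P_def \<Lambda>_def by simp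
    ultimately show ?thesis by (simp only:)
  qed
  have E5: "(\<Sum>i<?n. ?a i * r i) \<ge> - real (card (index_sets p ?n)) / \<phi>"
  proof -
    \<comment> \<open>Euler's identity: the u part of the second derivatives of w - u costs exactly
      the number of index sets, while the w part has a favourable sign.\<close>
    have "(\<Sum>i<?n. ?a i * ?l i) = (\<Sum>I\<in>index_sets p ?n. 1)"
      unfolding log_weight_sum by (intro sum.cong refl) (metis eig_sum_pos[OF x0] divide_self less_irrefl)
    then have N: "(\<Sum>i<?n. ?a i * ?l i) = real (card (index_sets p ?n))" by simp
    have "(\<Sum>i<?n. ?a i * r i) = (\<Sum>i<?n. (?a i * ?D (e i) (?D (e i) w) x0 - ?a i * ?l i) / \<phi>)"
      by (intro sum.cong refl) (use diag in \<open>simp add: r_def right_diff_distrib\<close>)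
    also have "\<dots> = ((\<Sum>i<?n. ?a i * ?D (e i) (?D (e i) w) x0) - real (card (index_sets p ?n))) / \<phi>"
      by (simp only: sum_divide_distrib[symmetric] sum_subtractf N)
    also have "\<dots> \<ge> (0 - real (card (index_sets p ?n))) / \<phi>"
      using barrier_trace_nonneg[OF x0 e] \<phi> by (intro divide_right_mono diff_right_mono) auto
    finally show ?thesis by simp
  qed
  have "\<alpha> / 2 * (1 / p) * ?l ?m \<le> (1 + \<delta>) * card (index_sets p ?n) / \<phi>
    + 2 * psi_second_bound \<Lambda> / ?l ?m + 2 * \<alpha> * (?n * (K * (M * (1 + K) / f0)))"
  proof (rule pogorelov_algebra[where q = q and P = P and u = U and r = r and R = R and s = s and \<epsilon> = "\<delta> / (4 + 3 * \<delta>)"])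
    show "(\<Sum>i<?n. ?a i * ((1 + \<delta>) * (r i - (q i)\<^sup>2) + R i / ?l ?m - (P i)\<^sup>2 + 2 * \<alpha> * ((?l i)\<^sup>2 + s i))) \<le> 0"
    proof (intro sum_nonpos mult_nonneg_nonpos)
      fix i assume "i \<in> {..<?n}"
      then have i: "i < ?n" by simp
      show "0 \<le> ?a i" using amin[OF i] am by linarith
      show "(1 + \<delta>) * (r i - (q i)\<^sup>2) + R i / ?l ?m - (P i)\<^sup>2 + 2 * \<alpha> * ((?l i)\<^sup>2 + s i) \<le> 0"
        using deriv_test[OF i] by (simp add: \<Lambda>_def)
    qed
    show "\<bar>q i\<bar> \<le> K / \<phi>" if "i < ?n" for i
      using partial_bounds(2)[OF x0 ne[OF that]] \<phi> by (simp add: q_def abs_div divide_right_mono)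
    show "\<bar>U i\<bar> \<le> K" if "i < ?n" for i
      using partial_bounds(1)[OF x0 ne[OF that]] by (simp add: U_def)
    show "?l i \<le> ?l ?m" if "i < ?n" for i by (rule eig_mono[OF x0]) (use that in auto)
  qed (use m \<delta> K \<alpha> \<Lambda> am amin top \<phi> large deriv_test E3 E4 E5 in \<open>auto simp: \<Lambda>_def \<phi>_def\<close>)
  then show ?thesis by (simp add: \<phi>_def \<Lambda>_def)
qed

end

section \<open>The global estimate\<close>

context touching_barrier
begin

section \<open>An a priori bound for the gap between u and w\<close>

definition "trace_floor = min 1 f0 / (4 * p)"

lemma trace_floor_pos: "trace_floor > 0"
  using f0(1) p by (simp add: trace_floor_def)

lemma increment_le:
  assumes xy: "cball x r \<subseteq> \<Omega>" "dist x y \<le> r"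
  shows "u y - u x \<le> K * dist x y"
proof -
  have in\<Omega>: "x + t *\<^sub>R (y - x) \<in> \<Omega>" if "0 \<le> t" "t \<le> 1" for t
  proof -
    have "dist x (x + t *\<^sub>R (y - x)) = t * dist x y" using that by (simp add: dist_norm norm_minus_commute)
    also have "\<dots> \<le> 1 * dist x y" using that by (intro mult_right_mono) auto
    finally show ?thesis using xy by auto
  qed
  have u1: "u differentiable at z" if "z \<in> \<Omega>" for z
    using Ck_u[of 1] that by simp
  have "\<exists>t>0. t < 1 \<and> u (x + 1 *\<^sub>R (y - x)) - u (x + 0 *\<^sub>R (y - x))
      = (1 - 0) * partial_deriv (y - x) u (x + t *\<^sub>R (y - x))"
    by (rule MVT2) (auto intro!: has_real_derivative_line u1 in\<Omega>)
  then obtain t where t: "0 < t" "t < 1" "u y - u x = partial_deriv (y - x) u (x + t *\<^sub>R (y - x))"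
    by auto
  have "u y - u x \<le> \<bar>grad u (x + t *\<^sub>R (y - x)) \<bullet> (y - x)\<bar>"
    using t in\<Omega>[of t] by (simp add: partial_deriv_grad[OF u1])
  also have "\<dots> \<le> norm (grad u (x + t *\<^sub>R (y - x))) * norm (y - x)" by (rule Cauchy_Schwarz_ineq2)
  also have "\<dots> \<le> K * norm (y - x)"
    using grad_bounds[OF in\<Omega>[of t]] t by (intro mult_right_mono) auto
  finally show ?thesis by (simp add: dist_norm norm_minus_commute)
qed

text \<open>The paraboloid of opening twice the trace floor cannot touch u from above, since
  the product of the p-fold eigenvalue sums would then be smaller than f0.\<close>
lemma ball_radius_le:
  assumes r: "r > 0" "cball x0 r \<subseteq> \<Omega>"
  shows "r \<le> K / trace_floor"
proof -
  define h where "h x = u x - trace_floor * ((x - x0) \<bullet> (x - x0))" for x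
  have "continuous_on (cball x0 r) h"
    unfolding h_def[abs_def]
    by (intro continuous_intros continuous_on_subset[OF cu]) (use r closure_subset in auto)
  then obtain x1 where x1: "x1 \<in> cball x0 r" and max: "\<And>y. y \<in> cball x0 r \<Longrightarrow> h y \<le> h x1"
    using continuous_attains_sup[of "cball x0 r" h] r by auto
  have x1\<Omega>: "x1 \<in> \<Omega>" using x1 r by auto
  have "x1 \<notin> ball x0 r"
  proof
    assume x1b: "x1 \<in> ball x0 r"
    obtain e where e: "orthonormal_frame e"
      "\<And>i j. i < CARD('n) \<Longrightarrow> j < CARD('n) \<Longrightarrow>
        partial_deriv (e i) (partial_deriv (e j) u) x1 = (if i = j then eig x1 i else 0)"
      using eigenframe[OF x1\<Omega>] by blast
    have eig_le: "eig x1 i \<le> 2 * trace_floor" if i: "i < CARD('n)" for i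
    proof -
      have ee: "e i \<bullet> e i = 1" using orthonormal_frameD(1)[OF e(1)] i by simp
      let ?c = "(x1 - x0) \<bullet> (x1 - x0)" and ?b = "(x1 - x0) \<bullet> e i"
      have quad: "(x1 + t *\<^sub>R e i - x0) \<bullet> (x1 + t *\<^sub>R e i - x0) = ?c + 2 * ?b * t + t\<^sup>2" for t
        by (simp add: inner_add_left inner_add_right inner_diff_left inner_diff_right ee
            inner_commute algebra_simps power2_eq_square)
      have "has_deriv2 (\<lambda>t. (x1 + t *\<^sub>R e i - x0) \<bullet> (x1 + t *\<^sub>R e i - x0)) (2 * ?b) 2"
        unfolding quad
        by (rule has_deriv2_explicit[where g' = "\<lambda>t. 2 * ?b + 2 * t"]) (auto intro!: derivative_eq_intros)
      then have "has_deriv2 (\<lambda>t. h (x1 + t *\<^sub>R e i)) (partial_deriv (e i) u x1 - trace_floor * (2 * ?b))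
          (partial_deriv (e i) (partial_deriv (e i) u) x1 - trace_floor * 2)"
        unfolding h_def
        by (intro has_deriv2_diff has_deriv2_cmult has_deriv2_line[OF op Ck_u x1\<Omega>]) simp_all
      moreover have "\<forall>\<^sub>F t in nhds 0. h (x1 + t *\<^sub>R e i) \<le> h (x1 + 0 *\<^sub>R e i)"
        using eventually_line_in_open[OF open_ball x1b, of "e i"]
        by eventually_elim (use max in auto)
      ultimately have "partial_deriv (e i) (partial_deriv (e i) u) x1 - trace_floor * 2 \<le> 0"
        by (rule has_deriv2_local_max(2))
      then show ?thesis using e(2)[OF i i] by simp
    qed
    have N: "1 \<le> card (index_sets p CARD('n))"
    proof -
      have "{..<p} \<in> index_sets p CARD('n)" using p by (auto simp: index_sets_def)
      then have "0 < card (index_sets p CARD('n))" by (auto simp: card_gt_0_iff)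
      then show ?thesis by simp
    qed
    have "f (x1, u x1) = (\<Prod>I\<in>index_sets p CARD('n). \<Sum>i\<in>I. eig x1 i)"
      using eq[OF x1\<Omega>] by (simp add: M_op_index_sets)
    \<comment> \<open>This is where the constant in \<open>trace_floor\<close> comes from:
      eigenvalues up to 2 * \<open>trace_floor\<close> make each p-fold sum at most min 1 f0 / 2.
      There is at least one factor and this bound is below 1, so the product is at most min 1 f0 / 2
      < f0.\<close>
    also have "\<dots> \<le> (\<Prod>I\<in>index_sets p CARD('n). min 1 f0 / 2)"
    proof (rule prod_mono, rule conjI)
      fix I assume I: "I \<in> index_sets p CARD('n)"
      then show "0 \<le> (\<Sum>i\<in>I. eig x1 i)" using eig_sum_pos[OF x1\<Omega> I] by simp
      have "(\<Sum>i\<in>I. eig x1 i) \<le> of_nat (card I) * (2 * trace_floor)"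
        by (rule sum_bounded_above) (use I eig_le in \<open>auto dest!: index_setsD\<close>)
      also have "\<dots> = min 1 f0 / 2"
        using index_setsD[OF I] p by (simp add: trace_floor_def)
      finally show "(\<Sum>i\<in>I. eig x1 i) \<le> min 1 f0 / 2" .
    qed
    also have "\<dots> = (min 1 f0 / 2) ^ card (index_sets p CARD('n))" by simp
    also have "\<dots> \<le> (min 1 f0 / 2) ^ 1"
      using f0(1) by (intro power_decreasing N) auto
    also have "\<dots> < f0" using f0(1) by auto
    finally show False using f0(2)[of "(x1, u x1)"] x1\<Omega> by simp
  qed
  \<comment> \<open>The maximum lies on the sphere. Between the centre and x1, u has grown by at
    least \<open>trace_floor\<close> * r^2, while the gradient bound allows only K * r.\<close>
  then have d: "dist x0 x1 = r" using x1 by auto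
  have "h x0 \<le> h x1" using max[of x0] r by simp
  then have "trace_floor * r\<^sup>2 \<le> u x1 - u x0"
    using d by (simp add: h_def dist_norm norm_minus_commute flip: power2_norm_eq_inner)
  also have "\<dots> \<le> K * r" using increment_le[OF r(2), of x1] d by simp
  finally have "trace_floor * r \<le> K" using r(1) by (simp add: power2_eq_square)
  then show ?thesis using trace_floor_pos by (simp add: field_simps)
qed

text \<open>The ball reaching to the nearest boundary point z lies in the domain, so its radius is
  bounded by data, unlike the diameter of the domain. Along the segment to z the gap falls to 0 with
  slope at most K.\<close>

lemma gap_le:
  assumes x0: "x0 \<in> \<Omega>"
  shows "w x0 - u x0 \<le> K * (K / trace_floor)"
proof -
  have "\<Omega> \<noteq> UNIV" using bdd not_bounded_UNIV by blast
  then have ne: "frontier \<Omega> \<noteq> {}" using x0 frontier_not_empty by blast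
  obtain z where z: "z \<in> frontier \<Omega>" "\<And>y. y \<in> frontier \<Omega> \<Longrightarrow> dist x0 z \<le> dist x0 y"
    using distance_attains_inf[OF frontier_closed ne, of x0] by blast
  define r where "r = dist x0 z"
  have "z \<notin> \<Omega>" using z(1) op by (simp add: frontier_def interior_open)
  then have r: "r > 0" using x0 by (auto simp: r_def)
  have ball: "ball x0 r \<subseteq> \<Omega>"
  proof (rule ccontr)
    assume "\<not> ball x0 r \<subseteq> \<Omega>"
    then have "ball x0 r \<inter> frontier \<Omega> \<noteq> {}"
      using x0 r by (intro connected_Int_frontier) (auto intro: centre_in_ball[THEN iffD2])
    then show False using z(2) by (fastforce simp: r_def)
  qed
  \<comment> \<open>\<open>ball_radius_le\<close> requires a closed ball inside the domain, and the
    closed ball of radius r contains z; so slightly smaller radii are used.\<close>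
  have r_le: "r \<le> K / trace_floor"
  proof (rule field_le_epsilon)
    fix \<epsilon> :: real assume \<epsilon>: "\<epsilon> > 0"
    define r' where "r' = max (r / 2) (r - \<epsilon>)"
    have r': "0 < r'" "r' < r" "r - \<epsilon> \<le> r'" using r \<epsilon> by (auto simp: r'_def)
    have "cball x0 r' \<subseteq> \<Omega>" using ball r'(2) by (auto simp: subset_eq)
    from ball_radius_le[OF r'(1) this] show "r \<le> K / trace_floor + \<epsilon>" using r'(3) by linarith
  qed
  define \<phi> where "\<phi> t = w (x0 + t *\<^sub>R (z - x0)) - u (x0 + t *\<^sub>R (z - x0))" for t
  have in\<Omega>: "x0 + t *\<^sub>R (z - x0) \<in> \<Omega>" if "0 \<le> t" "t < 1" for t
  proof -
    have "dist x0 (x0 + t *\<^sub>R (z - x0)) = t * r" using that by (simp add: r_def dist_norm norm_minus_commute)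
    also have "\<dots> < 1 * r" using that r by (intro mult_strict_right_mono) auto
    finally show ?thesis using ball by auto
  qed
  have diffs: "u differentiable at y" "w differentiable at y" if "y \<in> \<Omega>" for y
    using Ck_u[of 2] Ck_w that by (auto simp: numeral_2_eq_2)
  have deriv: "(\<phi> has_real_derivative partial_deriv (z - x0) w (x0 + t *\<^sub>R (z - x0))
      - partial_deriv (z - x0) u (x0 + t *\<^sub>R (z - x0))) (at t)" if "0 < t" "t < 1" for t
    unfolding \<phi>_def[abs_def] using that
    by (intro DERIV_diff has_real_derivative_line diffs in\<Omega>) auto
  have clos: "x0 + t *\<^sub>R (z - x0) \<in> closure \<Omega>" if "0 \<le> t" "t \<le> 1" for t
  proof (cases "t = 1")
    case True
    then show ?thesis using z(1) by (simp add: frontier_def)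
  next
    case False
    then show ?thesis using in\<Omega>[of t] that closure_subset by auto
  qed
  have "continuous_on {0..1} \<phi>"
    unfolding \<phi>_def[abs_def]
    by (intro continuous_on_diff continuous_on_compose2[OF cw] continuous_on_compose2[OF cu] continuous_intros)
      (use clos in auto)
  moreover have "\<phi> differentiable (at t)" if "0 < t" "t < 1" for t
    using deriv[OF that] real_differentiable_def by blast
  ultimately obtain l t where t: "0 < t" "t < 1" "(\<phi> has_real_derivative l) (at t)" "\<phi> 1 - \<phi> 0 = (1 - 0) * l"
    using MVT[of 0 1 \<phi>] by auto
  let ?y = "x0 + t *\<^sub>R (z - x0)"
  have y: "?y \<in> \<Omega>" using in\<Omega> t by simp
  have l: "l = (grad w ?y - grad u ?y) \<bullet> (z - x0)"
    using DERIV_unique[OF t(3) deriv[OF t(1,2)]] by (simp add: partial_deriv_grad diffs y inner_diff_left)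
  have "\<bar>l\<bar> \<le> norm (grad w ?y - grad u ?y) * norm (z - x0)"
    unfolding l by (rule Cauchy_Schwarz_ineq2)
  also have "\<dots> \<le> K * r"
  proof (rule mult_mono)
    show "norm (grad w ?y - grad u ?y) \<le> K"
      using norm_triangle_ineq4[of "grad w ?y" "grad u ?y"] K(2)[OF y] by linarith
  qed (use K in \<open>auto simp: r_def dist_norm norm_minus_commute\<close>)
  also have "\<dots> \<le> K * (K / trace_floor)" using r_le K by (intro mult_left_mono) auto
  finally have "\<bar>l\<bar> \<le> K * (K / trace_floor)" .
  moreover have "w x0 - u x0 = - l" using t(4) bc[OF z(1)] by (simp add: \<phi>_def)
  ultimately show ?thesis by linarith
qed

text \<open>The largest value allowed by the smallness condition on \<alpha> in
  \<open>pogorelov_algebra\<close>.\<close>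

definition pogorelov_\<alpha> :: "real \<Rightarrow> real" where
  "pogorelov_\<alpha> \<delta> = 1 / (64 * real CARD('n) * K\<^sup>2 * (1 + 2 / \<delta>))"

text \<open>A sum over three regimes. If (w - u) \<Lambda> is too small for the algebra, then y
  \<le> 1 + y^2 gives the first two summands; if \<Lambda> < 1, the bound \<Phi> for the gap
  suffices; otherwise the algebra gives the last summand, where G collects the errors from ln f(x, u
  x) and its first and second order expansion.\<close>

definition pogorelov_Q :: "real \<Rightarrow> real" where
  "pogorelov_Q \<delta> = (
  let \<alpha> = pogorelov_\<alpha> \<delta>; \<Phi> = K * (K / trace_floor);
    G = 2 * ((M * (1 + K)\<^sup>2 + M) / f0 + (M * (1 + K))\<^sup>2 / f0\<^sup>2 + M / f0)
      + 2 * \<alpha> * (real CARD('n) * (K * (M * (1 + K) / f0)))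
  in 1 + 16 * real CARD('n) * (1 + \<delta>)\<^sup>2 * K\<^sup>2 / (\<alpha> * (\<delta> / (4 + 3 * \<delta>))\<^sup>2) + \<Phi>
    + 2 * real p / \<alpha> * ((1 + \<delta>) * real (card (index_sets p CARD('n))) + G * \<Phi>))"

lemma pogorelov_alpha_pos: "\<delta> > 0 \<Longrightarrow> pogorelov_\<alpha> \<delta> > 0"
  using K(1) by (simp add: pogorelov_\<alpha>_def add_pos_pos)

lemma gap_times_top_eigenvalue_le:
  assumes x0: "x0 \<in> \<Omega>" and e: "orthonormal_frame e"
    and diag: "\<And>i j. i < CARD('n) \<Longrightarrow> j < CARD('n) \<Longrightarrow>
      partial_deriv (e i) (partial_deriv (e j) u) x0 = (if i = j then eig x0 i else 0)"
    and \<delta>: "\<delta> > 0"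
    and max: "\<And>x. x \<in> \<Omega> \<Longrightarrow>
      (w x - u x) powr (1 + \<delta>) * partial_deriv (e (CARD('n) - 1)) (partial_deriv (e (CARD('n) - 1)) u) x
        * exp (pogorelov_\<alpha> \<delta> * (norm (grad u x))\<^sup>2)
      \<le> (w x0 - u x0) powr (1 + \<delta>) * eig x0 (CARD('n) - 1) * exp (pogorelov_\<alpha> \<delta> * (norm (grad u x0))\<^sup>2)"
  shows "(w x0 - u x0) * eig x0 (CARD('n) - 1) \<le> pogorelov_Q \<delta>"
proof -
  define \<alpha> where "\<alpha> = pogorelov_\<alpha> \<delta>"
  define \<phi> where "\<phi> = w x0 - u x0"
  define \<Lambda> where "\<Lambda> = eig x0 (CARD('n) - 1)"
  define \<Phi> where "\<Phi> = K * (K / trace_floor)"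
  define D where "D = CARD('n) * (K * (M * (1 + K) / f0))"
  define c1 where "c1 = (M * (1 + K)\<^sup>2 + M) / f0 + (M * (1 + K))\<^sup>2 / f0\<^sup>2"
  define G where "G = 2 * (c1 + M / f0) + 2 * \<alpha> * D"
  define N where "N = (1 + \<delta>) * card (index_sets p CARD('n))"
  define A where "A = 16 * real CARD('n) * (1 + \<delta>)\<^sup>2 * K\<^sup>2"
  define B where "B = \<alpha> * (\<delta> / (4 + 3 * \<delta>))\<^sup>2"
  have \<alpha>: "\<alpha> > 0" using pogorelov_alpha_pos[OF \<delta>] by (simp add: \<alpha>_def)
  have B: "B > 0" using \<alpha> \<delta> by (simp add: B_def)
  have Q: "pogorelov_Q \<delta> = 1 + A / B + \<Phi> + 2 * p / \<alpha> * (N + G * \<Phi>)"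
    by (simp add: pogorelov_Q_def Let_def \<alpha>_def \<Phi>_def D_def c1_def G_def N_def A_def B_def)
  have K0: "K \<ge> 0" using K(1) by simp
  have \<phi>: "\<phi> > 0" "\<phi> \<le> \<Phi>" using wu[OF x0] gap_le[OF x0] by (simp_all add: \<phi>_def \<Phi>_def)
  have \<Lambda>: "\<Lambda> > 0"
    unfolding \<Lambda>_def using log_weight_top(1)[OF eig_mono[OF x0] eig_sum_pos[OF x0] p] .
  have c1: "c1 \<ge> 0" "D \<ge> 0" "M / f0 \<ge> 0" using M(1) K0 f0(1) by (auto simp: c1_def D_def)
  then have G: "G \<ge> 0" using \<alpha> by (simp add: G_def)
  have N: "N \<ge> 0" using \<delta> by (simp add: N_def)
  have A: "A \<ge> 0" by (simp add: A_def)
  have last: "2 * p / \<alpha> * (N + G * \<Phi>) \<ge> 0" using \<alpha> N G \<phi> by simp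
  have AB: "A / B \<ge> 0" using A B by simp
  consider "B * \<phi>\<^sup>2 * \<Lambda>\<^sup>2 < A" | "\<Lambda> < 1" | "A \<le> B * \<phi>\<^sup>2 * \<Lambda>\<^sup>2" "\<Lambda> \<ge> 1" by linarith
  then have "\<phi> * \<Lambda> \<le> 1 + A / B + \<Phi> + 2 * p / \<alpha> * (N + G * \<Phi>)"
  proof cases
    case 1
    then have "(\<phi> * \<Lambda>)\<^sup>2 \<le> A / B" using B by (simp add: power_mult_distrib field_simps)
    moreover have "\<phi> * \<Lambda> \<le> 1 + (\<phi> * \<Lambda>)\<^sup>2"
      using zero_le_power2[of "\<phi> * \<Lambda> - 1"] mult_pos_pos[OF \<phi>(1) \<Lambda>]
      by (simp add: power2_diff)
    ultimately show ?thesis using last \<phi> by linarith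
  next
    case 2
    then have "\<phi> * \<Lambda> \<le> \<phi> * 1" using \<phi> by (intro mult_left_mono) auto
    then show ?thesis using last \<phi> AB by linarith
  next
    case 3
    have \<alpha>2: "64 * real CARD('n) * K\<^sup>2 * (1 + 2 / \<delta>) * \<alpha> \<le> 1"
    proof -
      have "64 * real CARD('n) * K\<^sup>2 * (1 + 2 / \<delta>) > 0"
        using K(1) \<delta> by (simp add: add_pos_pos)
      then show ?thesis by (simp add: \<alpha>_def pogorelov_\<alpha>_def)
    qed
    have "\<alpha> / 2 * (1 / p) * \<Lambda> \<le> N / \<phi> + 2 * psi_second_bound \<Lambda> / \<Lambda> + 2 * \<alpha> * D"
      unfolding \<Lambda>_def \<phi>_def N_def D_def
      by (rule max_point_bound[OF x0 e diag \<delta> \<alpha> \<alpha>2 max[folded \<alpha>_def]])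
        (use 3 in \<open>simp_all add: A_def B_def \<phi>_def \<Lambda>_def\<close>)
    moreover have "2 * psi_second_bound \<Lambda> / \<Lambda> \<le> 2 * (c1 + M / f0)"
    proof -
      have "psi_second_bound \<Lambda> = c1 + M / f0 * \<Lambda>"
        by (simp add: psi_second_bound_def c1_def add_divide_distrib algebra_simps)
      also have "\<dots> \<le> c1 * \<Lambda> + M / f0 * \<Lambda>" using c1 3 by (simp add: mult_le_cancel_left1)
      finally have "psi_second_bound \<Lambda> \<le> (c1 + M / f0) * \<Lambda>" by (simp only: distrib_right)
      then have "psi_second_bound \<Lambda> / \<Lambda> \<le> c1 + M / f0" using \<Lambda> by (simp only: divide_le_eq if_True)
      then show ?thesis by simp
    qed
    ultimately have "\<alpha> / 2 * (1 / p) * \<Lambda> \<le> N / \<phi> + G" by (simp add: G_def)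
    then have "\<phi> * (\<alpha> / 2 * (1 / p) * \<Lambda>) \<le> \<phi> * (N / \<phi> + G)" using \<phi> by (intro mult_left_mono) auto
    also have "\<dots> = N + G * \<phi>" using \<phi> by (simp add: field_simps)
    also have "\<dots> \<le> N + G * \<Phi>" using \<phi> G by (intro add_left_mono mult_left_mono) auto
    finally have "\<phi> * \<Lambda> \<le> 2 * p / \<alpha> * (N + G * \<Phi>)" using \<alpha> p by (simp add: field_simps)
    then show ?thesis using AB \<phi> by linarith
  qed
  then show ?thesis by (simp add: Q \<phi>_def \<Lambda>_def)
qed

section \<open>Existence of the maximum and the final bound\<close>

lemma continuous_on_test_function:
  "continuous_on (\<Omega> \<times> UNIV)
    (\<lambda>(x, \<xi>). (w x - u x) powr \<beta> * ((hessian u x *v \<xi>) \<bullet> \<xi>) * exp (\<alpha> * (norm (grad u x))\<^sup>2))"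
proof -
  let ?S = "\<Omega> \<times> (UNIV :: (real^'n) set)"
  have fst: "continuous_on ?S (\<lambda>z. g (fst z))" if "continuous_on \<Omega> g" for g :: "real^'n \<Rightarrow> real"
    by (rule continuous_on_compose2[OF that]) (auto intro!: continuous_intros)
  have D1: "continuous_on \<Omega> (partial_deriv b u)" for b
    using Ck_on_partial_deriv[OF op Ck_u[of "Suc 0"], of b] Ck_on_imp_continuous_on by auto
  have D2: "continuous_on \<Omega> (partial_deriv b (partial_deriv b' u))" for b b'
  proof -
    have "Ck_on 0 \<Omega> (partial_deriv b (partial_deriv b' u))"
      by (intro Ck_on_partial_deriv op) (use Ck_u[of 2] in \<open>simp add: numeral_2_eq_2 del: Ck_on.simps\<close>)
    then show ?thesis by simp
  qed
  have cl: "continuous_on \<Omega> u" "continuous_on \<Omega> w"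
    using cu cw closure_subset continuous_on_subset by blast+
  have "continuous_on ?S (\<lambda>z. (w (fst z) - u (fst z)) powr \<beta>)"
    by (intro continuous_on_powr continuous_on_diff fst cl continuous_on_const) (auto dest: wu)
  moreover have "continuous_on ?S (\<lambda>z. (hessian u (fst z) *v snd z) \<bullet> snd z)"
    unfolding matrix_vector_mult_def hessian_def inner_vec_def
    by (simp add: inner_real_def) (intro continuous_intros fst D2)
  moreover have "continuous_on ?S (\<lambda>z. exp (\<alpha> * (norm (grad u (fst z)))\<^sup>2))"
    unfolding grad_def by (intro continuous_intros fst D1)
  ultimately show ?thesis
    unfolding case_prod_unfold by (intro continuous_on_mult)
qed

text \<open>D^2 u has no boundary values, so attaining the maximum takes an argument: the Lipschitz
  bound of Du keeps the quadratic form below L, and the weight (w - u)^(1 + \<delta>) vanishes on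
  the boundary. L affects c0 and the compact set T, but not the bound.\<close>

lemma quadratic_form_estimate:
  assumes \<delta>: "\<delta> > 0" and x1: "x1 \<in> \<Omega>" and \<xi>1: "norm \<xi>1 = 1"
  shows "(w x1 - u x1) powr (1 + \<delta>) * ((hessian u x1 *v \<xi>1) \<bullet> \<xi>1)
    \<le> (K * (K / trace_floor)) powr \<delta> * pogorelov_Q \<delta> * exp (pogorelov_\<alpha> \<delta> * K\<^sup>2)" (is "?lhs \<le> ?C")
proof -
  define \<alpha> where "\<alpha> = pogorelov_\<alpha> \<delta>"
  have \<alpha>: "\<alpha> > 0" using pogorelov_alpha_pos[OF \<delta>] by (simp add: \<alpha>_def)
  define \<phi> where "\<phi> x = (w x - u x) powr (1 + \<delta>)" for x
  define F where "F = (\<lambda>(x, \<xi>). \<phi> x * ((hessian u x *v \<xi>) \<bullet> \<xi>) * exp (\<alpha> * (norm (grad u x))\<^sup>2))"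
  have \<phi>pos: "\<phi> x > 0" if "x \<in> \<Omega>" for x using wu[OF that] by (simp add: \<phi>_def)
  have exp_le: "exp (\<alpha> * (norm (grad u x))\<^sup>2) \<le> exp (\<alpha> * K\<^sup>2)" if "x \<in> \<Omega>" for x
    using grad_bounds[OF that] \<alpha> by (simp add: power_mono)
  have Q0: "pogorelov_Q \<delta> \<ge> 0"
  proof -
    have "0 \<le> trace_floor" "0 \<le> pogorelov_\<alpha> \<delta>"
      using trace_floor_pos pogorelov_alpha_pos[OF \<delta>] by simp_all
    then show ?thesis
      using K(1) M(1) f0(1) \<delta> by (simp add: pogorelov_Q_def Let_def)
  qed
  have C0: "?C \<ge> 0" using Q0 by simp
  have H: "(hessian u x *v \<xi>) \<bullet> \<xi> = partial_deriv \<xi> (partial_deriv \<xi> u) x" if "x \<in> \<Omega>" for x \<xi>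
    by (rule hessian_bilinear[OF op Ck_u that]) simp
  show ?thesis
  proof (cases "F (x1, \<xi>1) > 0")
    case False
    then have "\<phi> x1 * ((hessian u x1 *v \<xi>1) \<bullet> \<xi>1) \<le> 0" by (simp add: F_def not_less mult_le_0_iff)
    then show ?thesis using C0 by (simp add: \<phi>_def)
  next
    case True
    obtain L where L: "L-lipschitz_on \<Omega> (grad u)" using lip by auto
    have L0: "L \<ge> 0" by (rule lipschitz_on_nonneg[OF L])
    \<comment> \<open>Where the weight is at most c0, the test function is at most c0 * (L + 1) *
      exp (\<alpha> * K^2), which is its value at the given point. L + 1 keeps the denominator
      positive when L = 0.\<close>
    define c0 where "c0 = F (x1, \<xi>1) / ((L + 1) * exp (\<alpha> * K\<^sup>2))"
    have c0: "c0 > 0" using True L0 by (simp add: c0_def)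
    have HL: "(hessian u x *v \<xi>) \<bullet> \<xi> \<le> L" if "x \<in> \<Omega>" "norm \<xi> = 1" for x \<xi>
      unfolding H[OF that(1)] by (rule grad_lipschitz_second_deriv_le[OF op Ck_u L that]) simp
    have small: "F (x, \<xi>) \<le> F (x1, \<xi>1)" if "x \<in> \<Omega>" "norm \<xi> = 1" "\<phi> x \<le> c0" for x \<xi>
    proof -
      have "F (x, \<xi>) \<le> \<phi> x * (L + 1) * exp (\<alpha> * (norm (grad u x))\<^sup>2)"
        unfolding F_def using HL[OF that(1,2)] \<phi>pos[OF that(1)]
        by (auto intro!: mult_right_mono mult_left_mono)
      also have "\<dots> \<le> c0 * (L + 1) * exp (\<alpha> * K\<^sup>2)"
        using that(3) exp_le[OF that(1)] L0 c0 \<phi>pos[OF that(1)] by (intro mult_mono) auto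
      also have "\<dots> = F (x1, \<xi>1)" using L0 by (simp add: c0_def)
      finally show ?thesis .
    qed
    \<comment> \<open>This superlevel set is closed in the closure of \<Omega> and avoids the
      frontier, where the weight is 0. It is thus a compact subset of \<Omega>.\<close>
    define T where "T = closure \<Omega> \<inter> \<phi> -` {c0..}"
    have gap0: "w x - u x \<ge> 0" if "x \<in> closure \<Omega>" for x
    proof (cases "x \<in> \<Omega>")
      case False
      then have "x \<in> frontier \<Omega>" using that op by (simp add: frontier_def interior_open)
      then show ?thesis using bc by simp
    qed (use wu in force)
    have "continuous_on (closure \<Omega>) \<phi>"
      unfolding \<phi>_def[abs_def]
      by (intro continuous_on_powr' continuous_on_diff cw cu continuous_on_const) (use gap0 \<delta> in auto)
    then have "closed T" unfolding T_def
      by (rule continuous_closed_preimage) auto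
    moreover have "bounded T" unfolding T_def using bdd bounded_closure bounded_subset by blast
    ultimately have "compact T" by (simp add: compact_eq_bounded_closed)
    then have cT: "compact (T \<times> sphere (0 :: real^'n) 1)" by (intro compact_Times) auto
    have T\<Omega>: "x \<in> \<Omega>" if "x \<in> T" for x
    proof (rule ccontr)
      assume "x \<notin> \<Omega>"
      then have "x \<in> frontier \<Omega>" using that op by (auto simp: T_def frontier_def interior_open)
      then have "\<phi> x = 0" using bc by (simp add: \<phi>_def)
      then show False using that c0 by (simp add: T_def)
    qed
    have "x1 \<in> T"
    proof (rule ccontr)
      assume "x1 \<notin> T"
      then have "\<phi> x1 < c0" using x1 closure_subset by (auto simp: T_def)
      have "F (x1, \<xi>1) \<le> \<phi> x1 * (L + 1) * exp (\<alpha> * K\<^sup>2)"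
      proof -
        have "F (x1, \<xi>1) \<le> \<phi> x1 * (L + 1) * exp (\<alpha> * (norm (grad u x1))\<^sup>2)"
          unfolding F_def using HL[OF x1 \<xi>1] \<phi>pos[OF x1] by (auto intro!: mult_right_mono mult_left_mono)
        also have "\<dots> \<le> \<phi> x1 * (L + 1) * exp (\<alpha> * K\<^sup>2)"
          using exp_le[OF x1] L0 \<phi>pos[OF x1] by (intro mult_left_mono) auto
        finally show ?thesis .
      qed
      also have "\<dots> < c0 * (L + 1) * exp (\<alpha> * K\<^sup>2)"
        using \<open>\<phi> x1 < c0\<close> L0 by (intro mult_strict_right_mono) auto
      also have "\<dots> = F (x1, \<xi>1)" using L0 by (simp add: c0_def)
      finally show False by simp
    qed
    have "continuous_on (T \<times> sphere 0 1) F"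
      unfolding F_def \<phi>_def
      by (rule continuous_on_subset[OF continuous_on_test_function]) (use T\<Omega> in auto)
    moreover have "(x1, \<xi>1) \<in> T \<times> sphere 0 1" using \<open>x1 \<in> T\<close> \<xi>1 by simp
    then have "T \<times> sphere (0 :: real^'n) 1 \<noteq> {}" by blast
    ultimately obtain z where z: "z \<in> T \<times> sphere 0 1" "\<And>y. y \<in> T \<times> sphere 0 1 \<Longrightarrow> F y \<le> F z"
      using continuous_attains_sup[OF cT] by blast
    obtain x0 \<xi>0 where z_eq: "z = (x0, \<xi>0)" by (cases z)
    have x0: "x0 \<in> \<Omega>" and \<xi>0: "norm \<xi>0 = 1" using z(1) T\<Omega> by (auto simp: z_eq)
    have max: "F (x, \<xi>) \<le> F (x0, \<xi>0)" if "x \<in> \<Omega>" "norm \<xi> = 1" for x \<xi>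
    proof (cases "x \<in> T")
      case True
      then show ?thesis using z(2)[of "(x, \<xi>)"] that by (simp add: z_eq)
    next
      case False
      then have "\<phi> x \<le> c0" using that closure_subset by (auto simp: T_def)
      then have "F (x, \<xi>) \<le> F (x1, \<xi>1)" by (rule small[OF that])
      also have "\<dots> \<le> F (x0, \<xi>0)" using z(2)[of "(x1, \<xi>1)"] \<open>x1 \<in> T\<close> \<xi>1 by (simp add: z_eq)
      finally show ?thesis .
    qed
    let ?m = "CARD('n) - 1"
    have "(hessian u x0 *v \<xi>0) \<bullet> \<xi>0 \<le> eig x0 ?m"
      using quadratic_form_le_top[OF hessian_u_symmetric[OF x0], of \<xi>0] \<xi>0 by (simp add: norm_eq_1)
    \<comment> \<open>The direction \<xi>0 need not be e_m, but the maximal value is at most the one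
      formed with the top eigenvalue. Hence x0 also maximises the test function with direction
      frozen at e_m.\<close>
    then have top: "F (x0, \<xi>0) \<le> \<phi> x0 * eig x0 ?m * exp (\<alpha> * (norm (grad u x0))\<^sup>2)"
      unfolding F_def using \<phi>pos[OF x0] by (auto intro!: mult_right_mono mult_left_mono)
    obtain e where e: "orthonormal_frame e"
      "\<And>i j. i < CARD('n) \<Longrightarrow> j < CARD('n) \<Longrightarrow>
        partial_deriv (e i) (partial_deriv (e j) u) x0 = (if i = j then eig x0 i else 0)"
      using eigenframe[OF x0] by blast
    have "norm (e ?m) = 1" using orthonormal_frameD(2)[OF e(1)] by simp
    have Q: "(w x0 - u x0) * eig x0 ?m \<le> pogorelov_Q \<delta>"
    proof (rule gap_times_top_eigenvalue_le[OF x0 e \<delta>])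
      fix x assume x: "x \<in> \<Omega>"
      show "(w x - u x) powr (1 + \<delta>) * partial_deriv (e ?m) (partial_deriv (e ?m) u) x
          * exp (pogorelov_\<alpha> \<delta> * (norm (grad u x))\<^sup>2)
        \<le> (w x0 - u x0) powr (1 + \<delta>) * eig x0 ?m * exp (pogorelov_\<alpha> \<delta> * (norm (grad u x0))\<^sup>2)"
        using order_trans[OF max[OF x \<open>norm (e ?m) = 1\<close>] top]
        by (simp add: F_def H[OF x] \<phi>_def \<alpha>_def)
    qed
    have gap: "w x0 - u x0 > 0" "w x0 - u x0 \<le> K * (K / trace_floor)"
      using wu[OF x0] gap_le[OF x0] by simp_all
    \<comment> \<open>One factor w - u goes with the top eigenvalue; the remaining power \<delta> is
      controlled by the a priori bound for the gap.\<close>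
    have "\<phi> x0 * eig x0 ?m = (w x0 - u x0) powr \<delta> * ((w x0 - u x0) * eig x0 ?m)"
      using gap by (simp add: \<phi>_def powr_add)
    also have "\<dots> \<le> (K * (K / trace_floor)) powr \<delta> * pogorelov_Q \<delta>"
    proof (rule mult_mono)
      show "(w x0 - u x0) powr \<delta> \<le> (K * (K / trace_floor)) powr \<delta>"
        using gap \<delta> by (intro powr_mono2) auto
      have "eig x0 ?m > 0"
        using log_weight_top(1)[OF eig_mono[OF x0] eig_sum_pos[OF x0] p] .
      then show "0 \<le> (w x0 - u x0) * eig x0 ?m" using gap by simp
    qed (use Q in auto)
    finally have main: "\<phi> x0 * eig x0 ?m \<le> (K * (K / trace_floor)) powr \<delta> * pogorelov_Q \<delta>" .
    have "?lhs \<le> F (x1, \<xi>1)"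
    proof -
      have "0 < \<phi> x1 * ((hessian u x1 *v \<xi>1) \<bullet> \<xi>1)"
        using True by (simp add: F_def zero_less_mult_iff)
      then show ?thesis
        using \<alpha> by (simp add: F_def \<phi>_def mult_le_cancel_left1)
    qed
    also have "\<dots> \<le> \<phi> x0 * eig x0 ?m * exp (\<alpha> * (norm (grad u x0))\<^sup>2)"
      by (rule order_trans[OF max[OF x1 \<xi>1] top])
    also have "\<dots> \<le> ?C"
    proof -
      have "\<phi> x0 * eig x0 ?m * exp (\<alpha> * (norm (grad u x0))\<^sup>2)
        \<le> (K * (K / trace_floor)) powr \<delta> * pogorelov_Q \<delta> * exp (\<alpha> * (norm (grad u x0))\<^sup>2)"
        using main by (intro mult_right_mono) auto
      also have "\<dots> \<le> ?C" unfolding \<alpha>_def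
        using exp_le[OF x0] Q0 by (intro mult_left_mono) (auto simp: \<alpha>_def)
      finally show ?thesis .
    qed
    finally show ?thesis .
  qed
qed

definition pogorelov_const :: "real \<Rightarrow> real" where
  "pogorelov_const \<delta> =
  CARD('n) * (p * ((K * (K / trace_floor)) powr \<delta> * pogorelov_Q \<delta> * exp (pogorelov_\<alpha> \<delta> * K\<^sup>2)))"

text \<open>The factor p passes from the top eigenvalue to the whole spectrum, the factor n from the
  spectrum to the Frobenius norm.\<close>

lemma hessian_estimate:
  assumes \<delta>: "\<delta> > 0" and x: "x \<in> \<Omega>"
  shows "(w x - u x) powr (1 + \<delta>) * norm (hessian u x) \<le> pogorelov_const \<delta>"
proof -
  let ?m = "CARD('n) - 1" and ?g = "(w x - u x) powr (1 + \<delta>)"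
  obtain e where e: "orthonormal_frame e"
    "\<And>i j. i < CARD('n) \<Longrightarrow> j < CARD('n) \<Longrightarrow>
      partial_deriv (e i) (partial_deriv (e j) u) x = (if i = j then eig x i else 0)"
    using eigenframe[OF x] by blast
  have "norm (e ?m) = 1" using orthonormal_frameD(2)[OF e(1)] by simp
  from quadratic_form_estimate[OF \<delta> x this]
  have top: "?g * eig x ?m \<le> (K * (K / trace_floor)) powr \<delta> * pogorelov_Q \<delta> * exp (pogorelov_\<alpha> \<delta> * K\<^sup>2)"
    by (simp add: hessian_bilinear[OF op Ck_u x] e(2))
  have "\<bar>eig x i\<bar> \<le> p * eig x ?m" if "i < CARD('n)" for i
    by (rule p_sum_nonneg_abs_bound[OF eig_mono[OF x] less_imp_le[OF eig_sum_pos[OF x]] p that])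
  from norm_symmetric_le[OF hessian_u_symmetric[OF x] this]
  have "?g * norm (hessian u x) \<le> ?g * (CARD('n) * (p * eig x ?m))"
    by (intro mult_left_mono) auto
  also have "\<dots> = CARD('n) * (p * (?g * eig x ?m))" by simp
  also have "\<dots> \<le> pogorelov_const \<delta>"
    unfolding pogorelov_const_def using top by (intro mult_left_mono) auto
  finally show ?thesis .
qed

end

theorem theorem0p4:
  fixes p :: nat and \<delta> :: real
  assumes "1 < p" and "p < CARD('n)" and "\<delta> > 0"
  shows "\<exists>C :: real \<Rightarrow> real \<Rightarrow> real \<Rightarrow> real.
    \<forall>(\<Omega> :: (real^'n) set) (u :: real^'n \<Rightarrow> real) (w :: real^'n \<Rightarrow> real)
      (f :: (real^'n) \<times> real \<Rightarrow> real) (f0 :: real).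
      open \<Omega> \<and> connected \<Omega> \<and> \<Omega> \<noteq> {} \<and> bounded \<Omega> \<and>
      Ck_on 4 \<Omega> u \<and> C11_closure \<Omega> u \<and> p_plurisubharmonic p \<Omega> u \<and>
      C11_closure (\<Omega> \<times> UNIV) f \<and>
      (\<forall>x\<in>\<Omega>. M_op p u x = f (x, u x)) \<and>
      f0 > 0 \<and> (\<forall>x\<in>closure \<Omega>. \<forall>t. f (x, t) \<ge> f0) \<and>
      p_plurisubharmonic p \<Omega> w \<and> continuous_on (closure \<Omega>) w \<and>
      (\<forall>x\<in>\<Omega>. w x > u x) \<and> (\<forall>x\<in>frontier \<Omega>. w x = u x) \<and>
      bdd_above ((\<lambda>x. norm (grad u x) + norm (grad w x)) ` \<Omega>)
      \<longrightarrow>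
      (\<forall>x\<in>\<Omega>. (w x - u x) powr (1 + \<delta>) * norm (hessian u x)
        \<le> C f0 (SUP x\<in>\<Omega>. norm (grad u x) + norm (grad w x)) (C11_norm (\<Omega> \<times> UNIV) f))"
proof (intro exI[of _ "\<lambda>f0 K M. touching_barrier.pogorelov_const TYPE('n) p f0 (max 1 K) M \<delta>"] allI impI ballI)
  fix \<Omega> :: "(real^'n) set" and u w :: "real^'n \<Rightarrow> real" and f :: "(real^'n) \<times> real \<Rightarrow> real" and f0 :: real and x
  assume asm: "open \<Omega> \<and> connected \<Omega> \<and> \<Omega> \<noteq> {} \<and> bounded \<Omega> \<and>
      Ck_on 4 \<Omega> u \<and> C11_closure \<Omega> u \<and> p_plurisubharmonic p \<Omega> u \<and>
      C11_closure (\<Omega> \<times> UNIV) f \<and>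
      (\<forall>x\<in>\<Omega>. M_op p u x = f (x, u x)) \<and>
      f0 > 0 \<and> (\<forall>x\<in>closure \<Omega>. \<forall>t. f (x, t) \<ge> f0) \<and>
      p_plurisubharmonic p \<Omega> w \<and> continuous_on (closure \<Omega>) w \<and>
      (\<forall>x\<in>\<Omega>. w x > u x) \<and> (\<forall>x\<in>frontier \<Omega>. w x = u x) \<and>
      bdd_above ((\<lambda>x. norm (grad u x) + norm (grad w x)) ` \<Omega>)" and x: "x \<in> \<Omega>"
  let ?K = "SUP x\<in>\<Omega>. norm (grad u x) + norm (grad w x)" and ?M = "C11_norm (\<Omega> \<times> UNIV) f"
  have fC: "C11_closure (\<Omega> \<times> UNIV) f" using asm by blast
  note fb = C11_norm_grad_bounds[OF fC]
  \<comment> \<open>The constant unfolds to a function of n, p, f0, K, M and \<delta>, and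
    \<open>max 1\<close> enforces K \<ge> 1. The Lipschitz property of the gradient is discharged
    here as a bare existence statement, so no value of it enters the constant.\<close>
  interpret touching_barrier p \<Omega> u w f f0 "max 1 ?K" ?M
  proof
    show "norm (grad u y) + norm (grad w y) \<le> max 1 ?K" if "y \<in> \<Omega>" for y
      using cSUP_upper[OF that, of "\<lambda>x. norm (grad u x) + norm (grad w x)"] asm by (simp add: le_max_iff_disj)
    show "?M \<ge> 0" by (rule order_trans[OF norm_ge_zero fb(1)[of "(x, 0)"]]) (use x in simp)
    show "f0 \<le> f y" if "y \<in> \<Omega> \<times> UNIV" for y
      using that asm closure_subset[of \<Omega>] by (cases y) auto
    show "f differentiable at y" if "y \<in> \<Omega> \<times> UNIV" for y
      using that fC by (cases y) (auto simp: C11_closure_def)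
    show "norm (grad f y) \<le> ?M" if "y \<in> \<Omega> \<times> UNIV" for y by (rule fb(1)[OF that])
    show "norm (grad f y - grad f z) \<le> ?M * norm (y - z)" if "y \<in> \<Omega> \<times> UNIV" "z \<in> \<Omega> \<times> UNIV" for y z
      by (rule fb(2)[OF that])
    show "\<exists>L. L-lipschitz_on \<Omega> (grad u)" "continuous_on (closure \<Omega>) u"
      using asm by (auto simp: C11_closure_def)
  qed (use asm assms in auto)
  show "(w x - u x) powr (1 + \<delta>) * norm (hessian u x)
      \<le> touching_barrier.pogorelov_const TYPE('n) p f0 (max 1 ?K) ?M \<delta>"
    by (rule hessian_estimate[OF assms(3) x])
qed

end
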